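(* Let $Y$ be a Banach space of dimension at least two. If $Y$ is a universal BPBp-RSE range space, then $Y$ is uniformly convex and finite dimensional.
   Context: Banach spaces are over $\mathbb K\in\{\mathbb R,\mathbb C\}$ and have dimension at least two; $B_X$, $S_X$ are the closed unit ball and unit sphere of $X$; $\mathbb T=\{\lambda\in\mathbb K:|\lambda|=1\}$; $\mathcal L(X,Y)$ is the space of bounded linear operators. $T\in\mathrm{RSE}(X,Y)$ (range strongly exposing) if there is $x_0\in S_X$ such that whenever $(x_n)\subseteq B_X$ satisfies $\|Tx_n\|\to\|T\|$, there are a subsequence $(x_{\sigma(n)})$ and $\lambda\in\mathbb T$ with $Tx_{\sigma(n)}\to\lambda Tx_0$. The pair $(X,Y)$ has the BPBp-RSE if for every $\varepsilon>0$ there is $0<\eta(\varepsilon)<\varepsilon$ such that for every $T\in\mathcal L(X,Y)$ with $\|T\|=1$ and every $x\in S_X$ with $\|Tx\|>1-\eta(\varepsilon)$, there exist $S\in\mathrm{RSE}(X,Y)$ and $x_0\in S_X$ with $\|S\|=\|Sx_0\|=1$, $\|S-T\|<\varepsilon$ and $\|x-x_0\|<\varepsilon$. $Y$ is a universal BPBp-RSE range space if for every Banach space $Z$ (over the same field) the pair $(Z,Y)$ has the BPBp-RSE. $Y$ is uniformly convex if for every $\varepsilon>0$ there is $0<\delta<1$ such that $y_1,y_2\in S_Y$ and $\|y_1+y_2\|/2>1-\delta$ imply $\|y_1-y_2\|<\varepsilon$. *)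

theory Defs
  imports "HOL-Analysis.Analysis" "Jordan_Normal_Form.VS_Connect"
begin

text \<open>
  Banach spaces are represented by records with an explicit carrier set, so that
  ``for every Banach space'' can occur inside a hypothesis. The scalar field is a type \<open>'k\<close>
  of class \<^class>\<open>real_normed_field\<close>; the theorem uses \<open>'k = real\<close> and \<open>'k = complex\<close>.
  The fields \<open>mult\<close> and \<open>one\<close> that HOL-Algebra's module records inherit from rings are not used.
\<close>

record ('k, 'a) normed_module = "('k, 'a) module" +
  vnorm :: "'a \<Rightarrow> real"

text \<open>Following the standing convention, Banach spaces have dimension at least two.\<close>

locale banach_space =
  V?: vectorspace "class_ring :: 'k::real_normed_field ring" X
  for X :: "('k::real_normed_field, 'a) normed_module" (structure) +
  assumes vnorm_eq_0_iff: "x \<in> carrier X \<Longrightarrow> vnorm X x = 0 \<longleftrightarrow> x = \<zero>\<^bsub>X\<^esub>"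
    and vnorm_smult: "x \<in> carrier X \<Longrightarrow> vnorm X (c \<odot>\<^bsub>X\<^esub> x) = norm c * vnorm X x"
    and vnorm_triangle:
      "\<lbrakk>x \<in> carrier X; y \<in> carrier X\<rbrakk> \<Longrightarrow> vnorm X (x \<oplus>\<^bsub>X\<^esub> y) \<le> vnorm X x + vnorm X y"
    and complete:
      "\<lbrakk>\<And>n::nat. s n \<in> carrier X;
        \<forall>\<epsilon>>0. \<exists>N. \<forall>m\<ge>N. \<forall>n\<ge>N. vnorm X (s m \<ominus>\<^bsub>X\<^esub> s n) < \<epsilon>\<rbrakk>
       \<Longrightarrow> \<exists>l\<in>carrier X. (\<lambda>n. vnorm X (s n \<ominus>\<^bsub>X\<^esub> l)) \<longlonglongrightarrow> 0"
    and dimension_ge_2: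
      "\<exists>u\<in>carrier X. \<exists>v\<in>carrier X. u \<noteq> v \<and> lin_indpt {u, v}"

definition unit_ball :: "('k, 'a) normed_module \<Rightarrow> 'a set" where
  "unit_ball X = {x \<in> carrier X. vnorm X x \<le> 1}"

definition unit_sphere :: "('k, 'a) normed_module \<Rightarrow> 'a set" where
  "unit_sphere X = {x \<in> carrier X. vnorm X x = 1}"

text \<open>Operators are HOL functions of which only the values on the carrier matter.\<close>

definition bounded_op ::
    "('k::real_normed_field, 'a) normed_module \<Rightarrow> ('k, 'b) normed_module \<Rightarrow> ('a \<Rightarrow> 'b) set" where
  "bounded_op X Y = {T. linear_map class_ring X Y T \<and>
     (\<exists>C. \<forall>x\<in>carrier X. vnorm Y (T x) \<le> C * vnorm X x)}"

definition op_norm ::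
    "('k, 'a) normed_module \<Rightarrow> ('k, 'b) normed_module \<Rightarrow> ('a \<Rightarrow> 'b) \<Rightarrow> real" where
  "op_norm X Y T = (SUP x\<in>unit_ball X. vnorm Y (T x))"

definition RSE ::
    "('k::real_normed_field, 'a) normed_module \<Rightarrow> ('k, 'b) normed_module \<Rightarrow> ('a \<Rightarrow> 'b) set" where
  "RSE X Y = {T \<in> bounded_op X Y.
     \<exists>x\<^sub>0\<in>unit_sphere X. \<forall>x :: nat \<Rightarrow> 'a.
       (\<forall>n. x n \<in> unit_ball X) \<and> (\<lambda>n. vnorm Y (T (x n))) \<longlonglongrightarrow> op_norm X Y T \<longrightarrow>
       (\<exists>\<sigma> :: nat \<Rightarrow> nat. \<exists>c :: 'k. strict_mono \<sigma> \<and> norm c = 1 \<and>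
          (\<lambda>n. vnorm Y (T (x (\<sigma> n)) \<ominus>\<^bsub>Y\<^esub> c \<odot>\<^bsub>Y\<^esub> T x\<^sub>0)) \<longlonglongrightarrow> 0)}"

definition BPBp_RSE ::
    "('k::real_normed_field, 'a) normed_module \<Rightarrow> ('k, 'b) normed_module \<Rightarrow> bool" where
  "BPBp_RSE X Y \<longleftrightarrow>
     (\<forall>\<epsilon>>0. \<exists>\<eta>. 0 < \<eta> \<and> \<eta> < \<epsilon> \<and>
       (\<forall>T\<in>bounded_op X Y. \<forall>x\<in>unit_sphere X.
          op_norm X Y T = 1 \<and> vnorm Y (T x) > 1 - \<eta> \<longrightarrow>
          (\<exists>S\<in>RSE X Y. \<exists>x\<^sub>0\<in>unit_sphere X.
             op_norm X Y S = 1 \<and> vnorm Y (S x\<^sub>0) = 1 \<and>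
             op_norm X Y (\<lambda>z. S z \<ominus>\<^bsub>Y\<^esub> T z) < \<epsilon> \<and>
             vnorm X (x \<ominus>\<^bsub>X\<^esub> x\<^sub>0) < \<epsilon>)))"

text \<open>
  HOL cannot quantify over types inside a definition, so \<open>Z\<close> ranges over all Banach spaces,
  with arbitrary operations and norm, whose carrier is a subset of the type \<open>'a\<close> that also
  holds the carrier of \<open>Y\<close>. As \<open>'a\<close> is a type variable and the carrier of \<open>Y\<close> may be any
  subset of it, \<open>'a\<close> can be taken as large as desired. Used as a hypothesis, this is implied by
  quantification over all Banach spaces.
\<close>

definition universal_BPBp_RSE_range :: "('k::real_normed_field, 'a) normed_module \<Rightarrow> bool" where
  "universal_BPBp_RSE_range Y \<longleftrightarrow>
     (\<forall>Z :: ('k, 'a) normed_module. banach_space Z \<longrightarrow> BPBp_RSE Z Y)"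

definition uniformly_convex_space :: "('k, 'a) normed_module \<Rightarrow> bool" where
  "uniformly_convex_space Y \<longleftrightarrow>
     (\<forall>\<epsilon>>0. \<exists>\<delta>. 0 < \<delta> \<and> \<delta> < 1 \<and>
       (\<forall>y\<^sub>1\<in>unit_sphere Y. \<forall>y\<^sub>2\<in>unit_sphere Y.
          vnorm Y (y\<^sub>1 \<oplus>\<^bsub>Y\<^esub> y\<^sub>2) / 2 > 1 - \<delta> \<longrightarrow> vnorm Y (y\<^sub>1 \<ominus>\<^bsub>Y\<^esub> y\<^sub>2) < \<epsilon>))"

end

theory Submission
  imports Defs "HOL-Library.Function_Algebras" "HOL-Library.Ramsey"
begin

text \<open>
  Both conclusions come from testing the universal property on \<open>\<ell>\<^sub>1\<close> with suitable norms. Uniform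
  convexity rests on the remark that a range strongly exposing operator attains its norm in a single
  direction: any two vectors at which it attains its norm have images that differ by a factor of
  modulus one (\<open>RSE_unique_direction\<close>). Finite dimension is then deduced from uniform convexity and
  from the mere fact that the approximating operators attain their norm close to the given point.

  \<^emph>\<open>Uniform convexity.\<close> Let \<open>y\<^sub>1, y\<^sub>2\<close> be unit vectors with \<open>\<parallel>y\<^sub>1 + y\<^sub>2\<parallel>\<close> close to \<open>2\<close>. The operator
  \<open>w \<mapsto> w\<^sub>0 y\<^sub>1 + w\<^sub>1 y\<^sub>2\<close> on \<open>\<ell>\<^sub>1\<close> almost attains its norm at \<open>(e\<^sub>0 + e\<^sub>1)/2\<close>. An operator \<open>S\<close> that attains its
  norm near this point attains it at \<open>e\<^sub>0\<close> and at \<open>e\<^sub>1\<close> too, because a combination of vectors of norm at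
  most one, with nonzero coefficients whose moduli add up to one, has norm one only if all of them
  have. If \<open>S\<close> is range strongly exposing, \<open>S e\<^sub>1 = c S e\<^sub>0\<close> with \<open>|c| = 1\<close>, and \<open>c\<close> is close to \<open>1\<close> as the sum is long. So \<open>y\<^sub>1\<close>
  and \<open>y\<^sub>2\<close> are close.

  \<^emph>\<open>Finite dimension.\<close> Here strict convexity is played against a norm on \<open>\<ell>\<^sub>1\<close> (\<open>flat_norm\<close>) whose unit
  ball is flat in the direction \<open>e\<^sub>k\<close> near each of its points \<open>w\<close> with \<open>|w\<^sub>k| < 1/k\<close> and small tail.
  If \<open>S\<close> attains its norm at such a \<open>w\<close>, then \<open>S (w \<plusminus> s e\<^sub>k)\<close> lie in the unit ball of \<open>Y\<close> and have a
  midpoint of norm one, so \<open>S e\<^sub>k = 0\<close> (\<open>uniformly_convex_imp_strictly_convex\<close>). The harmonic series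
  diverges, hence a summable sequence with small tail has such a \<open>k\<close> in each block
  \<open>2\<^sup>m \<le> k < 2\<^sup>m\<^sup>+\<^sup>1\<close>. Now consider \<open>T w = (1 - \<eta>/2) w\<^sub>0 y + (\<Sum>k w\<^sub>k y\<^sub>k)/4\<close>, the sum running over one block and
  all \<open>y\<^sub>k\<close> being unit vectors. It almost attains its norm at \<open>e\<^sub>0\<close>, and no operator close to it
  kills \<open>e\<^sub>k\<close> for any \<open>k\<close> in the block. This contradicts the universal property, provided that \<open>\<parallel>T\<parallel> \<le> 1\<close>.

  The bound \<open>\<parallel>T\<parallel> \<le> 1\<close> holds once \<open>\<parallel>\<Sum>k q\<^sub>k y\<^sub>k\<parallel> \<le> \<eta>\<close> for all coefficients with \<open>|q\<^sub>k| \<le> 1/2\<^sup>m\<close>, and this is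
  where infinite dimension enters (\<open>small_unconditional_sums\<close>). It is a Dvoretzky-Rogers phenomenon,
  and uniform convexity makes it elementary: \<open>Y\<close> contains finite basic sequences of any length
  with basis constant \<open>2\<close>, and in a uniformly convex space adding two successive blocks of such a sequence always
  loses a fixed proportion of the norm (an argument of Gurarii and Gurarii), so that sums of \<open>2\<^sup>m\<close>
  terms have norm at most a constant times \<open>(2 (1 - \<delta>))\<^sup>m\<close>.
\<close>

section \<open>Finitely supported sequences under a norm\<close>

definition fscale :: "'k::times \<Rightarrow> (nat \<Rightarrow> 'k) \<Rightarrow> nat \<Rightarrow> 'k" where
  "fscale c a = (\<lambda>k. c * a k)"

lemma fscale_apply: "fscale c a k = c * a k"
  by (simp add: fscale_def)

lemmas pointwise = plus_fun_apply minus_apply uminus_apply zero_fun_apply fscale_apply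

declare plus_fun_apply [simp del] minus_apply [simp del] uminus_apply [simp del] zero_fun_apply [simp del]

definition unitv :: "nat \<Rightarrow> nat \<Rightarrow> 'k::zero_neq_one" where
  "unitv n = (\<lambda>k. if k = n then 1 else 0)"

lemma unitv_apply: "unitv n k = (if k = n then 1 else 0)"
  by (simp add: unitv_def)

definition c00 :: "(nat \<Rightarrow> 'k::zero) set" where
  "c00 = {a. \<exists>n. \<forall>k\<ge>n. a k = 0}"

lemma c00_add: "a \<in> c00 \<Longrightarrow> b \<in> c00 \<Longrightarrow> a + b \<in> c00" for a b :: "nat \<Rightarrow> 'k::monoid_add"
  unfolding c00_def
  by (smt (verit) mem_Collect_eq plus_fun_apply add_0 nat_le_linear order_trans)

lemma c00_scale: "a \<in> c00 \<Longrightarrow> fscale c a \<in> c00" for a :: "nat \<Rightarrow> 'k::mult_zero"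
  unfolding c00_def by (fastforce simp: pointwise)

lemma c00_zero: "0 \<in> c00"
  unfolding c00_def by (auto simp: pointwise)

lemma c00_unitv: "unitv n \<in> c00"
  unfolding c00_def unitv_def by (auto intro!: exI[of _ "Suc n"])

lemma c00_supp: "(\<And>k. k \<ge> n \<Longrightarrow> a k = 0) \<Longrightarrow> a \<in> c00"
  unfolding c00_def by (auto simp: pointwise)

lemma c00_diff: "a \<in> c00 \<Longrightarrow> b \<in> c00 \<Longrightarrow> a - b \<in> c00" for a b :: "nat \<Rightarrow> 'k::group_add"
  unfolding c00_def
  by (smt (verit) mem_Collect_eq minus_apply diff_0_right nat_le_linear order_trans)

lemma c00_sum: "(\<And>l. l \<in> F \<Longrightarrow> x l \<in> c00) \<Longrightarrow> (\<Sum>l\<in>F. x l) \<in> c00" for x :: "'i \<Rightarrow> nat \<Rightarrow> 'k::comm_monoid_add"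
  by (induction F rule: infinite_finite_induct) (auto intro: c00_zero c00_add)

lemmas c00_intros = c00_add c00_scale c00_zero c00_unitv c00_diff c00_sum

lemma sum_fun_apply: "(\<Sum>l\<in>F. x l) k = (\<Sum>l\<in>F. x l k)" for x :: "'i \<Rightarrow> nat \<Rightarrow> 'k::comm_monoid_add"
  by (induction F rule: infinite_finite_induct) (auto simp: pointwise)

text \<open>
  The intended \<open>p\<close> is \<open>a \<mapsto> \<parallel>\<Sum>k a\<^sub>k z\<^sub>k\<parallel>\<close> for unit vectors \<open>z\<^sub>k\<close> of a Banach space, each at distance at least
  \<open>1/2\<close> from the span of its predecessors; \<open>last_coeff\<close> expresses this distance condition. Working
  with coefficient sequences reduces vector identities to pointwise ones.
\<close>

locale c00_seminorm =
  fixes p :: "(nat \<Rightarrow> 'k::{real_normed_field, euclidean_space}) \<Rightarrow> real"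
  assumes tri: "a \<in> c00 \<Longrightarrow> b \<in> c00 \<Longrightarrow> p (a + b) \<le> p a + p b"
    and scale: "a \<in> c00 \<Longrightarrow> p (fscale c a) = norm c * p a"
    and unit: "p (unitv n) = 1"
    and last_coeff: "(\<And>k. k > n \<Longrightarrow> a k = 0) \<Longrightarrow> norm (a n) \<le> 2 * p a"
begin

lemma p_zero: "p 0 = 0"
proof -
  have "fscale 0 0 = (0 :: nat \<Rightarrow> 'k)" by (simp add: fun_eq_iff pointwise)
  then show ?thesis using scale[OF c00_zero, of 0] by simp
qed

lemma p_minus: "a \<in> c00 \<Longrightarrow> p (- a) = p a"
proof -
  assume "a \<in> c00"
  moreover have "- a = fscale (-1) a" by (simp add: fun_eq_iff pointwise)
  ultimately show ?thesis using scale[of a "-1"] by simp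
qed

lemma p_diff: "a \<in> c00 \<Longrightarrow> b \<in> c00 \<Longrightarrow> p (a - b) \<le> p a + p b"
  using tri[of a "- b"] p_minus[of b] c00_diff[OF c00_zero, of b] by simp

lemma p_nonneg: "a \<in> c00 \<Longrightarrow> 0 \<le> p a"
  using p_diff[of a a] p_zero by simp

lemma p_le_sum_coeffs:
  assumes "\<And>k. k \<ge> n \<Longrightarrow> a k = 0"
  shows "p a \<le> (\<Sum>k<n. norm (a k))"
  using assms
proof (induction n arbitrary: a)
  case 0
  then have "a = 0" by (simp add: fun_eq_iff pointwise)
  then show ?case using p_zero by (simp only: lessThan_0 sum.empty)
next
  case (Suc n)
  define b where "b = a - fscale (a n) (unitv n)"
  have b: "\<And>k. k \<ge> n \<Longrightarrow> b k = 0"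
    using Suc.prems by (auto simp: b_def unitv_apply pointwise)
  have "a = b + fscale (a n) (unitv n)" by (simp add: b_def)
  then have "p a \<le> p b + norm (a n)"
    using tri[of b "fscale (a n) (unitv n)"] scale[OF c00_unitv, of "a n" n] unit[of n] c00_supp[OF b]
    by (auto intro: c00_intros)
  also have "p b \<le> (\<Sum>k<n. norm (b k))" using Suc.IH[OF b] .
  also have "(\<Sum>k<n. norm (b k)) = (\<Sum>k<n. norm (a k))"
    by (intro sum.cong) (auto simp: b_def unitv_apply pointwise)
  finally show ?case by simp
qed

text \<open>
  By induction on the length: \<open>last_coeff\<close> controls the last coefficient, and removing that term
  at most triples the norm.
\<close>

lemma coeff_bound:
  "\<exists>M. \<forall>a. (\<forall>k\<ge>n. a k = 0) \<longrightarrow> (\<forall>k. norm (a k) \<le> M * p a)"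
proof (induction n)
  case 0
  have "norm (a k) \<le> 0 * p a" if "\<forall>k\<ge>0. a k = 0" for a :: "nat \<Rightarrow> 'k" and k
    using that by auto
  then show ?case by blast
next
  case (Suc n)
  then obtain M where M: "\<And>a k. (\<forall>k\<ge>n. a k = 0) \<Longrightarrow> norm (a k) \<le> M * p a" by blast
  have "norm (a k) \<le> max 2 (\<bar>M\<bar> * 3) * p a" if a: "\<forall>k\<ge>Suc n. a k = 0" for a k
  proof -
    have ac: "a \<in> c00" using a by (auto intro: c00_supp)
    have an: "norm (a n) \<le> 2 * p a" using a by (intro last_coeff) auto
    define b where "b = a - fscale (a n) (unitv n)"
    have b: "\<forall>k\<ge>n. b k = 0" using a by (simp add: b_def unitv_apply pointwise)
    have "p b \<le> p a + norm (a n)"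
      using p_diff[OF ac, of "fscale (a n) (unitv n)"] scale[OF c00_unitv, of "a n" n] unit[of n]
      by (auto simp: b_def intro: c00_intros)
    then have pb: "p b \<le> 3 * p a" using an by simp
    have max: "2 * p a \<le> max 2 (\<bar>M\<bar> * 3) * p a" "(\<bar>M\<bar> * 3) * p a \<le> max 2 (\<bar>M\<bar> * 3) * p a"
      using p_nonneg[OF ac] by (auto intro: mult_right_mono)
    show ?thesis
    proof (cases "k = n")
      case True
      then show ?thesis using an max by simp
    next
      case False
      then have "norm (a k) = norm (b k)" by (simp add: b_def unitv_apply pointwise)
      also have "\<dots> \<le> M * p b" using M b by blast
      also have "\<dots> \<le> \<bar>M\<bar> * p b" 
        using p_nonneg[of b] c00_supp[of n b] b by (intro mult_right_mono) auto
      also have "\<dots> \<le> \<bar>M\<bar> * (3 * p a)" using pb by (intro mult_left_mono) auto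
      finally show ?thesis using max by simp
    qed
  qed
  then show ?case by blast
qed

text \<open>
  This replaces Mazur's choice of a vector annihilated by finitely many functionals and needs no
  duality. If the claim fails, each pair \<open>i < j\<close> has a witness \<open>(a, t)\<close> of the failure; its
  coefficients are bounded, so it may be taken from a finite set, and Ramsey's theorem yields an
  infinite set of indices \<open>h 0 < h 1 < \<dots>\<close> all of whose pairs share one witness. The average of
  \<open>a + t (e\<^bsub>h l\<^esub> - e\<^bsub>h (l+1)\<^esub>)\<close> over \<open>l < m\<close> telescopes to \<open>a + (t/m) (e\<^bsub>h 0\<^esub> - e\<^bsub>h m\<^esub>)\<close>, whose norm tends to \<open>p a\<close>,
  although every term has norm below \<open>p a\<close> by a fixed amount.
\<close>

lemma almost_orthogonal_difference:
  assumes "\<tau> > 0"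
  shows "\<exists>i j. n \<le> i \<and> i < j \<and>
    (\<forall>a t. (\<forall>k\<ge>n. a k = 0) \<longrightarrow> (1 - \<tau>) * p a \<le> p (a + fscale t (unitv i - unitv j)))"
proof (rule ccontr)
  assume "\<not> ?thesis"
  then have neg: "\<exists>a t. (\<forall>k\<ge>n. a k = 0) \<and> p (a + fscale t (unitv i - unitv j)) < (1 - \<tau>) * p a"
    if "n \<le> i" "i < j" for i j
    using that by (meson not_le)
  obtain M where M: "\<And>a k. (\<forall>k\<ge>n. a k = 0) \<Longrightarrow> norm (a k) \<le> M * p a"
    using coeff_bound[of n] by blast
  \<comment> \<open>Rounding \<open>n\<close> coefficients and \<open>t\<close> with accuracy \<open>\<theta>\<close> costs at most \<open>(2 n + 2) \<theta> = \<tau> / 2\<close> in total.\<close>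
  define \<theta> where "\<theta> = \<tau> / (4 * (real n + 1))"
  have \<theta>: "\<theta> > 0" using assms by (simp add: \<theta>_def)
  obtain G :: "'k set" where G: "finite G" "cball 0 (max M 2) \<subseteq> (\<Union>x\<in>G. ball x \<theta>)"
    using compact_cball[of "0::'k" "max M 2"] \<theta> unfolding compact_eq_totally_bounded by metis
  have "\<exists>g\<in>G. norm (g - s) < \<theta>" if "norm s \<le> max M 2" for s
  proof -
    have "s \<in> cball 0 (max M 2)" using that by simp
    then obtain g where "g \<in> G" "s \<in> ball g \<theta>" using G(2) by blast
    then show ?thesis by (auto simp: dist_norm)
  qed
  then obtain \<rho> where \<rho>: "\<And>s. norm s \<le> max M 2 \<Longrightarrow> \<rho> s \<in> G \<and> norm (\<rho> s - s) < \<theta>" by metis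
  define F where "F = {g. \<forall>k. (k \<in> {..<n} \<longrightarrow> g k \<in> G) \<and> (k \<notin> {..<n} \<longrightarrow> g k = 0)}"
  have "finite F" unfolding F_def using G(1) by (intro finite_set_of_finite_funs) auto
  then have fin: "finite (F \<times> G)" using G(1) by simp
  have ex: "\<exists>w\<in>F \<times> G. p (fst w + fscale (snd w) (unitv i - unitv j)) \<le> p (fst w) - \<tau> / 2"
    if ij: "n \<le> i" "i < j" for i j
  proof -
    define d :: "nat \<Rightarrow> 'k" where "d = unitv i - unitv j"
    have dc: "d \<in> c00" by (auto simp: d_def intro: c00_intros)
    have pd: "p d \<le> 2" using p_diff[OF c00_unitv c00_unitv, of i j] unit by (simp add: d_def)
    obtain a0 t0 where a0: "\<forall>k\<ge>n. a0 k = 0" "p (a0 + fscale t0 d) < (1 - \<tau>) * p a0"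
      using neg[OF ij] by (auto simp: d_def)
    have a0c: "a0 \<in> c00" using a0 by (auto intro: c00_supp)
    have "0 \<le> p (a0 + fscale t0 d)" by (intro p_nonneg c00_intros a0c dc)
    then have pos: "p a0 > 0" using a0(2) p_nonneg[OF a0c] by (cases "p a0 = 0") auto
    define r :: 'k where "r = of_real (1 / p a0)"
    have nr: "norm r = 1 / p a0" using pos by (simp add: r_def norm_divide)
    define a where "a = fscale r a0"
    define t where "t = r * t0"
    have supp: "\<forall>k\<ge>n. a k = 0" using a0 by (simp add: a_def pointwise)
    have ac: "a \<in> c00" unfolding a_def by (intro c00_intros a0c)
    have pa: "p a = 1" using scale[OF a0c, of r] nr pos by (simp add: a_def)
    have "a + fscale t d = fscale r (a0 + fscale t0 d)"
      by (simp add: fun_eq_iff pointwise a_def t_def algebra_simps)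
    then have "p (a + fscale t d) = (1 / p a0) * p (a0 + fscale t0 d)"
      using scale[of "a0 + fscale t0 d" r] nr by (auto intro!: c00_intros a0c dc)
    then have small: "p (a + fscale t d) < 1 - \<tau>"
      using mult_strict_left_mono[OF a0(2), of "1 / p a0"] pos by simp
    \<comment> \<open>The coefficient at \<open>j\<close> is \<open>- t\<close> and it is the last one, which bounds \<open>t\<close>.\<close>
    have "norm ((a + fscale t d) j) \<le> 2 * p (a + fscale t d)"
      using supp ij by (intro last_coeff) (auto simp: d_def unitv_apply pointwise)
    moreover have "(a + fscale t d) j = - t" using supp ij by (simp add: d_def unitv_apply pointwise)
    ultimately have "norm t \<le> 2" using small assms by simp
    then have h: "\<rho> t \<in> G" "norm (\<rho> t - t) < \<theta>" using \<rho>[of t] by auto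
    define g where "g = (\<lambda>k. if k < n then \<rho> (a k) else 0)"
    have g: "\<And>k. k < n \<Longrightarrow> \<rho> (a k) \<in> G \<and> norm (\<rho> (a k) - a k) < \<theta>"
      using \<rho> M[OF supp] pa by (simp add: le_max_iff_disj)
    then have gF: "g \<in> F" by (auto simp: g_def F_def)
    have gc: "g \<in> c00" by (rule c00_supp[of n]) (simp add: g_def)
    have "p (g - a) \<le> (\<Sum>k<n. norm ((g - a) k))"
      using supp by (intro p_le_sum_coeffs) (auto simp: g_def pointwise)
    also have "\<dots> \<le> (\<Sum>k<n. \<theta>)" using g by (intro sum_mono) (auto simp: g_def less_imp_le pointwise)
    finally have ga: "p (g - a) \<le> n * \<theta>" by simp
    have "p a \<le> p g + p (g - a)" using p_diff[OF gc c00_diff[OF gc ac]] by simp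
    then have pg: "1 - n * \<theta> \<le> p g" using ga pa by simp
    have "g + fscale (\<rho> t) d = (a + fscale t d) + ((g - a) + fscale (\<rho> t - t) d)"
      by (simp add: fun_eq_iff pointwise algebra_simps)
    then have le1: "p (g + fscale (\<rho> t) d) \<le> p (a + fscale t d) + (p (g - a) + p (fscale (\<rho> t - t) d))"
      using tri[of "a + fscale t d" "(g - a) + fscale (\<rho> t - t) d"] tri[of "g - a" "fscale (\<rho> t - t) d"]
      by (smt (verit) c00_intros ac dc gc)
    have le2: "p (fscale (\<rho> t - t) d) \<le> \<theta> * 2"
      using scale[OF dc, of "\<rho> t - t"] mult_mono[of "norm (\<rho> t - t)" \<theta> "p d" 2] h pd p_nonneg[OF dc] \<theta>
      by simp
    have "p (g + fscale (\<rho> t) d) \<le> p g - \<tau> + (2 * (real n * \<theta>) + 2 * \<theta>)"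
      using le1 le2 small ga pg by linarith
    also have "2 * (real n * \<theta>) + 2 * \<theta> = \<tau> / 2"
    proof -
      have "4 * (real n + 1) * \<theta> = \<tau>" by (simp add: \<theta>_def)
      then show ?thesis by (simp add: algebra_simps)
    qed
    finally have drop: "p (g + fscale (\<rho> t) d) \<le> p g - \<tau> / 2" by linarith
    show ?thesis
      by (rule bexI[of _ "(g, \<rho> t)"], unfold fst_conv snd_conv, rule drop[unfolded d_def]) (use gF h in blast)
  qed
  then obtain W where W: "\<And>i j. n \<le> i \<Longrightarrow> i < j \<Longrightarrow> W i j \<in> F \<times> G \<and>
      p (fst (W i j) + fscale (snd (W i j)) (unitv i - unitv j)) \<le> p (fst (W i j)) - \<tau> / 2"
    by metis
  obtain code :: "(nat \<Rightarrow> 'k) \<times> 'k \<Rightarrow> nat" and N where code: "code ` (F \<times> G) = {i. i < N}" "inj_on code (F \<times> G)"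
    using finite_imp_inj_to_nat_seg[OF fin] by blast
  have "\<exists>Y t. Y \<subseteq> {n..} \<and> infinite Y \<and> t < N \<and>
      (\<forall>x\<in>Y. \<forall>y\<in>Y. x \<noteq> y \<longrightarrow> code (W (Min {x, y}) (Max {x, y})) = t)"
  proof (rule Ramsey2)
    show "infinite {n..}" by (simp add: infinite_Ici)
    have "code (W i j) < N" if "n \<le> i" "i < j" for i j
    proof -
      have "code (W i j) \<in> code ` (F \<times> G)" by (rule imageI) (rule conjunct1[OF W[OF that]])
      then show ?thesis unfolding code(1) by simp
    qed
    then show "\<forall>x\<in>{n..}. \<forall>y\<in>{n..}. x \<noteq> y \<longrightarrow> code (W (Min {x, y}) (Max {x, y})) < N"
      by (auto simp: min_def max_def)
  qed
  then obtain H c where H: "H \<subseteq> {n..}" "infinite H"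
      and c: "\<forall>x\<in>H. \<forall>y\<in>H. x \<noteq> y \<longrightarrow> code (W (Min {x, y}) (Max {x, y})) = c"
    by (elim exE conjE)
  have c': "code (W i j) = c" if "i \<in> H" "j \<in> H" "i < j" for i j
  proof -
    have "Min {i, j} = i" "Max {i, j} = j" "i \<noteq> j" using that by auto
    then show ?thesis using c that by metis
  qed
  define h where "h = enumerate H"
  have hH: "h l \<in> H" for l using H(2) by (simp add: h_def enumerate_in_set)
  have hmono: "l < l' \<Longrightarrow> h l < h l'" for l l' using H(2) by (simp add: h_def enumerate_mono)
  define g s where "g = fst (W (h 0) (h 1))" and "s = snd (W (h 0) (h 1))"
  have Wconst: "W (h l) (h (Suc l)) = (g, s)" for l
  proof -
    have "W (h l) (h (Suc l)) \<in> F \<times> G" "W (h 0) (h 1) \<in> F \<times> G"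
      using W hH hmono H(1) by (auto simp: subset_iff)
    moreover have "code (W (h l) (h (Suc l))) = code (W (h 0) (h 1))"
      using c'[OF hH hH] hmono by simp
    ultimately show ?thesis using code(2) by (auto simp: inj_on_def g_def s_def)
  qed
  have step: "p (g + fscale s (unitv (h l) - unitv (h (Suc l)))) \<le> p g - \<tau> / 2" for l
    using W[of "h l" "h (Suc l)"] Wconst[of l] hH[of l] hmono[of l "Suc l"] H(1) by auto
  have "W (h 0) (h 1) \<in> F \<times> G" using W hH hmono H(1) by (auto simp: subset_iff)
  then have "g \<in> F" by (auto simp: g_def)
  then have gc: "g \<in> c00" by (intro c00_supp[of n]) (auto simp: F_def)
  have avg: "p (fscale (of_nat m) g + fscale s (unitv (h 0) - unitv (h m))) \<le> m * (p g - \<tau> / 2)" for m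
  proof (induction m)
    case 0
    have "fscale (of_nat 0) g + fscale s (unitv (h 0) - unitv (h 0)) = 0" by (simp add: fun_eq_iff pointwise)
    then show ?case by (simp only: p_zero)
  next
    case (Suc m)
    have "fscale (of_nat (Suc m)) g + fscale s (unitv (h 0) - unitv (h (Suc m))) =
        (fscale (of_nat m) g + fscale s (unitv (h 0) - unitv (h m))) +
        (g + fscale s (unitv (h m) - unitv (h (Suc m))))"
      by (simp add: fun_eq_iff pointwise algebra_simps)
    then have "p (fscale (of_nat (Suc m)) g + fscale s (unitv (h 0) - unitv (h (Suc m)))) \<le>
        p (fscale (of_nat m) g + fscale s (unitv (h 0) - unitv (h m))) +
        p (g + fscale s (unitv (h m) - unitv (h (Suc m))))"
      using tri by (metis c00_intros(1,2,4,5) gc)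
    also have "\<dots> \<le> m * (p g - \<tau> / 2) + (p g - \<tau> / 2)" using Suc.IH step[of m] by linarith
    finally show ?case by (simp add: algebra_simps add_divide_distrib)
  qed
  have bound: "m * p g \<le> m * (p g - \<tau> / 2) + norm s * 2" for m :: nat
  proof -
    define d :: "nat \<Rightarrow> 'k" where "d = unitv (h 0) - unitv (h m)"
    have dc: "d \<in> c00" by (auto simp: d_def intro: c00_intros)
    have pd: "p d \<le> 2" using p_diff[OF c00_unitv c00_unitv, of "h 0" "h m"] unit by (simp add: d_def)
    have "m * p g = p (fscale (of_nat m) g)" using scale[OF gc, of "of_nat m"] by simp
    also have "fscale (of_nat m) g = (fscale (of_nat m) g + fscale s d) - fscale s d" by simp
    also have "p \<dots> \<le> p (fscale (of_nat m) g + fscale s d) + p (fscale s d)"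
      by (intro p_diff c00_intros gc dc)
    also have "p (fscale s d) \<le> norm s * 2" using scale[OF dc, of s] pd by (simp add: mult_left_mono)
    finally show ?thesis using avg[of m] by (simp add: d_def)
  qed
  obtain m :: nat where "m > norm s * 4 / \<tau>" using reals_Archimedean2 by blast
  then have "m * \<tau> > norm s * 4" using assms by (simp add: field_simps)
  then show False using bound[of m] by (simp add: algebra_simps)
qed

text \<open>
  Choosing differences of unit vectors one after another, each almost orthogonal to the span of the
  previous ones, loses a factor \<open>1 - \<tau>\<close> per step.
\<close>

lemma basic_sequence:
  fixes n :: nat
  shows "\<exists>x. (\<forall>l. x l \<in> c00 \<and> 1 / 2 \<le> p (x l) \<and> p (x l) \<le> 2) \<and>
    (\<forall>k k' b. k \<le> k' \<longrightarrow> k' \<le> n \<longrightarrow>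
      p (\<Sum>l<k. fscale (b l) (x l)) \<le> 2 * p (\<Sum>l<k'. fscale (b l) (x l)))"
proof -
  \<comment> \<open>By Bernoulli's inequality, \<open>n\<close> steps cost at most the factor \<open>1 - n \<tau> \<ge> 1 / 2\<close>.\<close>
  define \<tau> where "\<tau> = 1 / (2 * real n + 2)"
  have \<tau>: "0 < \<tau>" "\<tau> < 1" "n * \<tau> \<le> 1 / 2" by (auto simp: \<tau>_def field_simps)
  define orth where "orth n' ij \<longleftrightarrow> n' \<le> fst ij \<and> fst ij < snd ij \<and>
      (\<forall>a t. (\<forall>k\<ge>n'. a k = 0) \<longrightarrow>
        (1 - \<tau>) * p a \<le> p (a + fscale t (unitv (fst ij) - unitv (snd ij))))" for n' ij
  have ex: "\<exists>ij. orth n' ij" for n'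
    using almost_orthogonal_difference[OF \<tau>(1), of n'] by (auto simp: orth_def)
  have "\<exists>f. \<forall>l. (fst (f l) < snd (f l)) \<and> orth (Suc (snd (f l))) (f (Suc l))"
  proof (rule dependent_nat_choice)
    show "\<exists>ij::nat \<times> nat. fst ij < snd ij" by (rule exI[of _ "(0, 1)"]) simp
    show "\<exists>ij'. fst ij' < snd ij' \<and> orth (Suc (snd ij)) ij'" if "fst ij < snd ij" for ij and l :: nat
      using ex[of "Suc (snd ij)"] unfolding orth_def by blast
  qed
  then obtain f where f: "\<And>l. fst (f l) < snd (f l)" "\<And>l. orth (Suc (snd (f l))) (f (Suc l))"
    by blast
  define x :: "nat \<Rightarrow> nat \<Rightarrow> 'k" where "x l = unitv (fst (f l)) - unitv (snd (f l))" for l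
  have xc: "x l \<in> c00" for l by (auto simp: x_def intro: c00_intros)
  have xle: "p (x l) \<le> 2" for l
    using p_diff[OF c00_unitv c00_unitv, of "fst (f l)" "snd (f l)"] unit by (simp add: x_def)
  have xge: "1 / 2 \<le> p (x l)" for l
  proof -
    have "norm (x l (snd (f l))) \<le> 2 * p (x l)"
      using f(1)[of l] by (intro last_coeff) (auto simp: x_def unitv_apply pointwise)
    then show ?thesis using f(1)[of l] by (simp add: x_def unitv_apply pointwise)
  qed
  have supp: "(\<Sum>l<Suc k. fscale (b l) (x l)) i = 0" if "i > snd (f k)" for b k i
    using that
  proof (induction k arbitrary: i)
    case 0
    then show ?case using f(1)[of 0] by (auto simp: x_def unitv_apply pointwise)
  next
    case (Suc k)
    have "snd (f k) < fst (f (Suc k))" using f(2)[of k] by (auto simp: orth_def)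
    then have "i > snd (f k)" "i > fst (f (Suc k))" using Suc.prems f(1)[of "Suc k"] by auto
    then have "(\<Sum>l<Suc k. fscale (b l) (x l)) i = 0" "x (Suc k) i = 0"
      by (rule_tac [1] Suc.IH) (use Suc.prems f(1)[of "Suc k"] in \<open>auto simp: x_def unitv_apply pointwise\<close>)
    moreover have "(\<Sum>l<Suc (Suc k). fscale (b l) (x l)) =
        (\<Sum>l<Suc k. fscale (b l) (x l)) + fscale (b (Suc k)) (x (Suc k))" by (rule sum.lessThan_Suc)
    ultimately show ?case by (simp only: plus_fun_apply[of _ _ i] fscale_apply[of _ _ i] mult_zero_right add_0)
  qed
  have step: "(1 - \<tau>) * p (\<Sum>l<k. fscale (b l) (x l)) \<le> p (\<Sum>l<Suc k. fscale (b l) (x l))" for k b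
  proof (cases k)
    case 0
    have "p (\<Sum>l<0. fscale (b l) (x l)) = 0" by (simp only: lessThan_0 sum.empty p_zero)
    moreover have "0 \<le> p (\<Sum>l<Suc k. fscale (b l) (x l))" by (intro p_nonneg c00_intros xc)
    ultimately show ?thesis using 0 by simp
  next
    case (Suc k')
    have "\<forall>i\<ge>Suc (snd (f k')). (\<Sum>l<Suc k'. fscale (b l) (x l)) i = 0"
      using supp by (metis Suc_le_eq)
    then have "(1 - \<tau>) * p (\<Sum>l<Suc k'. fscale (b l) (x l)) \<le>
       p ((\<Sum>l<Suc k'. fscale (b l) (x l)) + fscale (b (Suc k')) (x (Suc k')))"
      using f(2)[of k'] unfolding orth_def x_def by blast
    then show ?thesis using Suc by (simp only: sum.lessThan_Suc)
  qed
  have "(1 - \<tau>) ^ d * p (\<Sum>l<k. fscale (b l) (x l)) \<le> p (\<Sum>l<k + d. fscale (b l) (x l))" for k d b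
  proof (induction d)
    case 0
    then show ?case by simp
  next
    case (Suc d)
    have "(1 - \<tau>) ^ Suc d * p (\<Sum>l<k. fscale (b l) (x l)) \<le> (1 - \<tau>) * p (\<Sum>l<k + d. fscale (b l) (x l))"
      using mult_left_mono[OF Suc.IH, of "1 - \<tau>"] \<tau> by (simp add: mult.assoc)
    also have "\<dots> \<le> p (\<Sum>l<k + Suc d. fscale (b l) (x l))" unfolding add_Suc_right by (rule step)
    finally show ?case .
  qed
  note iter = this
  have "p (\<Sum>l<k. fscale (b l) (x l)) \<le> 2 * p (\<Sum>l<k'. fscale (b l) (x l))"
    if "k \<le> k'" "k' \<le> n" for k k' b
  proof -
    define d where "d = k' - k"
    have "d * \<tau> \<le> n * \<tau>" using that \<tau> by (intro mult_right_mono) (auto simp: d_def)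
    then have "1 / 2 \<le> 1 - d * \<tau>" using \<tau>(3) by linarith
    also have "\<dots> \<le> (1 - \<tau>) ^ d" using Bernoulli_inequality[of "- \<tau>" d] \<tau> by simp
    finally have "(1 / 2) * p (\<Sum>l<k. fscale (b l) (x l)) \<le> (1 - \<tau>) ^ d * p (\<Sum>l<k. fscale (b l) (x l))"
      by (intro mult_right_mono p_nonneg c00_intros xc)
    also have "\<dots> \<le> p (\<Sum>l<k'. fscale (b l) (x l))" using iter[where d = d and k = k and b = b] that by (simp add: d_def)
    finally show ?thesis by simp
  qed
  note basic = this
  show ?thesis
  proof (intro exI[of _ x] conjI allI impI)
    show "x l \<in> c00" "1 / 2 \<le> p (x l)" "p (x l) \<le> 2" for l by (fact xc xge xle)+
    show "p (\<Sum>l<k. fscale (b l) (x l)) \<le> 2 * p (\<Sum>l<k'. fscale (b l) (x l))"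
      if "k \<le> k'" "k' \<le> n" for k k' b by (rule basic[OF that])
  qed
qed

text \<open>
  Let \<open>u\<close> and \<open>v\<close> be the two halves of a dyadic block, both of norm at most \<open>R\<close>. If \<open>u + v\<close> had norm
  above \<open>2 R (1 - \<delta>)\<close>, then \<open>u - v\<close> would be short by \<open>uc\<close>. But \<open>u\<close> is an initial segment of the
  combination \<open>u - v\<close>, so \<open>p u \<le> 2 p (u - v)\<close> would be short as well, which leaves \<open>u + v\<close> too short.
\<close>

lemma dyadic_sum_bound:
  fixes n s k :: nat
  assumes uc: "\<And>u v R. u \<in> c00 \<Longrightarrow> v \<in> c00 \<Longrightarrow> R > 0 \<Longrightarrow> p u \<le> R \<Longrightarrow> p v \<le> R \<Longrightarrow>
      p (u + v) > 2 * R * (1 - \<delta>) \<Longrightarrow> p (u - v) < R / 4"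
    and \<delta>: "0 < \<delta>" "\<delta> \<le> 1 / 4"
    and x: "\<And>l. x l \<in> c00" "\<And>l. p (x l) \<le> 2"
    and basic: "\<And>k k' b. k \<le> k' \<Longrightarrow> k' \<le> n \<Longrightarrow>
      p (\<Sum>l<k. fscale (b l) (x l)) \<le> 2 * p (\<Sum>l<k'. fscale (b l) (x l))"
    and b: "\<And>l. norm (b l) \<le> 1"
    and s: "s + 2 ^ k \<le> n"
  shows "p (\<Sum>l=s..<s + 2 ^ k. fscale (b l) (x l)) \<le> 2 * (2 * (1 - \<delta>)) ^ k"
  using s
proof (induction k arbitrary: s)
  case 0
  have single: "{s..<s + 1} = {s}" by auto
  have "p (\<Sum>l=s..<s + 2 ^ 0. fscale (b l) (x l)) = norm (b s) * p (x s)"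
    unfolding power_0 single by (simp add: scale[OF x(1)])
  also have "\<dots> \<le> 1 * 2" using b x p_nonneg by (intro mult_mono) auto
  finally show ?case by (simp only: power_0 mult_1 mult_1_right)
next
  case (Suc k)
  define R where "R = 2 * (2 * (1 - \<delta>)) ^ k"
  have R: "R > 0" using \<delta> by (simp add: R_def)
  define u v where "u = (\<Sum>l=s..<s + 2 ^ k. fscale (b l) (x l))"
    and "v = (\<Sum>l=s + 2 ^ k..<s + 2 ^ Suc k. fscale (b l) (x l))"
  have uv: "u \<in> c00" "v \<in> c00" by (auto simp: u_def v_def intro!: c00_intros x)
  have pu: "p u \<le> R" unfolding u_def R_def using Suc.prems by (intro Suc.IH) simp
  have pv: "p v \<le> R"
  proof -
    have dbl: "s + 2 ^ k + 2 ^ k = s + 2 ^ Suc k" by simp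
    have "p (\<Sum>l=s + 2 ^ k..<s + 2 ^ k + 2 ^ k. fscale (b l) (x l)) \<le> 2 * (2 * (1 - \<delta>)) ^ k"
      by (rule Suc.IH) (use Suc.prems in simp)
    then show ?thesis unfolding v_def R_def dbl .
  qed
  have split: "(\<Sum>l=s..<s + 2 ^ Suc k. fscale (b l) (x l)) = u + v"
    unfolding u_def v_def by (rule sum.atLeastLessThan_concat[symmetric]) auto
  have "p (u + v) \<le> 2 * R * (1 - \<delta>)"
  proof (rule ccontr)
    assume "\<not> ?thesis"
    then have big: "p (u + v) > 2 * R * (1 - \<delta>)" by simp
    have close: "p (u - v) < R / 4" by (rule uc[OF uv R pu pv big])
    \<comment> \<open>These coefficients have \<open>u\<close> as the partial sum up to the middle and \<open>u - v\<close> as the full sum.\<close>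
    define b' where "b' l = (if l < s then 0 else if l < s + 2 ^ k then b l else - b l)" for l
    have zero: "(\<Sum>l<s. fscale (b' l) (x l)) = 0"
      by (intro sum.neutral) (auto simp: b'_def fun_eq_iff pointwise)
    have first: "(\<Sum>l<s + 2 ^ k. fscale (b' l) (x l)) = u"
    proof -
      have "(\<Sum>l<s + 2 ^ k. fscale (b' l) (x l)) =
          (\<Sum>l<s. fscale (b' l) (x l)) + (\<Sum>l=s..<s + 2 ^ k. fscale (b' l) (x l))"
        unfolding lessThan_atLeast0 by (rule sum.atLeastLessThan_concat[symmetric]) auto
      also have "(\<Sum>l=s..<s + 2 ^ k. fscale (b' l) (x l)) = u"
        unfolding u_def by (intro sum.cong) (auto simp: b'_def)
      finally show ?thesis using zero by simp
    qed
    have "(\<Sum>l<s + 2 ^ Suc k. fscale (b' l) (x l)) =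
        (\<Sum>l<s + 2 ^ k. fscale (b' l) (x l)) + (\<Sum>l=s + 2 ^ k..<s + 2 ^ Suc k. fscale (b' l) (x l))"
      unfolding lessThan_atLeast0 by (rule sum.atLeastLessThan_concat[symmetric]) auto
    also have "(\<Sum>l=s + 2 ^ k..<s + 2 ^ Suc k. fscale (b' l) (x l)) = - v"
      unfolding v_def sum_negf[symmetric] by (intro sum.cong) (auto simp: b'_def fun_eq_iff pointwise)
    finally have all: "(\<Sum>l<s + 2 ^ Suc k. fscale (b' l) (x l)) = u - v" using first by simp
    have "p u \<le> 2 * p (u - v)"
      using basic[of "s + 2 ^ k" "s + 2 ^ Suc k" b'] Suc.prems unfolding all first by simp
    then have "p u < R / 2" using close by simp
    moreover have "p (u + v) \<le> p u + p v" by (rule tri[OF uv])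
    moreover have "R * \<delta> \<le> R * (1 / 4)" using \<delta> R by (intro mult_left_mono) auto
    ultimately show False using big pv by (simp add: algebra_simps)
  qed
  then have "p (\<Sum>l=s..<s + 2 ^ Suc k. fscale (b l) (x l)) \<le> 2 * R * (1 - \<delta>)" unfolding split .
  also have "2 * R * (1 - \<delta>) = 2 * (2 * (1 - \<delta>)) ^ Suc k" unfolding R_def power_Suc by (simp only: mult_ac)
  finally show ?case .
qed

lemma small_unconditional_sum:
  assumes uc: "\<And>u v R. u \<in> c00 \<Longrightarrow> v \<in> c00 \<Longrightarrow> R > 0 \<Longrightarrow> p u \<le> R \<Longrightarrow> p v \<le> R \<Longrightarrow>
      p (u + v) > 2 * R * (1 - \<delta>) \<Longrightarrow> p (u - v) < R / 4"
    and \<delta>: "0 < \<delta>" "\<delta> \<le> 1 / 4"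
    and D: "D > 0"
  shows "\<exists>m (y :: nat \<Rightarrow> nat \<Rightarrow> 'k). (\<forall>l. y l \<in> c00 \<and> p (y l) = 1) \<and>
    (\<forall>q. (\<forall>l. norm (q l) \<le> 1 / 2 ^ m) \<longrightarrow> p (\<Sum>l<2 ^ m. fscale (q l) (y l)) \<le> D)"
proof -
  obtain m where m: "(1 - \<delta>) ^ m < D / 4"
    using real_arch_pow_inv[of "D / 4" "1 - \<delta>"] D \<delta> by auto
  obtain x where X: "\<forall>l::nat. x l \<in> c00 \<and> 1 / 2 \<le> p (x l) \<and> p (x l) \<le> 2"
    and B: "\<forall>k k' b. k \<le> k' \<longrightarrow> k' \<le> 2 ^ m \<longrightarrow>
      p (\<Sum>l<k. fscale (b l) (x l)) \<le> 2 * p (\<Sum>l<k'. fscale (b l) (x l))"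
    using basic_sequence[of "2 ^ m"] by (elim exE conjE)
  have x: "\<And>l. x l \<in> c00" "\<And>l. 1 / 2 \<le> p (x l)" "\<And>l. p (x l) \<le> 2" using X by auto
  have basic: "p (\<Sum>l<k. fscale (b l) (x l)) \<le> 2 * p (\<Sum>l<k'. fscale (b l) (x l))"
    if "k \<le> k'" "k' \<le> 2 ^ m" for k k' b
    using B[rule_format, OF that] .
  have pos: "p (x l) > 0" for l using x(2)[of l] by linarith
  define y where "y l = fscale (of_real (1 / p (x l))) (x l)" for l
  have y: "y l \<in> c00" "p (y l) = 1" for l
    using scale[OF x(1), of "of_real (1 / p (x l))" l] pos[of l] x(1)
    by (auto simp: y_def norm_divide intro: c00_intros)
  have "p (\<Sum>l<2 ^ m. fscale (q l) (y l)) \<le> D" if q: "\<And>l. norm (q l) \<le> 1 / 2 ^ m" for q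
  proof -
    define b where "b l = of_real (2 ^ m / (2 * p (x l))) * q l" for l
    have "norm (b l) \<le> 1" for l
    proof -
      have "norm (b l) = 2 ^ m / (2 * p (x l)) * norm (q l)"
        using pos[of l] by (simp add: b_def norm_mult norm_divide norm_power)
      also have "\<dots> \<le> 2 ^ m / (2 * p (x l)) * (1 / 2 ^ m)"
        using pos[of l] q by (intro mult_left_mono) auto
      also have "\<dots> \<le> 1" using x(2)[of l] by (simp add: field_simps)
      finally show ?thesis .
    qed
    then have "p (\<Sum>l=0..<0 + 2 ^ m. fscale (b l) (x l)) \<le> 2 * (2 * (1 - \<delta>)) ^ m"
      by (intro dyadic_sum_bound[where n = "2 ^ m"] uc \<delta> x basic) auto
    then have le: "p (\<Sum>l<2 ^ m. fscale (b l) (x l)) \<le> 2 * (2 * (1 - \<delta>)) ^ m"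
      by (simp add: lessThan_atLeast0)
    have "(\<Sum>l<2 ^ m. fscale (q l) (y l)) = fscale (of_real (2 / 2 ^ m)) (\<Sum>l<2 ^ m. fscale (b l) (x l))"
    proof -
      have "of_real (2 / 2 ^ m) * of_real (2 ^ m / (2 * p (x l))) = (of_real (1 / p (x l)) :: 'k)" for l
        unfolding of_real_mult[symmetric] using pos[of l] by (intro arg_cong[where f = of_real]) simp
      then have eq: "q l * (of_real (1 / p (x l)) * z) = of_real (2 / 2 ^ m) * (b l * z)" for l z
        unfolding b_def by (metis mult.assoc mult.left_commute)
      show ?thesis
        by (rule ext, unfold fscale_apply sum_fun_apply sum_distrib_left, unfold y_def fscale_apply)
          (intro sum.cong refl eq)
    qed
    then have "p (\<Sum>l<2 ^ m. fscale (q l) (y l)) = 2 / 2 ^ m * p (\<Sum>l<2 ^ m. fscale (b l) (x l))"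
      using scale[of "\<Sum>l<2 ^ m. fscale (b l) (x l)" "of_real (2 / 2 ^ m)"] x(1)
      by (simp add: c00_intros norm_divide norm_power)
    also have "\<dots> \<le> 2 / 2 ^ m * (2 * (2 * (1 - \<delta>)) ^ m)" using le by (intro mult_left_mono) auto
    also have "\<dots> = 4 * (1 - \<delta>) ^ m" unfolding power_mult_distrib by simp
    finally show ?thesis using m by simp
  qed
  note bound = this
  show ?thesis
  proof (intro exI[of _ m] exI[of _ y] conjI allI impI)
    show "y l \<in> c00" "p (y l) = 1" for l by (fact y)+
    show "p (\<Sum>l<2 ^ m. fscale (q l) (y l)) \<le> D" if "\<forall>l. norm (q l) \<le> 1 / 2 ^ m" for q
      using bound that by blast
  qed
qed

end

section \<open>Renormed copies of the sequence space of absolutely summable sequences\<close>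

text \<open>
  A sequence of scalars is determined by the pairs of an index and a basic open set that contains
  the corresponding term. There are countably many such pairs, so sequences inject into sets of
  naturals, these into the reals, and the reals into any line of \<open>Y\<close>.
\<close>

lemma inj_sequences_into_line:
  assumes "banach_space (Y :: ('k::{real_normed_field, euclidean_space}, 'a) normed_module)"
  shows "\<exists>\<iota> :: (nat \<Rightarrow> 'k) \<Rightarrow> 'a. inj \<iota>"
proof -
  interpret Y: banach_space Y by fact
  obtain B :: "'k set set" where B: "countable B" "topological_basis B"
    using ex_countable_basis by blast
  define \<phi> :: "(nat \<Rightarrow> 'k) \<Rightarrow> (nat \<times> 'k set) set" where "\<phi> f = {(n, b). b \<in> B \<and> f n \<in> b}" for f
  have "inj \<phi>"
  proof (rule injI)
    fix f g assume eq: "\<phi> f = \<phi> g"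
    show "f = g"
    proof (rule ccontr)
      assume "f \<noteq> g"
      then obtain n where "f n \<noteq> g n" by (auto simp: fun_eq_iff pointwise)
      then obtain U where U: "open U" "f n \<in> U" "g n \<notin> U" by (meson t1_space)
      then obtain b where "b \<in> B" "f n \<in> b" "b \<subseteq> U" using topological_basisE[OF B(2)] by metis
      then have "(n, b) \<in> \<phi> f" "(n, b) \<notin> \<phi> g" using U by (auto simp: \<phi>_def)
      then show False using eq by simp
    qed
  qed
  have "countable ((UNIV :: nat set) \<times> B)" using B by blast
  then obtain h :: "nat \<times> 'k set \<Rightarrow> nat" where h: "inj_on h (UNIV \<times> B)"
    by (auto simp: countable_def)
  have "inj (\<lambda>f. h ` \<phi> f)"
  proof (rule injI)
    fix f g assume "h ` \<phi> f = h ` \<phi> g"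
    moreover have "\<phi> f \<subseteq> UNIV \<times> B" "\<phi> g \<subseteq> UNIV \<times> B" by (auto simp: \<phi>_def)
    ultimately have "\<phi> f = \<phi> g" using inj_on_image_eq_iff[OF h] by blast
    then show "f = g" using \<open>inj \<phi>\<close> by (simp add: inj_eq)
  qed
  then have inj_h: "inj (\<lambda>f. h ` \<phi> f)" .
  obtain r :: "nat set \<Rightarrow> real" where inj_r: "inj r"
    using nat_sets_eqpoll_reals by (auto simp: eqpoll_def bij_betw_def)
  obtain u where u: "u \<in> carrier Y" "u \<noteq> \<zero>\<^bsub>Y\<^esub>"
  proof -
    obtain u v where "u \<in> carrier Y" "v \<in> carrier Y" "u \<noteq> v" using Y.dimension_ge_2 by blast
    then show ?thesis using that by metis
  qed
  have inj_u: "inj (\<lambda>c :: 'k. c \<odot>\<^bsub>Y\<^esub> u)"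
  proof (rule injI)
    fix c d :: 'k assume eq: "c \<odot>\<^bsub>Y\<^esub> u = d \<odot>\<^bsub>Y\<^esub> u"
    have "(c - d) \<odot>\<^bsub>Y\<^esub> u \<oplus>\<^bsub>Y\<^esub> d \<odot>\<^bsub>Y\<^esub> u = c \<odot>\<^bsub>Y\<^esub> u"
      using Y.smult_l_distr[of "c - d" d u] u by simp
    then have "(c - d) \<odot>\<^bsub>Y\<^esub> u = \<zero>\<^bsub>Y\<^esub>"
      using eq u Y.smult_closed[of "c - d" u] Y.smult_closed[of d u] by (simp add: Y.M.add.r_cancel_one')
    then have "norm (c - d) * vnorm Y u = 0"
      using Y.vnorm_smult[OF u(1), of "c - d"] Y.vnorm_eq_0_iff[of "\<zero>\<^bsub>Y\<^esub>"] by simp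
    then show "c = d" using Y.vnorm_eq_0_iff[OF u(1)] u(2) by simp
  qed
  have "inj (\<lambda>f. (of_real (r (h ` \<phi> f)) :: 'k) \<odot>\<^bsub>Y\<^esub> u)"
  proof (rule injI)
    fix f g assume "(of_real (r (h ` \<phi> f)) :: 'k) \<odot>\<^bsub>Y\<^esub> u = of_real (r (h ` \<phi> g)) \<odot>\<^bsub>Y\<^esub> u"
    then have "(of_real (r (h ` \<phi> f)) :: 'k) = of_real (r (h ` \<phi> g))" by (rule injD[OF inj_u])
    then have "h ` \<phi> f = h ` \<phi> g" using injD[OF inj_r] by simp
    then show "f = g" by (rule injD[OF inj_h])
  qed
  then show ?thesis by blast
qed

definition l1 :: "(nat \<Rightarrow> 'k::real_normed_vector) set" where
  "l1 = {w. summable (\<lambda>k. norm (w k))}"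

definition l1_norm :: "(nat \<Rightarrow> 'k::real_normed_vector) \<Rightarrow> real" where
  "l1_norm w = (\<Sum>k. norm (w k))"

lemma l1_dominated:
  assumes "w \<in> l1" "v \<in> l1" "\<And>k. norm (z k) \<le> norm (w k) + norm (v k)"
  shows "z \<in> l1" "l1_norm z \<le> l1_norm w + l1_norm v"
proof -
  have sum: "summable (\<lambda>k. norm (w k) + norm (v k))"
    using assms by (intro summable_add) (auto simp: l1_def)
  have "summable (\<lambda>k. norm (z k))"
    by (rule summable_comparison_test[OF _ sum]) (use assms in auto)
  then show "z \<in> l1" by (simp add: l1_def)
  have "l1_norm z \<le> (\<Sum>k. norm (w k) + norm (v k))"
    unfolding l1_norm_def by (rule suminf_le) (use assms sum \<open>summable (\<lambda>k. norm (z k))\<close> in auto)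
  also have "\<dots> = l1_norm w + l1_norm v"
    unfolding l1_norm_def using assms by (intro suminf_add[symmetric]) (auto simp: l1_def)
  finally show "l1_norm z \<le> l1_norm w + l1_norm v" .
qed

lemma l1_add: "w \<in> l1 \<Longrightarrow> v \<in> l1 \<Longrightarrow> w + v \<in> l1 \<and> l1_norm (w + v) \<le> l1_norm w + l1_norm v"
  using l1_dominated[of w v "w + v"] by (auto simp: norm_triangle_ineq pointwise)

lemma l1_diff: "w \<in> l1 \<Longrightarrow> v \<in> l1 \<Longrightarrow> w - v \<in> l1 \<and> l1_norm (w - v) \<le> l1_norm w + l1_norm v"
  using l1_dominated[of w v "w - v"] by (auto simp: norm_triangle_ineq4 pointwise)

lemma l1_fscale:
  fixes w :: "nat \<Rightarrow> 'k::real_normed_field"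
  assumes "w \<in> l1"
  shows "fscale c w \<in> l1 \<and> l1_norm (fscale c w) = norm c * l1_norm w"
proof -
  have sum: "summable (\<lambda>k. norm (w k))" using assms by (simp add: l1_def)
  have eq: "(\<lambda>k. norm (fscale c w k)) = (\<lambda>k. norm c * norm (w k))"
    by (simp add: fscale_apply norm_mult)
  show ?thesis
    unfolding l1_def l1_norm_def mem_Collect_eq eq
    using summable_mult[OF sum] suminf_mult[OF sum] by blast
qed

lemma l1_finite_support:
  assumes "finite F" "\<And>k. k \<notin> F \<Longrightarrow> w k = 0"
  shows "w \<in> l1" "l1_norm w = (\<Sum>k\<in>F. norm (w k))"
proof -
  have "(\<lambda>k. norm (w k)) sums (\<Sum>k\<in>F. norm (w k))"
    using assms by (intro sums_finite) auto
  then show "w \<in> l1" "l1_norm w = (\<Sum>k\<in>F. norm (w k))"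
    by (auto simp: l1_def l1_norm_def sums_iff)
qed

lemma l1_zero: "0 \<in> l1"
  using l1_finite_support(1)[of "{}" 0] by (simp add: pointwise)

lemma l1_unitv: "(unitv n :: nat \<Rightarrow> 'k::real_normed_field) \<in> l1" "l1_norm (unitv n :: nat \<Rightarrow> 'k::real_normed_field) = 1"
  using l1_finite_support[of "{n}" "unitv n :: nat \<Rightarrow> 'k"] by (auto simp: unitv_apply pointwise)

lemma sum_norm_le_l1_norm: "w \<in> l1 \<Longrightarrow> finite F \<Longrightarrow> (\<Sum>k\<in>F. norm (w k)) \<le> l1_norm w"
  unfolding l1_def l1_norm_def by (intro sum_le_suminf) auto

lemma norm_le_l1_norm: "w \<in> l1 \<Longrightarrow> norm (w k) \<le> l1_norm w"
  using sum_norm_le_l1_norm[of w "{k}"] by simp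

lemma l1_norm_nonneg: "w \<in> l1 \<Longrightarrow> 0 \<le> l1_norm w"
  using norm_le_l1_norm[of w 0] norm_ge_zero[of "w 0"] by linarith

lemma l1_norm_remove:
  fixes w :: "nat \<Rightarrow> 'k::real_normed_field"
  assumes "w \<in> l1"
  shows "w(k := 0) \<in> l1" "l1_norm w = norm (w k) + l1_norm (w(k := 0))"
proof -
  show l: "w(k := 0) \<in> l1"
    using l1_dominated(1)[OF assms l1_zero, of "w(k := 0)"] by (simp add: pointwise)
  have s: "(\<lambda>i. if i = k then norm (w i) else 0) sums norm (w k)" by (rule sums_single)
  have "(\<Sum>i. norm (w i)) = (\<Sum>i. (if i = k then norm (w i) else 0) + norm ((w(k := 0)) i))"
    by (intro suminf_cong) auto
  also have "\<dots> = (\<Sum>i. if i = k then norm (w i) else 0) + (\<Sum>i. norm ((w(k := 0)) i))"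
    using s l by (intro suminf_add[symmetric]) (auto simp: sums_iff l1_def)
  finally show "l1_norm w = norm (w k) + l1_norm (w(k := 0))"
    using s by (simp add: l1_norm_def sums_iff)
qed

lemma split_coordinate: "w = fscale (w k) (unitv k) + w(k := 0)" for w :: "nat \<Rightarrow> 'k::real_normed_field"
  by (simp add: fun_eq_iff pointwise unitv_apply)

lemma l1_bounded_partial_sums:
  assumes "\<And>n. (\<Sum>k<n. norm (w k)) \<le> C"
  shows "w \<in> l1" "l1_norm w \<le> C"
proof -
  have "summable (\<lambda>k. norm (w k))"
    using assms by (intro summableI_nonneg_bounded[where x = C]) auto
  then show "w \<in> l1" "l1_norm w \<le> C"
    using assms by (auto simp: l1_def l1_norm_def intro: suminf_le_const)
qed

text \<open>
  Coordinates of a Cauchy sequence converge, and the tail estimates survive the limit because they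
  are estimates of finite partial sums.
\<close>

lemma l1_complete:
  fixes s :: "nat \<Rightarrow> nat \<Rightarrow> 'k::banach"
  assumes s: "\<And>n. s n \<in> l1"
    and cauchy: "\<forall>\<epsilon>>0. \<exists>N. \<forall>m\<ge>N. \<forall>n\<ge>N. l1_norm (s m - s n) < \<epsilon>"
  shows "\<exists>l\<in>l1. (\<lambda>n. l1_norm (s n - l)) \<longlonglongrightarrow> 0"
proof -
  have diff: "s m - s n \<in> l1" for m n using l1_diff[OF s s] by blast
  have coord: "norm (s m k - s n k) \<le> l1_norm (s m - s n)" for m n k
    using norm_le_l1_norm[OF diff[of m n], of k] by (simp add: pointwise)
  have "Cauchy (\<lambda>n. s n k)" for k
    unfolding Cauchy_def dist_norm using cauchy coord by (meson le_less_trans)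
  then have "\<exists>l. (\<lambda>n. s n k) \<longlonglongrightarrow> l" for k
    by (simp add: Cauchy_convergent_iff convergent_def)
  then obtain l where l: "\<And>k. (\<lambda>n. s n k) \<longlonglongrightarrow> l k" by metis
  have tail: "s n - l \<in> l1 \<and> l1_norm (s n - l) \<le> \<epsilon>"
    if "\<forall>m\<ge>N. \<forall>n\<ge>N. l1_norm (s m - s n) < \<epsilon>" "n \<ge> N" for n N \<epsilon>
  proof -
    have "(\<Sum>k<K. norm ((s n - l) k)) \<le> \<epsilon>" for K
    proof (rule LIMSEQ_le_const2)
      show "(\<lambda>m. \<Sum>k<K. norm (s n k - s m k)) \<longlonglongrightarrow> (\<Sum>k<K. norm ((s n - l) k))"
        using l by (auto simp: pointwise intro!: tendsto_intros)
      have "(\<Sum>k<K. norm (s n k - s m k)) \<le> \<epsilon>" if "m \<ge> N" for m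
        using sum_norm_le_l1_norm[OF diff[of n m], of "{..<K}"]
          \<open>\<forall>m\<ge>N. \<forall>n\<ge>N. l1_norm (s m - s n) < \<epsilon>\<close>[rule_format, OF \<open>n \<ge> N\<close> that] by (simp add: pointwise)
      then show "\<exists>M. \<forall>m\<ge>M. (\<Sum>k<K. norm (s n k - s m k)) \<le> \<epsilon>" by blast
    qed
    then show ?thesis using l1_bounded_partial_sums by blast
  qed
  obtain N0 where "\<forall>m\<ge>N0. \<forall>n\<ge>N0. l1_norm (s m - s n) < 1"
    using cauchy[rule_format, of 1] by auto
  then have N0: "s n - l \<in> l1" if "n \<ge> N0" for n using tail[OF _ that] by simp
  have "l = s N0 - (s N0 - l)" by (simp add: fun_eq_iff pointwise)
  then have lc: "l \<in> l1" using l1_diff[OF s[of N0] N0[OF order_refl]] by metis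
  have "(\<lambda>n. l1_norm (s n - l)) \<longlonglongrightarrow> 0"
  proof (rule LIMSEQ_I)
    fix r :: real assume "r > 0"
    then obtain N where N: "\<forall>m\<ge>N. \<forall>n\<ge>N. l1_norm (s m - s n) < r / 2"
      using cauchy[rule_format, of "r / 2"] by auto
    have "norm (l1_norm (s n - l) - 0) < r" if "n \<ge> N" for n
      using tail[OF N that] l1_norm_nonneg[of "s n - l"] \<open>r > 0\<close> by simp
    then show "\<exists>no. \<forall>n\<ge>no. norm (l1_norm (s n - l) - 0) < r" by blast
  qed
  then show ?thesis using lc by blast
qed

text \<open>
  A norm on \<open>\<ell>\<^sub>1\<close> equivalent to the usual one; one constant serves for both inequalities.
\<close>

locale renormed_l1 =
  fixes \<nu> :: "(nat \<Rightarrow> 'k::{real_normed_field, euclidean_space}) \<Rightarrow> real" and C :: real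
  assumes \<nu>_add: "w \<in> l1 \<Longrightarrow> v \<in> l1 \<Longrightarrow> \<nu> (w + v) \<le> \<nu> w + \<nu> v"
    and \<nu>_fscale: "w \<in> l1 \<Longrightarrow> \<nu> (fscale c w) = norm c * \<nu> w"
    and l1_norm_le: "w \<in> l1 \<Longrightarrow> l1_norm w \<le> C * \<nu> w"
    and \<nu>_le: "w \<in> l1 \<Longrightarrow> \<nu> w \<le> C * l1_norm w"
    and C_pos: "C > 0"
begin

lemma \<nu>_nonneg: "w \<in> l1 \<Longrightarrow> 0 \<le> \<nu> w"
  using l1_norm_le[of w] l1_norm_nonneg[of w] C_pos by (metis order_trans zero_le_mult_iff not_less order_less_imp_le)

lemma \<nu>_eq_0: "w \<in> l1 \<Longrightarrow> \<nu> w = 0 \<longleftrightarrow> w = 0"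
proof
  assume w: "w \<in> l1" and "\<nu> w = 0"
  then have "norm (w k) \<le> 0" for k
    using order_trans[OF norm_le_l1_norm[OF w, of k] l1_norm_le[OF w]] by simp
  then show "w = 0" by (simp add: fun_eq_iff pointwise)
next
  assume w: "w \<in> l1" and "w = 0"
  then have "w = fscale 0 w" by (simp add: fun_eq_iff pointwise)
  then show "\<nu> w = 0" using \<nu>_fscale[OF w, of 0] by simp
qed

text \<open>
  The universal property speaks only about spaces whose carrier lies in the type of \<open>Y\<close>. Hence the
  renormed sequence space is transported along an injection into that type.
\<close>

definition copy :: "((nat \<Rightarrow> 'k) \<Rightarrow> 'a) \<Rightarrow> ('k, 'a) normed_module" where
  "copy \<iota> = \<lparr>carrier = \<iota> ` l1, mult = (\<lambda>x y. x), one = \<iota> 0, zero = \<iota> 0,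
     add = (\<lambda>x y. \<iota> (inv_into UNIV \<iota> x + inv_into UNIV \<iota> y)), smult = (\<lambda>c x. \<iota> (fscale c (inv_into UNIV \<iota> x))),
     vnorm = (\<lambda>x. \<nu> (inv_into UNIV \<iota> x))\<rparr>"

context
  fixes \<iota> :: "(nat \<Rightarrow> 'k) \<Rightarrow> 'a"
  assumes inj: "inj \<iota>"
begin

lemma copy_simps:
  "carrier (copy \<iota>) = \<iota> ` l1" "\<zero>\<^bsub>copy \<iota>\<^esub> = \<iota> 0"
  "\<iota> w \<oplus>\<^bsub>copy \<iota>\<^esub> \<iota> v = \<iota> (w + v)" "c \<odot>\<^bsub>copy \<iota>\<^esub> \<iota> w = \<iota> (fscale c w)"
  "vnorm (copy \<iota>) (\<iota> w) = \<nu> w"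
  by (simp_all add: copy_def inj)

lemma copy_vectorspace: "vectorspace class_ring (copy \<iota>)"
proof -
  have ab: "abelian_group (copy \<iota>)"
  proof (rule abelian_groupI)
    fix x assume "x \<in> carrier (copy \<iota>)"
    then obtain w where w: "x = \<iota> w" "w \<in> l1" by (auto simp: copy_simps)
    then have "\<iota> (- w) \<oplus>\<^bsub>copy \<iota>\<^esub> x = \<zero>\<^bsub>copy \<iota>\<^esub>" by (simp add: copy_simps)
    moreover have "- w \<in> l1" using l1_diff[OF l1_zero w(2)] by simp
    ultimately show "\<exists>y\<in>carrier (copy \<iota>). y \<oplus>\<^bsub>copy \<iota>\<^esub> x = \<zero>\<^bsub>copy \<iota>\<^esub>" by (auto simp: copy_simps)
  next
    fix x y assume "x \<in> carrier (copy \<iota>)" "y \<in> carrier (copy \<iota>)"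
    then obtain w v where wv: "x = \<iota> w" "w \<in> l1" "y = \<iota> v" "v \<in> l1" by (auto simp: copy_simps)
    then show "x \<oplus>\<^bsub>copy \<iota>\<^esub> y \<in> carrier (copy \<iota>)"
      using l1_add[of w v] by (simp add: copy_simps)
  qed (use l1_zero in \<open>auto simp: copy_simps add_ac\<close>)
  interpret abelian_group "copy \<iota>" by (rule ab)
  have "Module.module class_ring (copy \<iota>)"
  proof (rule moduleI)
    show "cring (class_ring :: 'k ring)"
      by (rule domain.axioms(1)[OF field.axioms(1)[OF class_field]])
    show "abelian_group (copy \<iota>)" by (rule ab)
    fix a b :: 'k and x assume "x \<in> carrier (copy \<iota>)"
    then obtain w where w: "x = \<iota> w" "w \<in> l1" by (auto simp: copy_simps)
    show "a \<odot>\<^bsub>copy \<iota>\<^esub> x \<in> carrier (copy \<iota>)"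
      using l1_fscale[OF w(2), of a] by (simp add: w copy_simps)
    have "fscale (a + b) w = fscale a w + fscale b w" "fscale (a * b) w = fscale a (fscale b w)" "fscale 1 w = w"
      by (simp_all add: fun_eq_iff pointwise algebra_simps)
    then show "(a \<oplus>\<^bsub>class_ring\<^esub> b) \<odot>\<^bsub>copy \<iota>\<^esub> x = a \<odot>\<^bsub>copy \<iota>\<^esub> x \<oplus>\<^bsub>copy \<iota>\<^esub> b \<odot>\<^bsub>copy \<iota>\<^esub> x"
      "(a \<otimes>\<^bsub>class_ring\<^esub> b) \<odot>\<^bsub>copy \<iota>\<^esub> x = a \<odot>\<^bsub>copy \<iota>\<^esub> (b \<odot>\<^bsub>copy \<iota>\<^esub> x)"
      "\<one>\<^bsub>class_ring\<^esub> \<odot>\<^bsub>copy \<iota>\<^esub> x = x"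
      by (simp_all add: w copy_simps)
    fix y assume "y \<in> carrier (copy \<iota>)"
    then obtain v where v: "y = \<iota> v" "v \<in> l1" by (auto simp: copy_simps)
    have "fscale a (w + v) = fscale a w + fscale a v"
      by (simp add: fun_eq_iff pointwise algebra_simps)
    then show "a \<odot>\<^bsub>copy \<iota>\<^esub> (x \<oplus>\<^bsub>copy \<iota>\<^esub> y) = a \<odot>\<^bsub>copy \<iota>\<^esub> x \<oplus>\<^bsub>copy \<iota>\<^esub> a \<odot>\<^bsub>copy \<iota>\<^esub> y"
      by (simp add: w v copy_simps)
  qed
  then show ?thesis by (simp add: vectorspace_def class_field)
qed

lemma copy_minus: "w \<in> l1 \<Longrightarrow> v \<in> l1 \<Longrightarrow> \<iota> w \<ominus>\<^bsub>copy \<iota>\<^esub> \<iota> v = \<iota> (w - v)"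
proof -
  assume wv: "w \<in> l1" "v \<in> l1"
  interpret V: vectorspace class_ring "copy \<iota>" by (rule copy_vectorspace)
  have "- v \<in> l1" using l1_diff[OF l1_zero wv(2)] by simp
  then have "\<ominus>\<^bsub>copy \<iota>\<^esub> \<iota> v = \<iota> (- v)"
    using wv by (intro V.M.minus_equality) (auto simp: copy_simps)
  then show ?thesis by (simp add: a_minus_def copy_simps)
qed

lemma copy_banach_space: "banach_space (copy \<iota>)"
proof -
  interpret V: vectorspace class_ring "copy \<iota>" by (rule copy_vectorspace)
  show ?thesis
  proof (rule banach_space.intro[OF copy_vectorspace], rule banach_space_axioms.intro)
    fix x assume "x \<in> carrier (copy \<iota>)"
    then obtain w where w: "x = \<iota> w" "w \<in> l1" by (auto simp: copy_simps)
    show "vnorm (copy \<iota>) x = 0 \<longleftrightarrow> x = \<zero>\<^bsub>copy \<iota>\<^esub>"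
      using \<nu>_eq_0[OF w(2)] inj by (simp add: w copy_simps inj_eq)
    show "vnorm (copy \<iota>) (c \<odot>\<^bsub>copy \<iota>\<^esub> x) = norm c * vnorm (copy \<iota>) x" for c
      using \<nu>_fscale[OF w(2)] by (simp add: w copy_simps)
    fix y assume "y \<in> carrier (copy \<iota>)"
    then obtain v where v: "y = \<iota> v" "v \<in> l1" by (auto simp: copy_simps)
    show "vnorm (copy \<iota>) (x \<oplus>\<^bsub>copy \<iota>\<^esub> y) \<le> vnorm (copy \<iota>) x + vnorm (copy \<iota>) y"
      using \<nu>_add[OF w(2) v(2)] by (simp add: w v copy_simps)
  next
    fix s :: "nat \<Rightarrow> 'a"
    assume s: "\<And>n. s n \<in> carrier (copy \<iota>)"
      and cauchy: "\<forall>\<epsilon>>0. \<exists>N. \<forall>m\<ge>N. \<forall>n\<ge>N. vnorm (copy \<iota>) (s m \<ominus>\<^bsub>copy \<iota>\<^esub> s n) < \<epsilon>"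
    have "\<forall>n. \<exists>w. s n = \<iota> w \<and> w \<in> l1" using s by (auto simp: copy_simps)
    then obtain t where t: "\<And>n. s n = \<iota> (t n)" "\<And>n. t n \<in> l1" by metis
    have "\<exists>N. \<forall>m\<ge>N. \<forall>n\<ge>N. l1_norm (t m - t n) < \<epsilon>" if "\<epsilon> > 0" for \<epsilon>
    proof -
      have "\<epsilon> / C > 0" using that C_pos by simp
      then obtain N where N: "\<forall>m\<ge>N. \<forall>n\<ge>N. vnorm (copy \<iota>) (s m \<ominus>\<^bsub>copy \<iota>\<^esub> s n) < \<epsilon> / C"
        using cauchy by blast
      have "l1_norm (t m - t n) < \<epsilon>" if "m \<ge> N" "n \<ge> N" for m n
      proof -
        have "\<nu> (t m - t n) < \<epsilon> / C" using N that by (simp add: t copy_minus copy_simps)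
        then have "C * \<nu> (t m - t n) < \<epsilon>" using C_pos by (simp add: field_simps)
        then show ?thesis using l1_norm_le[of "t m - t n"] l1_diff t by fastforce
      qed
      then show ?thesis by blast
    qed
    then obtain l where l: "l \<in> l1" "(\<lambda>n. l1_norm (t n - l)) \<longlonglongrightarrow> 0"
      using l1_complete[of t] t by blast
    have "(\<lambda>n. \<nu> (t n - l)) \<longlonglongrightarrow> 0"
    proof (rule tendsto_sandwich[of "\<lambda>_. 0" _ _ "\<lambda>n. C * l1_norm (t n - l)"])
      have "t n - l \<in> l1" for n using l1_diff t l by blast
      then show "\<forall>\<^sub>F n in sequentially. 0 \<le> \<nu> (t n - l)"
        "\<forall>\<^sub>F n in sequentially. \<nu> (t n - l) \<le> C * l1_norm (t n - l)"
        using \<nu>_nonneg \<nu>_le by auto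
      show "(\<lambda>n. C * l1_norm (t n - l)) \<longlonglongrightarrow> 0" using tendsto_mult_left[OF l(2), of C] by simp
    qed simp
    then show "\<exists>l\<in>carrier (copy \<iota>). (\<lambda>n. vnorm (copy \<iota>) (s n \<ominus>\<^bsub>copy \<iota>\<^esub> l)) \<longlonglongrightarrow> 0"
      using l t by (intro bexI[of _ "\<iota> l"]) (simp_all add: copy_simps copy_minus)
  next
    define u v where "u = \<iota> (unitv 0)" and "v = \<iota> (unitv 1)"
    have uv: "u \<in> carrier (copy \<iota>)" "v \<in> carrier (copy \<iota>)" by (auto simp: u_def v_def copy_simps l1_unitv)
    have "unitv 0 0 \<noteq> (unitv 1 0 :: 'k)" by (simp add: unitv_apply pointwise)
    then have ne: "u \<noteq> v" using inj by (auto simp: u_def v_def inj_eq)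
    have "V.lin_indpt {u, v}"
    proof (rule V.finite_lin_indpt2)
      fix a :: "'a \<Rightarrow> 'k" assume a: "V.lincomb a {u, v} = \<zero>\<^bsub>copy \<iota>\<^esub>"
      have "V.lincomb a {u, v} = a u \<odot>\<^bsub>copy \<iota>\<^esub> u \<oplus>\<^bsub>copy \<iota>\<^esub> a v \<odot>\<^bsub>copy \<iota>\<^esub> v"
        using uv ne V.smult_closed[of _ u] V.smult_closed[of _ v] by (simp add: V.lincomb_def)
      also have "\<dots> = \<iota> (fscale (a u) (unitv 0) + fscale (a v) (unitv 1))"
        unfolding u_def v_def copy_simps ..
      finally have zero: "fscale (a u) (unitv 0) + fscale (a v) (unitv 1) = 0"
        using a inj by (simp add: copy_simps inj_eq)
      have "a u = 0" "a v = 0"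
        using fun_cong[OF zero, of 0] fun_cong[OF zero, of 1] by (simp_all add: unitv_apply pointwise)
      then show "\<forall>x\<in>{u, v}. a x = \<zero>\<^bsub>class_ring\<^esub>" by simp
    qed (use uv in auto)
    then show "\<exists>u\<in>carrier (copy \<iota>). \<exists>v\<in>carrier (copy \<iota>). u \<noteq> v \<and> V.lin_indpt {u, v}"
      using uv ne by blast
  qed
qed

end

end

section \<open>Banach spaces given by records\<close>

context banach_space
begin

lemma vnorm_zero [simp]: "vnorm X \<zero>\<^bsub>X\<^esub> = 0"
  using vnorm_eq_0_iff[of "\<zero>\<^bsub>X\<^esub>"] by simp

lemma scalar_zero [simp]: "x \<in> carrier X \<Longrightarrow> (0 :: 'k) \<odot>\<^bsub>X\<^esub> x = \<zero>\<^bsub>X\<^esub>"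
  using lmult_0[of x] by simp

lemma scalar_one [simp]: "x \<in> carrier X \<Longrightarrow> (1 :: 'k) \<odot>\<^bsub>X\<^esub> x = x"
  using smult_one[of x] by simp

lemma scalar_closed [simp, intro]: "x \<in> carrier X \<Longrightarrow> (c :: 'k) \<odot>\<^bsub>X\<^esub> x \<in> carrier X"
  using smult_closed[of c x] by simp

lemma scalar_add: "x \<in> carrier X \<Longrightarrow> (a + b :: 'k) \<odot>\<^bsub>X\<^esub> x = a \<odot>\<^bsub>X\<^esub> x \<oplus>\<^bsub>X\<^esub> b \<odot>\<^bsub>X\<^esub> x"
  using smult_l_distr[of a b x] by simp

lemma scalar_mult: "x \<in> carrier X \<Longrightarrow> (a * b :: 'k) \<odot>\<^bsub>X\<^esub> x = a \<odot>\<^bsub>X\<^esub> (b \<odot>\<^bsub>X\<^esub> x)"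
  using smult_assoc1[of a b x] by simp

lemma scalar_distrib:
  "x \<in> carrier X \<Longrightarrow> y \<in> carrier X \<Longrightarrow> (a :: 'k) \<odot>\<^bsub>X\<^esub> (x \<oplus>\<^bsub>X\<^esub> y) = a \<odot>\<^bsub>X\<^esub> x \<oplus>\<^bsub>X\<^esub> a \<odot>\<^bsub>X\<^esub> y"
  using smult_r_distr[of a x y] by simp

lemma minus_eq_scalar: "x \<in> carrier X \<Longrightarrow> y \<in> carrier X \<Longrightarrow> x \<ominus>\<^bsub>X\<^esub> y = x \<oplus>\<^bsub>X\<^esub> (-1 :: 'k) \<odot>\<^bsub>X\<^esub> y"
proof -
  assume xy: "x \<in> carrier X" "y \<in> carrier X"
  have "(-1 :: 'k) \<odot>\<^bsub>X\<^esub> y \<oplus>\<^bsub>X\<^esub> y = \<zero>\<^bsub>X\<^esub>"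
    using scalar_add[OF xy(2), of "-1" 1] xy by simp
  then have "\<ominus>\<^bsub>X\<^esub> y = (-1 :: 'k) \<odot>\<^bsub>X\<^esub> y"
    using xy by (intro M.minus_equality) auto
  then show ?thesis by (simp add: a_minus_def)
qed

lemma vnorm_nonneg: "x \<in> carrier X \<Longrightarrow> 0 \<le> vnorm X x"
proof -
  assume x: "x \<in> carrier X"
  have "x \<ominus>\<^bsub>X\<^esub> x = \<zero>\<^bsub>X\<^esub>" using x by (simp add: M.r_neg a_minus_def)
  then have "0 \<le> vnorm X x + vnorm X ((-1 :: 'k) \<odot>\<^bsub>X\<^esub> x)"
    using vnorm_triangle[OF x scalar_closed[OF x, of "-1"]] x by (simp add: minus_eq_scalar)
  then show ?thesis using vnorm_smult[OF x, of "-1"] by simp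
qed

definition comb :: "nat set \<Rightarrow> (nat \<Rightarrow> 'a) \<Rightarrow> (nat \<Rightarrow> 'k) \<Rightarrow> 'a" where
  "comb F v a = (\<Oplus>\<^bsub>X\<^esub>k\<in>F. a k \<odot>\<^bsub>X\<^esub> v k)"

lemma comb_empty [simp]: "comb {} v a = \<zero>\<^bsub>X\<^esub>"
  by (simp add: comb_def)

lemma comb_insert:
  "finite F \<Longrightarrow> k \<notin> F \<Longrightarrow> (\<And>k. v k \<in> carrier X) \<Longrightarrow> comb (insert k F) v a = a k \<odot>\<^bsub>X\<^esub> v k \<oplus>\<^bsub>X\<^esub> comb F v a"
  unfolding comb_def by (rule M.finsum_insert) auto

lemma comb_closed [simp, intro]: "(\<And>k. v k \<in> carrier X) \<Longrightarrow> comb F v a \<in> carrier X"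
  unfolding comb_def by (rule M.finsum_closed) auto

lemma comb_add: "(\<And>k. v k \<in> carrier X) \<Longrightarrow> comb F v (a + b) = comb F v a \<oplus>\<^bsub>X\<^esub> comb F v b"
  unfolding comb_def
  by (subst M.finsum_addf[symmetric]) (auto simp: scalar_add pointwise)

lemma comb_fscale: "finite F \<Longrightarrow> (\<And>k. v k \<in> carrier X) \<Longrightarrow> comb F v (fscale c a) = c \<odot>\<^bsub>X\<^esub> comb F v a"
proof (induction F rule: finite_induct)
  case empty
  then show ?case using rmult_0[of c] by simp
next
  case (insert k F)
  then show ?case by (simp add: comb_insert scalar_distrib scalar_mult pointwise)
qed

lemma comb_diff:
  assumes "finite F" "\<And>k. v k \<in> carrier X"
  shows "comb F v (a - b) = comb F v a \<ominus>\<^bsub>X\<^esub> comb F v b"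
proof -
  have "a - b = a + fscale (-1) b" by (simp add: fun_eq_iff pointwise)
  then have "comb F v (a - b) = comb F v (a + fscale (-1) b)" by (rule arg_cong)
  then show ?thesis using assms by (simp only: comb_add comb_fscale minus_eq_scalar comb_closed)
qed

lemma comb_support:
  assumes "finite G" "F \<subseteq> G" "\<And>k. v k \<in> carrier X" "\<And>k. k \<in> G - F \<Longrightarrow> a k = 0"
  shows "comb G v a = comb F v a"
  unfolding comb_def using assms by (intro M.add.finprod_mono_neutral_cong_right) auto

lemma comb_unitv:
  assumes "finite F" "k \<in> F" "\<And>k. v k \<in> carrier X"
  shows "comb F v (unitv k) = v k"
proof -
  have "comb F v (unitv k) = comb {k} v (unitv k)"
    using assms by (intro comb_support) (auto simp: unitv_apply)
  also have "\<dots> = v k" using comb_insert[of "{}" k v "unitv k"] assms by (simp add: unitv_apply)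
  finally show ?thesis .
qed

lemma vnorm_comb_le:
  assumes "finite F" "\<And>k. v k \<in> carrier X"
  shows "vnorm X (comb F v a) \<le> (\<Sum>k\<in>F. norm (a k) * vnorm X (v k))"
  using assms(1)
proof (induction F rule: finite_induct)
  case (insert k F)
  then show ?case
    using vnorm_triangle[of "a k \<odot>\<^bsub>X\<^esub> v k" "comb F v a"] assms(2) by (simp add: comb_insert vnorm_smult)
qed simp

text \<open>
  As a function of the two coefficients, the norm obeys the rules below, so that estimates with two
  vectors become arithmetic with scalars.
\<close>

definition vnorm2 :: "'a \<Rightarrow> 'a \<Rightarrow> 'k \<Rightarrow> 'k \<Rightarrow> real" where
  "vnorm2 u v a b = vnorm X (a \<odot>\<^bsub>X\<^esub> u \<oplus>\<^bsub>X\<^esub> b \<odot>\<^bsub>X\<^esub> v)"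

context
  fixes u v assumes uv: "u \<in> carrier X" "v \<in> carrier X"
begin

lemma vnorm2_add: "vnorm2 u v (a + c) (b + d) \<le> vnorm2 u v a b + vnorm2 u v c d"
proof -
  have "(a + c) \<odot>\<^bsub>X\<^esub> u \<oplus>\<^bsub>X\<^esub> (b + d) \<odot>\<^bsub>X\<^esub> v =
      (a \<odot>\<^bsub>X\<^esub> u \<oplus>\<^bsub>X\<^esub> b \<odot>\<^bsub>X\<^esub> v) \<oplus>\<^bsub>X\<^esub> (c \<odot>\<^bsub>X\<^esub> u \<oplus>\<^bsub>X\<^esub> d \<odot>\<^bsub>X\<^esub> v)"
    using uv by (simp add: scalar_add M.a_ac)
  then show ?thesis using uv vnorm_triangle by (simp add: vnorm2_def)
qed

lemma vnorm2_mult: "vnorm2 u v (c * a) (c * b) = norm c * vnorm2 u v a b"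
proof -
  have "(c * a) \<odot>\<^bsub>X\<^esub> u \<oplus>\<^bsub>X\<^esub> (c * b) \<odot>\<^bsub>X\<^esub> v = c \<odot>\<^bsub>X\<^esub> (a \<odot>\<^bsub>X\<^esub> u \<oplus>\<^bsub>X\<^esub> b \<odot>\<^bsub>X\<^esub> v)"
    using uv by (simp add: scalar_mult scalar_distrib)
  then show ?thesis using uv vnorm_smult by (simp add: vnorm2_def)
qed

lemma vnorm2_le: "vnorm2 u v a b \<le> norm a * vnorm X u + norm b * vnorm X v"
  using vnorm_triangle[of "a \<odot>\<^bsub>X\<^esub> u" "b \<odot>\<^bsub>X\<^esub> v"] uv by (simp add: vnorm2_def vnorm_smult)

lemma vnorm2_simps:
  "vnorm2 u v 1 1 = vnorm X (u \<oplus>\<^bsub>X\<^esub> v)" "vnorm2 u v 1 (-1) = vnorm X (u \<ominus>\<^bsub>X\<^esub> v)"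
  "vnorm2 u v 1 0 = vnorm X u" "vnorm2 u v 0 1 = vnorm X v"
  using uv by (simp_all add: vnorm2_def minus_eq_scalar)

lemma vnorm_add_le_minus: "vnorm X u \<le> vnorm X (u \<ominus>\<^bsub>X\<^esub> v) + vnorm X v"
  using vnorm2_add[of 1 0 "-1" 1] by (simp add: vnorm2_simps)

lemma vnorm_le_add: "vnorm X u \<le> vnorm X (u \<oplus>\<^bsub>X\<^esub> v) + vnorm X v"
  using vnorm2_add[of 1 0 1 "-1"] vnorm2_le[of 0 "-1"] by (simp add: vnorm2_simps)

lemma vnorm_minus_commute: "vnorm X (u \<ominus>\<^bsub>X\<^esub> v) = vnorm X (v \<ominus>\<^bsub>X\<^esub> u)"
proof -
  have "vnorm X (v \<ominus>\<^bsub>X\<^esub> u) = vnorm2 u v (-1) 1"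
    using uv by (simp add: vnorm2_def minus_eq_scalar M.a_comm)
  then show ?thesis using vnorm2_mult[of "-1" 1 "-1"] by (simp add: vnorm2_simps)
qed

lemma vnorm_minus_le: "vnorm X (u \<ominus>\<^bsub>X\<^esub> v) \<le> vnorm X u + vnorm X v"
  using vnorm2_le[of 1 "-1"] by (simp add: vnorm2_simps)

lemma minus_eq_zero_imp: "vnorm X (u \<ominus>\<^bsub>X\<^esub> v) = 0 \<Longrightarrow> u = v"
proof -
  assume "vnorm X (u \<ominus>\<^bsub>X\<^esub> v) = 0"
  then have "u \<ominus>\<^bsub>X\<^esub> v = \<zero>\<^bsub>X\<^esub>" using uv vnorm_eq_0_iff by simp
  then show "u = v" using uv by (metis M.minus_equality M.minus_minus a_minus_def M.a_inv_closed)
qed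

end

lemma vnorm_minus_triangle:
  assumes "u \<in> carrier X" "v \<in> carrier X" "w \<in> carrier X"
  shows "vnorm X (u \<ominus>\<^bsub>X\<^esub> w) \<le> vnorm X (u \<ominus>\<^bsub>X\<^esub> v) + vnorm X (v \<ominus>\<^bsub>X\<^esub> w)"
proof -
  have "u \<ominus>\<^bsub>X\<^esub> w = (u \<ominus>\<^bsub>X\<^esub> v) \<oplus>\<^bsub>X\<^esub> (v \<ominus>\<^bsub>X\<^esub> w)"
    using assms by (simp add: a_minus_def M.a_ac M.r_neg1 M.r_neg2)
  then show ?thesis using assms vnorm_triangle by simp
qed

text \<open>
  If \<open>\<parallel>u + v\<parallel>\<close> is almost \<open>2 R\<close>, both norms are almost \<open>R\<close>, and replacing \<open>u\<close> and \<open>v\<close> by \<open>R\<close> times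
  their normalizations changes \<open>u \<plusminus> v\<close> by less than \<open>2 R \<delta>\<close> in norm.
\<close>

lemma uniformly_convex_scaled:
  assumes "uniformly_convex_space X"
  shows "\<exists>\<delta>. 0 < \<delta> \<and> \<delta> \<le> 1 / 4 \<and> (\<forall>u\<in>carrier X. \<forall>v\<in>carrier X. \<forall>R>0.
     vnorm X u \<le> R \<longrightarrow> vnorm X v \<le> R \<longrightarrow> vnorm X (u \<oplus>\<^bsub>X\<^esub> v) > 2 * R * (1 - \<delta>) \<longrightarrow>
     vnorm X (u \<ominus>\<^bsub>X\<^esub> v) < R / 4)"
proof -
  obtain \<delta>0 where \<delta>0: "0 < \<delta>0" "\<delta>0 < 1" "\<And>y1 y2. y1 \<in> unit_sphere X \<Longrightarrow> y2 \<in> unit_sphere X \<Longrightarrow>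
      vnorm X (y1 \<oplus>\<^bsub>X\<^esub> y2) / 2 > 1 - \<delta>0 \<Longrightarrow> vnorm X (y1 \<ominus>\<^bsub>X\<^esub> y2) < 1 / 8"
    using assms[unfolded uniformly_convex_space_def, rule_format, of "1 / 8"] by auto
  define \<delta> where "\<delta> = min (\<delta>0 / 2) (1 / 16)"
  have \<delta>: "0 < \<delta>" "\<delta> \<le> 1 / 16" "2 * \<delta> \<le> \<delta>0" using \<delta>0 by (auto simp: \<delta>_def)
  have "vnorm X (u \<ominus>\<^bsub>X\<^esub> v) < R / 4"
    if uv: "u \<in> carrier X" "v \<in> carrier X" and R: "R > 0" "vnorm X u \<le> R" "vnorm X v \<le> R"
      and big: "vnorm X (u \<oplus>\<^bsub>X\<^esub> v) > 2 * R * (1 - \<delta>)" for u v R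
  proof -
    define \<alpha> \<beta> where "\<alpha> = vnorm X u" and "\<beta> = vnorm X v"
    have sum: "\<alpha> + \<beta> > 2 * R * (1 - \<delta>)"
      using big vnorm_triangle[OF uv] by (simp add: \<alpha>_def \<beta>_def)
    have small: "R * \<delta> \<le> R * (1 / 16)" using R \<delta> by (intro mult_left_mono) auto
    have "\<alpha> + \<beta> > 2 * R - 2 * (R * \<delta>)" using sum by (simp add: algebra_simps)
    moreover have "\<alpha> \<le> R" "\<beta> \<le> R" using R by (auto simp: \<alpha>_def \<beta>_def)
    ultimately have pos: "\<alpha> > 0" "\<beta> > 0" using R(1) small by linarith+
    define u' v' where "u' = (of_real (1 / \<alpha>) :: 'k) \<odot>\<^bsub>X\<^esub> u" and "v' = (of_real (1 / \<beta>) :: 'k) \<odot>\<^bsub>X\<^esub> v"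
    have uv': "u' \<in> carrier X" "v' \<in> carrier X" using uv by (auto simp: u'_def v'_def)
    have sph: "u' \<in> unit_sphere X" "v' \<in> unit_sphere X"
      using uv pos by (auto simp: unit_sphere_def u'_def v'_def vnorm_smult norm_divide \<alpha>_def \<beta>_def)
    have unscale: "u = (of_real \<alpha> :: 'k) \<odot>\<^bsub>X\<^esub> u'" "v = (of_real \<beta> :: 'k) \<odot>\<^bsub>X\<^esub> v'"
      using uv pos by (simp_all add: u'_def v'_def scalar_mult[symmetric])
    have norm1: "vnorm X u' = 1" "vnorm X v' = 1" using sph by (auto simp: unit_sphere_def)
    have rest: "vnorm2 u' v' (of_real (\<alpha> - R)) (of_real s * of_real (\<beta> - R)) \<le> (R - \<alpha>) + (R - \<beta>)"
      if "\<bar>s\<bar> = 1" for s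
      using vnorm2_le[OF uv', of "of_real (\<alpha> - R)" "of_real s * of_real (\<beta> - R)"] norm1 R that
      by (simp add: norm_mult \<alpha>_def \<beta>_def norm_of_real del: of_real_diff)
    \<comment> \<open>The sign \<open>s\<close> treats the sum (\<open>s = 1\<close>) and the difference (\<open>s = -1\<close>) together.\<close>
    have main: "vnorm2 u' v' (of_real \<alpha>) (of_real s * of_real \<beta>) \<le>
        R * vnorm2 u' v' 1 (of_real s) + (R - \<alpha>) + (R - \<beta>)" if "\<bar>s\<bar> = 1" for s
    proof -
      have "vnorm2 u' v' (of_real \<alpha>) (of_real s * of_real \<beta>) \<le>
         vnorm2 u' v' (of_real R * 1) (of_real R * of_real s) +
         vnorm2 u' v' (of_real (\<alpha> - R)) (of_real s * of_real (\<beta> - R))"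
        using vnorm2_add[OF uv', of "of_real R * 1" "of_real (\<alpha> - R)" "of_real R * of_real s" "of_real s * of_real (\<beta> - R)"]
        by (simp add: algebra_simps)
      then show ?thesis using rest[OF that] vnorm2_mult[OF uv', of "of_real R" 1 "of_real s"] R by simp
    qed
    have "vnorm X (u \<oplus>\<^bsub>X\<^esub> v) = vnorm2 u' v' (of_real \<alpha>) (of_real 1 * of_real \<beta>)"
      by (simp add: vnorm2_def unscale[symmetric])
    then have "2 * R * (1 - \<delta>) < R * vnorm X (u' \<oplus>\<^bsub>X\<^esub> v') + (2 * R - (\<alpha> + \<beta>))"
      using main[of 1] big vnorm2_simps(1)[OF uv'] by simp
    then have "R * vnorm X (u' \<oplus>\<^bsub>X\<^esub> v') > R * (2 * (1 - 2 * \<delta>))" using sum by (simp add: algebra_simps)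
    then have "vnorm X (u' \<oplus>\<^bsub>X\<^esub> v') / 2 > 1 - \<delta>0" using R \<delta> by simp
    then have "vnorm X (u' \<ominus>\<^bsub>X\<^esub> v') < 1 / 8" using \<delta>0(3) sph by blast
    then have close: "R * vnorm X (u' \<ominus>\<^bsub>X\<^esub> v') < R / 8" using R by simp
    have "vnorm X (u \<ominus>\<^bsub>X\<^esub> v) = vnorm2 u' v' (of_real \<alpha>) (of_real (- 1) * of_real \<beta>)"
      using uv uv' by (simp add: vnorm2_def minus_eq_scalar unscale[symmetric] scalar_mult[symmetric])
        (metis unscale(2) mult_minus1 scalar_mult uv'(2))
    then have "vnorm X (u \<ominus>\<^bsub>X\<^esub> v) \<le> R * vnorm X (u' \<ominus>\<^bsub>X\<^esub> v') + (2 * R - (\<alpha> + \<beta>))"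
      using main[of "-1"] vnorm2_simps(2)[OF uv'] by simp
    then have "vnorm X (u \<ominus>\<^bsub>X\<^esub> v) < R / 8 + 2 * (R * \<delta>)"
      using close sum by (simp add: algebra_simps)
    then show ?thesis using small by simp
  qed
  then show ?thesis using \<delta> by (intro exI[of _ \<delta>]) auto
qed

lemma uniformly_convex_imp_strictly_convex:
  assumes uc: "uniformly_convex_space X" and uv: "u \<in> carrier X" "v \<in> carrier X"
    and "vnorm X u \<le> 1" "vnorm X v \<le> 1" "vnorm X (u \<oplus>\<^bsub>X\<^esub> v) = 2"
  shows "u = v"
proof -
  have sph: "u \<in> unit_sphere X" "v \<in> unit_sphere X"
    using assms vnorm_triangle[OF uv] by (auto simp: unit_sphere_def)
  have "vnorm X (u \<ominus>\<^bsub>X\<^esub> v) < \<epsilon>" if pos: "\<epsilon> > 0" for \<epsilon>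
  proof -
    obtain \<delta> where "0 < \<delta>" and \<delta>: "\<And>y1 y2. y1 \<in> unit_sphere X \<Longrightarrow> y2 \<in> unit_sphere X \<Longrightarrow>
      vnorm X (y1 \<oplus>\<^bsub>X\<^esub> y2) / 2 > 1 - \<delta> \<Longrightarrow> vnorm X (y1 \<ominus>\<^bsub>X\<^esub> y2) < \<epsilon>"
      using uc[unfolded uniformly_convex_space_def, rule_format, of \<epsilon>] pos by auto
    then show ?thesis using sph assms by simp
  qed
  from this[of "vnorm X (u \<ominus>\<^bsub>X\<^esub> v)"] have "vnorm X (u \<ominus>\<^bsub>X\<^esub> v) = 0"
    using vnorm_nonneg[of "u \<ominus>\<^bsub>X\<^esub> v"] uv by fastforce
  then show ?thesis by (rule minus_eq_zero_imp[OF uv])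
qed

end

section \<open>Small unconditional sums in infinite dimension\<close>

context banach_space
begin

lemma comb_in_span:
  assumes "finite F" "\<And>k. v k \<in> carrier X"
  shows "comb F v a \<in> span (v ` F)"
proof -
  have sub: "submodule class_ring (span (v ` F)) X"
    using assms by (intro span_is_submodule) auto
  have "comb G v a \<in> span (v ` F)" if "G \<subseteq> F" for G
    using finite_subset[OF that assms(1)] that
  proof (induction G rule: finite_induct)
    case empty
    then show ?case using submodule.zero_closed[OF sub] sub submodule_def by auto
  next
    case (insert k G)
    have "v k \<in> span (v ` F)" using in_own_span[of "v ` F"] assms insert.prems by auto
    then have "a k \<odot>\<^bsub>X\<^esub> v k \<in> span (v ` F)" using submodule.smult_closed[OF sub, of "a k" "v k"] by simp
    then show ?case
      using insert assms submodule.m_closed[OF sub] by (simp add: comb_insert)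
  qed
  then show ?thesis by simp
qed

text \<open>
  The bound of \<open>coeff_bound\<close> for a finite stretch of vectors, as it is available while the sequence
  is still being constructed.
\<close>

lemma coeff_bound_of_last:
  assumes z: "\<And>k. z k \<in> carrier X"
    and last: "\<And>m a. m < n \<Longrightarrow> norm (a m) \<le> 2 * vnorm X (comb {..m} z a)"
    and unit: "\<And>k. k < n \<Longrightarrow> vnorm X (z k) = 1"
  shows "\<exists>M\<ge>0. \<forall>a. \<forall>i<n. norm (a i) \<le> M * vnorm X (comb {..<n} z a)"
  using last unit
proof (induction n)
  case 0
  then show ?case by auto
next
  case (Suc n)
  then obtain M where M: "M \<ge> 0" "\<And>a i. i < n \<Longrightarrow> norm (a i) \<le> M * vnorm X (comb {..<n} z a)"
    by (metis less_SucI)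
  have "norm (a i) \<le> (2 + 3 * M) * vnorm X (comb {..<Suc n} z a)" if "i < Suc n" for a i
  proof -
    have an: "norm (a n) \<le> 2 * vnorm X (comb {..<Suc n} z a)"
      using Suc.prems(1)[of n a] by (simp add: lessThan_Suc_atMost)
    have nn: "0 \<le> vnorm X (comb {..<Suc n} z a)" using z by (intro vnorm_nonneg comb_closed)
    show ?thesis
    proof (cases "i = n")
      case True
      have "0 \<le> 3 * M * vnorm X (comb {..<Suc n} z a)" using M nn by simp
      then show ?thesis using True an by (simp add: distrib_right)
    next
      case False
      have "comb {..<Suc n} z a = a n \<odot>\<^bsub>X\<^esub> z n \<oplus>\<^bsub>X\<^esub> comb {..<n} z a"
        using z by (simp add: lessThan_Suc comb_insert)
      then have "comb {..<Suc n} z a = comb {..<n} z a \<oplus>\<^bsub>X\<^esub> a n \<odot>\<^bsub>X\<^esub> z n"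
        using z by (simp add: M.a_comm)
      then have "vnorm X (comb {..<n} z a) \<le> vnorm X (comb {..<Suc n} z a) + norm (a n)"
        using vnorm_le_add[of "comb {..<n} z a" "a n \<odot>\<^bsub>X\<^esub> z n"] z Suc.prems(2)[of n]
        by (simp add: vnorm_smult)
      then have "vnorm X (comb {..<n} z a) \<le> 3 * vnorm X (comb {..<Suc n} z a)" using an by linarith
      then have "M * vnorm X (comb {..<n} z a) \<le> M * (3 * vnorm X (comb {..<Suc n} z a))"
        using M by (intro mult_left_mono)
      moreover have "norm (a i) \<le> M * vnorm X (comb {..<n} z a)" using M(2) False that by simp
      ultimately have "norm (a i) \<le> M * (3 * vnorm X (comb {..<Suc n} z a))" by linarith
      then show ?thesis using nn by (simp add: distrib_right)
    qed
  qed
  then show ?case using M(1) by (intro exI[of _ "2 + 3 * M"]) auto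
qed

end

text \<open>
  Riesz' lemma for the span of \<open>z 0, \<dots>, z (n - 1)\<close>. The span misses some vector \<open>y0\<close>, and the distance
  \<open>d\<close> of \<open>y0\<close> from it is positive: since the coefficients are controlled by the norm, a minimizing
  sequence with \<open>d = 0\<close> would converge coordinatewise and put \<open>y0\<close> into the span. An almost nearest point
  then gives \<open>y\<close> after normalization.
\<close>

lemma riesz_vector:
  fixes X :: "('k::{real_normed_field, euclidean_space}, 'a) normed_module"
  assumes "banach_space X" and inf: "\<not> vectorspace.fin_dim class_ring X"
    and z: "\<And>k. z k \<in> carrier X"
    and last: "\<And>m a. m < n \<Longrightarrow> norm (a m) \<le> 2 * vnorm X (banach_space.comb X {..m} z a)"
    and unit: "\<And>k. k < n \<Longrightarrow> vnorm X (z k) = 1"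
  shows "\<exists>y\<in>carrier X. vnorm X y = 1 \<and> (\<forall>a. 1 / 2 \<le> vnorm X (y \<oplus>\<^bsub>X\<^esub> banach_space.comb X {..<n} z a))"
proof -
  interpret banach_space X by fact
  obtain M where M: "M \<ge> 0" "\<And>a i. i < n \<Longrightarrow> norm (a i) \<le> M * vnorm X (comb {..<n} z a)"
    using coeff_bound_of_last[OF z last unit] by blast
  obtain y0 where y0: "y0 \<in> carrier X" "\<And>a. y0 \<noteq> comb {..<n} z a"
  proof (rule ccontr)
    assume "\<not> thesis"
    then have "\<forall>y\<in>carrier X. \<exists>a. y = comb {..<n} z a" using that by blast
    then have "carrier X \<subseteq> span (z ` {..<n})" using comb_in_span[of "{..<n}" z] z by auto
    moreover have "z ` {..<n} \<subseteq> carrier X" using z by auto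
    ultimately have "gen_set (z ` {..<n})" using span_is_subset2 by auto
    then have "fin_dim" using \<open>z ` {..<n} \<subseteq> carrier X\<close> by (auto simp: fin_dim_def)
    then show False using inf by simp
  qed
  define f where "f a = vnorm X (y0 \<ominus>\<^bsub>X\<^esub> comb {..<n} z a)" for a
  have cl: "comb {..<n} z a \<in> carrier X" for a using z by (rule comb_closed)
  have f0: "0 \<le> f a" for a using y0 cl by (auto simp: f_def intro: vnorm_nonneg)
  define d where "d = (INF a. f a)"
  have bdd: "bdd_below (range f)" using f0 by (intro bdd_belowI[of _ 0]) auto
  have d_le: "d \<le> f a" for a unfolding d_def using bdd by (intro cINF_lower) auto
  have d_pos: "d > 0"
  proof (rule ccontr)
    assume "\<not> d > 0"
    then have "\<exists>a. f a < 1 / real (Suc j)" for j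
      unfolding d_def using cINF_less_iff[OF _ bdd, of "1 / real (Suc j)"]
      by (metis UNIV_I UNIV_not_empty less_le_trans linorder_not_less of_nat_0_less_iff zero_less_Suc zero_less_divide_1_iff)
    then obtain s where s: "\<And>j. f (s j) < 1 / real (Suc j)" by metis
    have dist: "norm (s j i - s l i) \<le> M * (f (s j) + f (s l))" if "i < n" for i j l
    proof -
      have "norm ((s j - s l) i) \<le> M * vnorm X (comb {..<n} z (s j - s l))" using M(2) that by blast
      also have "vnorm X (comb {..<n} z (s j - s l)) = vnorm X (comb {..<n} z (s j) \<ominus>\<^bsub>X\<^esub> comb {..<n} z (s l))"
        using z by (simp add: comb_diff)
      also have "M * \<dots> \<le> M * (f (s j) + f (s l))"
        using vnorm_minus_triangle[OF cl y0(1) cl, of "s j" "s l"] vnorm_minus_commute[OF y0(1) cl, of "s j"] M(1)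
        by (intro mult_left_mono) (auto simp: f_def)
      finally show ?thesis by (simp add: pointwise)
    qed
    have lim0: "(\<lambda>j. f (s j)) \<longlonglongrightarrow> 0"
      by (rule tendsto_sandwich[OF _ _ tendsto_const LIMSEQ_inverse_real_of_nat])
        (use s f0 in \<open>auto simp: inverse_eq_divide less_imp_le\<close>)
    have "\<exists>l. (\<lambda>j. s j i) \<longlonglongrightarrow> l" if "i < n" for i
    proof -
      have "Cauchy (\<lambda>j. s j i)"
      proof (rule metric_CauchyI)
        fix e :: real assume "e > 0"
        define K where "K = M + 1"
        have K: "K > 0" "M \<le> K" using M by (auto simp: K_def)
        have "e / (2 * K) > 0" using K \<open>e > 0\<close> by simp
        then obtain N where N: "\<And>j. j \<ge> N \<Longrightarrow> f (s j) < e / (2 * K)"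
          using LIMSEQ_D[OF lim0] f0 by fastforce
        have "dist (s j i) (s l i) < e" if "j \<ge> N" "l \<ge> N" for j l
        proof -
          have "f (s j) + f (s l) < e / K" 
          proof -
            have "e / K = e / (2 * K) + e / (2 * K)" using K by (simp add: field_simps)
            then show ?thesis using N[OF that(1)] N[OF that(2)] by linarith
          qed
          then have "K * (f (s j) + f (s l)) < e" using K by (simp add: field_simps)
          moreover have "M * (f (s j) + f (s l)) \<le> K * (f (s j) + f (s l))"
            using f0 K by (intro mult_right_mono) (auto intro: add_nonneg_nonneg)
          ultimately show ?thesis using dist[OF \<open>i < n\<close>, of j l] by (simp add: dist_norm)
        qed
        then show "\<exists>N. \<forall>j\<ge>N. \<forall>l\<ge>N. dist (s j i) (s l i) < e" by blast
      qed
      then show ?thesis by (simp add: Cauchy_convergent_iff convergent_def)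
    qed
    then obtain a where a: "\<And>i. i < n \<Longrightarrow> (\<lambda>j. s j i) \<longlonglongrightarrow> a i" by metis
    have "f a \<le> f (s j) + (\<Sum>i<n. norm (s j i - a i) * vnorm X (z i))" for j
    proof -
      have "f a \<le> f (s j) + vnorm X (comb {..<n} z (s j) \<ominus>\<^bsub>X\<^esub> comb {..<n} z a)"
        unfolding f_def using vnorm_minus_triangle[OF y0(1) cl cl] .
      also have "comb {..<n} z (s j) \<ominus>\<^bsub>X\<^esub> comb {..<n} z a = comb {..<n} z (s j - a)"
        using z by (simp add: comb_diff)
      finally show ?thesis using vnorm_comb_le[of "{..<n}" z "s j - a"] z by (simp add: pointwise)
    qed
    moreover have "(\<lambda>j. f (s j) + (\<Sum>i<n. norm (s j i - a i) * vnorm X (z i))) \<longlonglongrightarrow> 0 + (\<Sum>i<n. norm (a i - a i) * vnorm X (z i))"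
      using a by (intro tendsto_intros lim0) auto
    ultimately have "f a \<le> 0" by (intro LIMSEQ_le_const) auto
    then have "f a = 0" using f0[of a] by simp
    then have "y0 = comb {..<n} z a" unfolding f_def by (rule minus_eq_zero_imp[OF y0(1) cl])
    then show False using y0(2) by blast
  qed
  have "d < 2 * d" using d_pos by simp
  then obtain a0 where a0: "f a0 < 2 * d"
    unfolding d_def using cINF_less_iff[OF _ bdd, of "2 * (INF a. f a)"] by auto
  have fpos: "f a0 > 0" using d_le[of a0] d_pos by simp
  define c :: 'k where "c = of_real (1 / f a0)"
  have c: "norm c = 1 / f a0" "c \<noteq> 0" using fpos by (auto simp: c_def norm_divide)
  define y where "y = c \<odot>\<^bsub>X\<^esub> (y0 \<ominus>\<^bsub>X\<^esub> comb {..<n} z a0)"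
  have ycl: "y \<in> carrier X" using y0 cl by (auto simp: y_def)
  have "vnorm X y = norm c * f a0" using y0 cl by (simp add: y_def f_def vnorm_smult)
  then have y1: "vnorm X y = 1" using c fpos by simp
  have "1 / 2 \<le> vnorm X (y \<oplus>\<^bsub>X\<^esub> comb {..<n} z a)" for a
  proof -
    define b where "b = a0 - fscale (1 / c) a"
    have "y \<oplus>\<^bsub>X\<^esub> comb {..<n} z a = c \<odot>\<^bsub>X\<^esub> (y0 \<ominus>\<^bsub>X\<^esub> comb {..<n} z b)"
    proof -
      have eq: "fscale (-1) b = fscale (-1) a0 + fscale (1 / c) a"
        by (simp add: b_def fun_eq_iff pointwise)
      have "y0 \<ominus>\<^bsub>X\<^esub> comb {..<n} z b = y0 \<oplus>\<^bsub>X\<^esub> comb {..<n} z (fscale (-1) b)"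
        using z y0 cl by (simp add: comb_fscale minus_eq_scalar)
      also have "\<dots> = (y0 \<oplus>\<^bsub>X\<^esub> comb {..<n} z (fscale (-1) a0)) \<oplus>\<^bsub>X\<^esub> (1 / c) \<odot>\<^bsub>X\<^esub> comb {..<n} z a"
        unfolding eq using z y0 cl by (simp add: comb_add comb_fscale M.a_assoc)
      also have "y0 \<oplus>\<^bsub>X\<^esub> comb {..<n} z (fscale (-1) a0) = y0 \<ominus>\<^bsub>X\<^esub> comb {..<n} z a0"
        using z y0 cl by (simp add: comb_fscale minus_eq_scalar)
      finally show ?thesis
        using z y0 cl c by (simp add: y_def scalar_distrib scalar_mult[symmetric])
    qed
    then have "vnorm X (y \<oplus>\<^bsub>X\<^esub> comb {..<n} z a) = norm c * f b"
      using y0 cl by (simp add: f_def vnorm_smult)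
    moreover have "norm c * d \<le> norm c * f b" using d_le by (intro mult_left_mono) auto
    moreover have "norm c * f a0 \<le> norm c * (2 * d)" using a0 by (intro mult_left_mono) auto
    moreover have "norm c * f a0 = 1" using c fpos by simp
    ultimately show ?thesis by linarith
  qed
  then show ?thesis using ycl y1 by blast
qed

lemma riesz_sequence:
  fixes X :: "('k::{real_normed_field, euclidean_space}, 'a) normed_module"
  assumes "banach_space X" and inf: "\<not> vectorspace.fin_dim class_ring X"
  shows "\<exists>z. (\<forall>k. z k \<in> carrier X \<and> vnorm X (z k) = 1) \<and>
    (\<forall>m a. norm (a m) \<le> 2 * vnorm X (banach_space.comb X {..m} z a))"
proof -
  interpret banach_space X by fact
  \<comment> \<open>Dependent choice requires that \<open>P\<close> look only at the entries of \<open>z\<close> below \<open>n\<close>; the other entries are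
    replaced by zero.\<close>
  define P where "P z n y \<longleftrightarrow> y \<in> carrier X \<and> vnorm X y = 1 \<and>
      (\<forall>a. 1 / 2 \<le> vnorm X (y \<oplus>\<^bsub>X\<^esub> comb {..<n} (\<lambda>k. if k < n then z k else \<zero>\<^bsub>X\<^esub>) a))" for z n y
  have last: "norm (a m) \<le> 2 * vnorm X (comb {..m} z a)"
    if P: "\<And>k. k \<le> m \<Longrightarrow> P z' k (z k)" and z: "\<And>k. z k \<in> carrier X"
      and agree: "\<And>k. k < m \<Longrightarrow> z' k = z k" for z z' m and a :: "nat \<Rightarrow> 'k"
  proof (cases "a m = 0")
    case True
    then show ?thesis using z by (simp add: vnorm_nonneg comb_closed)
  next
    case False
    define c where "c = 1 / a m"
    have sc: "c \<odot>\<^bsub>X\<^esub> comb {..m} z a = z m \<oplus>\<^bsub>X\<^esub> comb {..<m} z (fscale c a)"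
    proof -
      have "c \<odot>\<^bsub>X\<^esub> comb {..m} z a = comb (insert m {..<m}) z (fscale c a)"
        using z by (simp add: comb_fscale ivl_disj_un(2)[symmetric] lessThan_Suc_atMost[symmetric] lessThan_Suc)
      then show ?thesis using z False by (simp add: comb_insert pointwise c_def)
    qed
    have "comb {..<m} z (fscale c a) = comb {..<m} (\<lambda>k. if k < m then z' k else \<zero>\<^bsub>X\<^esub>) (fscale c a)"
      unfolding comb_def using z agree by (intro M.finsum_cong') auto
    then have "1 / 2 \<le> vnorm X (z m \<oplus>\<^bsub>X\<^esub> comb {..<m} z (fscale c a))"
      using P[of m] by (simp add: P_def)
    also have "\<dots> = norm c * vnorm X (comb {..m} z a)"
      using z by (simp add: sc[symmetric] vnorm_smult comb_closed)
    finally show ?thesis using False by (simp add: c_def norm_divide field_simps)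
  qed
  have "\<exists>z. \<forall>n. P z n (z n)"
  proof (rule dependent_wellorder_choice)
    show "P f n y = P g n y" if "\<And>k. k < n \<Longrightarrow> f k = g k" for n y and f g :: "nat \<Rightarrow> 'a"
    proof -
      have "(\<lambda>k. if k < n then f k else \<zero>\<^bsub>X\<^esub>) = (\<lambda>k. if k < n then g k else \<zero>\<^bsub>X\<^esub>)"
        using that by auto
      then show ?thesis by (simp add: P_def)
    qed
    show "\<exists>y. P f n y" if prev: "\<And>k. k < n \<Longrightarrow> P f k (f k)" for n f
    proof -
      define z where "z k = (if k < n then f k else \<zero>\<^bsub>X\<^esub>)" for k
      have z: "z k \<in> carrier X" for k using prev by (auto simp: z_def P_def)
      have l: "norm (a m) \<le> 2 * vnorm X (comb {..m} z a)" if "m < n" for m a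
        by (rule last[of m f]) (use prev z that in \<open>auto simp: z_def\<close>)
      have un: "vnorm X (z k) = 1" if "k < n" for k using prev[OF that] that by (simp add: z_def P_def)
      have "\<exists>y\<in>carrier X. vnorm X y = 1 \<and> (\<forall>a. 1 / 2 \<le> vnorm X (y \<oplus>\<^bsub>X\<^esub> comb {..<n} z a))"
        by (rule riesz_vector[OF assms z l un])
      then show ?thesis unfolding P_def z_def by blast
    qed
  qed
  then obtain z where z: "\<And>n. P z n (z n)" by blast
  then have "norm (a m) \<le> 2 * vnorm X (comb {..m} z a)" for a m
    by (intro last[of _ z z]) (auto simp: P_def)
  then show ?thesis using z by (intro exI[of _ z]) (auto simp: P_def)
qed

text \<open>
  The lemmas on coefficient sequences apply to \<open>p a = \<parallel>\<Sum>k a\<^sub>k z\<^sub>k\<parallel>\<close>, where \<open>z\<close> is the Riesz sequence.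
\<close>

lemma small_unconditional_sums:
  fixes X :: "('k::{real_normed_field, euclidean_space}, 'a) normed_module"
  assumes "banach_space X" and inf: "\<not> vectorspace.fin_dim class_ring X"
    and uc: "uniformly_convex_space X" and D: "D > 0"
  shows "\<exists>m y. (\<forall>l. y l \<in> carrier X \<and> vnorm X (y l) = 1) \<and>
    (\<forall>q. (\<forall>l. norm (q l) \<le> 1 / 2 ^ m) \<longrightarrow> vnorm X (banach_space.comb X {..<2 ^ m} y q) \<le> D)"
proof -
  interpret banach_space X by fact
  obtain z where z: "\<And>k. z k \<in> carrier X" "\<And>k. vnorm X (z k) = 1"
    and last: "\<And>m a. norm (a m) \<le> 2 * vnorm X (comb {..m} z a)"
    using riesz_sequence[OF assms(1,2)] by blast
  define L where "L a = comb {k. a k \<noteq> 0} z a" for a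
  have cl: "L a \<in> carrier X" for a using z by (simp add: L_def comb_closed)
  have L_eq: "L a = comb F z a" if "finite F" "\<And>k. k \<notin> F \<Longrightarrow> a k = 0" for a F
    unfolding L_def using that z by (intro comb_support[symmetric]) auto
  have supp: "\<exists>n. \<forall>k. k \<notin> {..<n} \<longrightarrow> a k = 0" if "a \<in> c00" for a :: "nat \<Rightarrow> 'k"
    using that by (auto simp: c00_def not_less)
  have supp2: "\<exists>n. (\<forall>k. k \<notin> {..<n} \<longrightarrow> a k = 0) \<and> (\<forall>k. k \<notin> {..<n} \<longrightarrow> b k = 0)"
    if ab: "a \<in> c00" "b \<in> c00" for a b :: "nat \<Rightarrow> 'k"
  proof -
    obtain n n' where n: "\<forall>k. k \<notin> {..<n} \<longrightarrow> a k = 0" "\<forall>k. k \<notin> {..<n'} \<longrightarrow> b k = 0"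
      using supp ab by blast
    then show ?thesis by (intro exI[of _ "max n n'"]) auto
  qed
  have L_add: "L (a + b) = L a \<oplus>\<^bsub>X\<^esub> L b" if ab: "a \<in> c00" "b \<in> c00" for a b
  proof -
    obtain n where n: "\<And>k. k \<notin> {..<n} \<Longrightarrow> a k = 0" "\<And>k. k \<notin> {..<n} \<Longrightarrow> b k = 0"
      using supp2[OF ab] by blast
    have "L a = comb {..<n} z a" "L b = comb {..<n} z b" "L (a + b) = comb {..<n} z (a + b)"
      by (rule L_eq; simp add: n pointwise)+
    then show ?thesis using z by (simp add: comb_add)
  qed
  have L_diff: "L (a - b) = L a \<ominus>\<^bsub>X\<^esub> L b" if ab: "a \<in> c00" "b \<in> c00" for a b
  proof -
    obtain n where n: "\<And>k. k \<notin> {..<n} \<Longrightarrow> a k = 0" "\<And>k. k \<notin> {..<n} \<Longrightarrow> b k = 0"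
      using supp2[OF ab] by blast
    have "L a = comb {..<n} z a" "L b = comb {..<n} z b" "L (a - b) = comb {..<n} z (a - b)"
      by (rule L_eq; simp add: n pointwise)+
    then show ?thesis using z by (simp add: comb_diff)
  qed
  have L_fscale: "L (fscale c a) = c \<odot>\<^bsub>X\<^esub> L a" if a: "a \<in> c00" for c a
  proof -
    obtain n where n: "\<And>k. k \<notin> {..<n} \<Longrightarrow> a k = 0" using supp[OF a] by blast
    have "L a = comb {..<n} z a" "L (fscale c a) = comb {..<n} z (fscale c a)"
      by (rule L_eq; simp add: n pointwise)+
    then show ?thesis using z by (simp add: comb_fscale)
  qed
  define p where "p a = vnorm X (L a)" for a
  interpret P: c00_seminorm p
  proof
    show "p (a + b) \<le> p a + p b" if "a \<in> c00" "b \<in> c00" for a b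
      using that vnorm_triangle[OF cl cl] by (simp add: p_def L_add)
    show "p (fscale c a) = norm c * p a" if "a \<in> c00" for c a
      using that cl by (simp add: p_def L_fscale vnorm_smult)
    show "p (unitv n) = 1" for n
      using L_eq[of "{n}" "unitv n"] comb_unitv[of "{n}" n z] z by (simp add: p_def unitv_apply)
    show "norm (a n) \<le> 2 * p a" if "\<And>k. k > n \<Longrightarrow> a k = 0" for a n
      using last[of a n] L_eq[of "{..n}" a] that by (simp add: p_def not_le)
  qed
  obtain \<delta> where \<delta>: "0 < \<delta>" "\<delta> \<le> 1 / 4" and far: "\<And>u v R. u \<in> carrier X \<Longrightarrow> v \<in> carrier X \<Longrightarrow> R > 0 \<Longrightarrow>
     vnorm X u \<le> R \<Longrightarrow> vnorm X v \<le> R \<Longrightarrow> vnorm X (u \<oplus>\<^bsub>X\<^esub> v) > 2 * R * (1 - \<delta>) \<Longrightarrow>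
     vnorm X (u \<ominus>\<^bsub>X\<^esub> v) < R / 4"
    using uniformly_convex_scaled[OF uc] by blast
  have far': "p (u - v) < R / 4" if "u \<in> c00" "v \<in> c00" "R > 0" "p u \<le> R" "p v \<le> R" "p (u + v) > 2 * R * (1 - \<delta>)" for u v R
    using far[OF cl cl that(3), of u v] that by (simp add: p_def L_add L_diff)
  have "\<exists>m (y :: nat \<Rightarrow> nat \<Rightarrow> 'k). (\<forall>l. y l \<in> c00 \<and> p (y l) = 1) \<and>
      (\<forall>q. (\<forall>l. norm (q l) \<le> 1 / 2 ^ m) \<longrightarrow> p (\<Sum>l<2 ^ m. fscale (q l) (y l)) \<le> D)"
    by (rule P.small_unconditional_sum[OF _ \<delta> D]) (rule far')
  then obtain m and y :: "nat \<Rightarrow> nat \<Rightarrow> 'k" where y: "\<forall>l. y l \<in> c00 \<and> p (y l) = 1"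
    and small: "\<forall>q. (\<forall>l. norm (q l) \<le> 1 / 2 ^ m) \<longrightarrow> p (\<Sum>l<2 ^ m. fscale (q l) (y l)) \<le> D"
    by (elim exE conjE)
  have yc: "y l \<in> c00" for l using y by simp
  have comb_L: "L (\<Sum>l\<in>F. fscale (q l) (y l)) = comb F (\<lambda>l. L (y l)) q" if "finite F" for q F
    using that
  proof (induction F rule: finite_induct)
    case empty
    have "L (fscale 0 0) = \<zero>\<^bsub>X\<^esub>" using L_fscale[OF c00_zero, of 0] cl by simp
    moreover have "fscale 0 0 = (0 :: nat \<Rightarrow> 'k)" by (simp add: fun_eq_iff pointwise)
    ultimately show ?case by simp
  next
    case (insert l F)
    have "L (\<Sum>l\<in>insert l F. fscale (q l) (y l)) = L (fscale (q l) (y l) + (\<Sum>l\<in>F. fscale (q l) (y l)))"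
      using insert by simp
    also have "\<dots> = q l \<odot>\<^bsub>X\<^esub> L (y l) \<oplus>\<^bsub>X\<^esub> L (\<Sum>l\<in>F. fscale (q l) (y l))"
      by (simp only: L_add L_fscale c00_intros yc)
    finally show ?case using insert cl by (simp add: comb_insert)
  qed
  show ?thesis
  proof (intro exI[of _ m] exI[of _ "\<lambda>l. L (y l)"] conjI allI impI)
    show "L (y l) \<in> carrier X" for l by (rule cl)
    show "vnorm X (L (y l)) = 1" for l using y by (simp add: p_def)
    show "vnorm X (comb {..<2 ^ m} (\<lambda>l. L (y l)) q) \<le> D" if "\<forall>l. norm (q l) \<le> 1 / 2 ^ m" for q
      using small[rule_format, of q] that comb_L[of "{..<2 ^ m}" q] by (simp add: p_def)
  qed
qed

section \<open>The universal property on sequence spaces\<close>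

lemma bounded_opI:
  fixes X :: "('k::real_normed_field, 'a) normed_module" and Y :: "('k, 'b) normed_module"
  assumes "banach_space X" "banach_space Y"
    and "\<And>x. x \<in> carrier X \<Longrightarrow> T x \<in> carrier Y"
    and "\<And>x y. x \<in> carrier X \<Longrightarrow> y \<in> carrier X \<Longrightarrow> T (x \<oplus>\<^bsub>X\<^esub> y) = T x \<oplus>\<^bsub>Y\<^esub> T y"
    and "\<And>c x. x \<in> carrier X \<Longrightarrow> T (c \<odot>\<^bsub>X\<^esub> x) = c \<odot>\<^bsub>Y\<^esub> T x"
    and "\<And>x. x \<in> carrier X \<Longrightarrow> vnorm Y (T x) \<le> C * vnorm X x"
  shows "T \<in> bounded_op X Y"
proof -
  interpret X: banach_space X by fact
  interpret Y: banach_space Y by fact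
  have "mod_hom class_ring X Y T"
    using assms by unfold_locales (auto simp: module_hom_def)
  then have "linear_map class_ring X Y T"
    by (intro linear_map.intro X.vectorspace_axioms Y.vectorspace_axioms)
  then show ?thesis using assms(6) by (auto simp: bounded_op_def)
qed

lemma bounded_opD:
  assumes "T \<in> bounded_op X Y"
  shows "x \<in> carrier X \<Longrightarrow> T x \<in> carrier Y"
    and "x \<in> carrier X \<Longrightarrow> y \<in> carrier X \<Longrightarrow> T (x \<oplus>\<^bsub>X\<^esub> y) = T x \<oplus>\<^bsub>Y\<^esub> T y"
    and "x \<in> carrier X \<Longrightarrow> T (c \<odot>\<^bsub>X\<^esub> x) = c \<odot>\<^bsub>Y\<^esub> T x"
    and "\<exists>C. \<forall>x\<in>carrier X. vnorm Y (T x) \<le> C * vnorm X x"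
proof -
  have "T \<in> module_hom class_ring X Y"
    using assms by (auto simp: bounded_op_def linear_map_def mod_hom_def mod_hom_axioms_def)
  then show "x \<in> carrier X \<Longrightarrow> T x \<in> carrier Y"
    "x \<in> carrier X \<Longrightarrow> y \<in> carrier X \<Longrightarrow> T (x \<oplus>\<^bsub>X\<^esub> y) = T x \<oplus>\<^bsub>Y\<^esub> T y"
    "x \<in> carrier X \<Longrightarrow> T (c \<odot>\<^bsub>X\<^esub> x) = c \<odot>\<^bsub>Y\<^esub> T x"
    by (auto simp: module_hom_def)
  show "\<exists>C. \<forall>x\<in>carrier X. vnorm Y (T x) \<le> C * vnorm X x"
    using assms by (auto simp: bounded_op_def)
qed

lemma op_norm_le:
  assumes "banach_space X" "\<And>x. x \<in> unit_ball X \<Longrightarrow> vnorm Y (T x) \<le> C"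
  shows "op_norm X Y T \<le> C"
proof -
  interpret X: banach_space X by fact
  have "\<zero>\<^bsub>X\<^esub> \<in> unit_ball X" by (simp add: unit_ball_def)
  then show ?thesis unfolding op_norm_def using assms(2) by (intro cSUP_least) auto
qed

lemma vnorm_le_op_norm:
  fixes X :: "('k::real_normed_field, 'a) normed_module" and Y :: "('k, 'b) normed_module"
  assumes "banach_space X" "banach_space Y" and T: "T \<in> bounded_op X Y" and x: "x \<in> carrier X"
  shows "vnorm Y (T x) \<le> op_norm X Y T * vnorm X x"
proof -
  interpret X: banach_space X by fact
  interpret Y: banach_space Y by fact
  obtain C where C: "\<And>x. x \<in> carrier X \<Longrightarrow> vnorm Y (T x) \<le> C * vnorm X x"
    using bounded_opD(4)[OF T] by blast
  have "vnorm Y (T x) \<le> \<bar>C\<bar>" if "x \<in> unit_ball X" for x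
  proof -
    have "C * vnorm X x \<le> \<bar>C\<bar> * 1"
      using that X.vnorm_nonneg by (intro mult_mono) (auto simp: unit_ball_def)
    then show ?thesis using C[of x] that by (auto simp: unit_ball_def)
  qed
  then have bdd: "bdd_above ((\<lambda>x. vnorm Y (T x)) ` unit_ball X)"
    by (intro bdd_aboveI2)
  show ?thesis
  proof (cases "vnorm X x = 0")
    case True
    then show ?thesis using C[OF x] by simp
  next
    case False
    then have pos: "vnorm X x > 0" using X.vnorm_nonneg[OF x] by simp
    define c :: 'k where "c = of_real (1 / vnorm X x)"
    have c: "norm c = 1 / vnorm X x" using pos by (simp add: c_def norm_divide)
    have "c \<odot>\<^bsub>X\<^esub> x \<in> unit_ball X"
      using x pos c by (simp add: unit_ball_def X.vnorm_smult)
    then have "vnorm Y (T (c \<odot>\<^bsub>X\<^esub> x)) \<le> op_norm X Y T"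
      unfolding op_norm_def using bdd by (intro cSUP_upper)
    then show ?thesis
      using bounded_opD(1,3)[OF T x] c pos by (simp add: Y.vnorm_smult field_simps)
  qed
qed

lemma bounded_op_diff:
  assumes "banach_space X" "banach_space Y" and S: "S \<in> bounded_op X Y" and T: "T \<in> bounded_op X Y"
  shows "(\<lambda>x. S x \<ominus>\<^bsub>Y\<^esub> T x) \<in> bounded_op X Y"
proof -
  interpret X: banach_space X by fact
  interpret Y: banach_space Y by fact
  note [simp] = bounded_opD(1-3)[OF S] bounded_opD(1-3)[OF T]
  show ?thesis
  proof (rule bounded_opI[OF assms(1,2)])
    fix x assume x: "x \<in> carrier X"
    show "S x \<ominus>\<^bsub>Y\<^esub> T x \<in> carrier Y" using x by simp
    show "S (c \<odot>\<^bsub>X\<^esub> x) \<ominus>\<^bsub>Y\<^esub> T (c \<odot>\<^bsub>X\<^esub> x) = c \<odot>\<^bsub>Y\<^esub> (S x \<ominus>\<^bsub>Y\<^esub> T x)" for c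
      using x by (simp add: Y.minus_eq_scalar Y.scalar_distrib Y.scalar_mult[symmetric])
    show "vnorm Y (S x \<ominus>\<^bsub>Y\<^esub> T x) \<le> (op_norm X Y S + op_norm X Y T) * vnorm X x"
      using x Y.vnorm_minus_le[of "S x" "T x"] vnorm_le_op_norm[OF assms(1,2) S x] vnorm_le_op_norm[OF assms(1,2) T x]
      by (simp add: distrib_right)
    fix y assume y: "y \<in> carrier X"
    show "S (x \<oplus>\<^bsub>X\<^esub> y) \<ominus>\<^bsub>Y\<^esub> T (x \<oplus>\<^bsub>X\<^esub> y) = S x \<ominus>\<^bsub>Y\<^esub> T x \<oplus>\<^bsub>Y\<^esub> (S y \<ominus>\<^bsub>Y\<^esub> T y)"
      using x y by (simp add: Y.minus_eq_scalar Y.scalar_distrib Y.M.a_ac)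
  qed
qed

lemma bounded_op_scalar:
  assumes "banach_space X" "banach_space Y" and T: "T \<in> bounded_op X Y"
  shows "(\<lambda>x. c \<odot>\<^bsub>Y\<^esub> T x) \<in> bounded_op X Y"
proof -
  interpret X: banach_space X by fact
  interpret Y: banach_space Y by fact
  note [simp] = bounded_opD(1-3)[OF T]
  show ?thesis
  proof (rule bounded_opI[OF assms(1,2)])
    fix x assume x: "x \<in> carrier X"
    show "c \<odot>\<^bsub>Y\<^esub> T x \<in> carrier Y" using x by simp
    show "c \<odot>\<^bsub>Y\<^esub> T (d \<odot>\<^bsub>X\<^esub> x) = d \<odot>\<^bsub>Y\<^esub> (c \<odot>\<^bsub>Y\<^esub> T x)" for d
      using x by (simp add: Y.scalar_mult[symmetric] mult.commute)
    show "vnorm Y (c \<odot>\<^bsub>Y\<^esub> T x) \<le> (norm c * op_norm X Y T) * vnorm X x"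
      using x vnorm_le_op_norm[OF assms(1,2) T x] by (simp add: Y.vnorm_smult mult.assoc mult_left_mono)
    fix y assume "y \<in> carrier X"
    then show "c \<odot>\<^bsub>Y\<^esub> T (x \<oplus>\<^bsub>X\<^esub> y) = c \<odot>\<^bsub>Y\<^esub> T x \<oplus>\<^bsub>Y\<^esub> c \<odot>\<^bsub>Y\<^esub> T y"
      using x by (simp add: Y.scalar_distrib)
  qed
qed

text \<open>
  Constant sequences at two vectors where the norm is attained are maximizing, so both images are
  unimodular multiples of the image of the exposing vector.
\<close>

lemma RSE_unique_direction:
  fixes X :: "('k::real_normed_field, 'a) normed_module" and Y :: "('k, 'b) normed_module"
  assumes "banach_space X" "banach_space Y" and S: "S \<in> RSE X Y"
    and x: "x \<in> unit_ball X" "vnorm Y (S x) = op_norm X Y S"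
    and y: "y \<in> unit_ball X" "vnorm Y (S y) = op_norm X Y S"
  shows "\<exists>c. norm c = 1 \<and> S x = c \<odot>\<^bsub>Y\<^esub> S y"
proof -
  interpret X: banach_space X by fact
  interpret Y: banach_space Y by fact
  have Sb: "S \<in> bounded_op X Y" using S by (simp add: RSE_def)
  obtain x0 where x0: "x0 \<in> unit_sphere X" and exp: "\<And>s. (\<forall>n. s n \<in> unit_ball X) \<Longrightarrow>
      (\<lambda>n. vnorm Y (S (s n))) \<longlonglongrightarrow> op_norm X Y S \<Longrightarrow>
      \<exists>\<sigma> :: nat \<Rightarrow> nat. \<exists>c :: 'k. strict_mono \<sigma> \<and> norm c = 1 \<and>
          (\<lambda>n. vnorm Y (S (s (\<sigma> n)) \<ominus>\<^bsub>Y\<^esub> c \<odot>\<^bsub>Y\<^esub> S x0)) \<longlonglongrightarrow> 0"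
    using S unfolding RSE_def by blast
  have Sx0: "S x0 \<in> carrier Y" using x0 bounded_opD(1)[OF Sb] by (simp add: unit_sphere_def)
  have dir: "\<exists>c. norm c = 1 \<and> S z = c \<odot>\<^bsub>Y\<^esub> S x0"
    if z: "z \<in> unit_ball X" "vnorm Y (S z) = op_norm X Y S" for z
  proof -
    obtain c :: 'k where c: "norm c = 1" "(\<lambda>n :: nat. vnorm Y (S z \<ominus>\<^bsub>Y\<^esub> c \<odot>\<^bsub>Y\<^esub> S x0)) \<longlonglongrightarrow> 0"
      using exp[of "\<lambda>_. z"] z by auto
    then have "vnorm Y (S z \<ominus>\<^bsub>Y\<^esub> c \<odot>\<^bsub>Y\<^esub> S x0) = 0" by (simp add: LIMSEQ_const_iff)
    then have "S z = c \<odot>\<^bsub>Y\<^esub> S x0"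
      using Sx0 z bounded_opD(1)[OF Sb] by (intro Y.minus_eq_zero_imp) (auto simp: unit_ball_def)
    then show ?thesis using c by blast
  qed
  obtain a b where a: "norm a = 1" "S x = a \<odot>\<^bsub>Y\<^esub> S x0" and b: "norm b = 1" "S y = b \<odot>\<^bsub>Y\<^esub> S x0"
    using dir[OF x] dir[OF y] by blast
  have "b \<noteq> 0" using b by auto
  then have "S x = (a / b) \<odot>\<^bsub>Y\<^esub> S y" using a b Sx0 by (simp add: Y.scalar_mult[symmetric])
  moreover have "norm (a / b) = 1" using a b by (simp add: norm_divide)
  ultimately show ?thesis by blast
qed

context renormed_l1
begin

text \<open>
  What the Bishop-Phelps-Bollobas property yields for \<open>T\<close> at \<open>x\<close>, written in terms of sequences. The
  factor \<open>2\<close> leaves room for normalizing \<open>T\<close>, which is only known to have norm at most one.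
\<close>

definition exposing_approximation ::
    "('k, 'a) normed_module \<Rightarrow> real \<Rightarrow> ((nat \<Rightarrow> 'k) \<Rightarrow> 'a) \<Rightarrow> (nat \<Rightarrow> 'k) \<Rightarrow> ((nat \<Rightarrow> 'k) \<Rightarrow> 'a) \<Rightarrow> (nat \<Rightarrow> 'k) \<Rightarrow> bool" where
  "exposing_approximation Y \<epsilon> T x S x0 \<longleftrightarrow>
     (\<forall>w\<in>l1. S w \<in> carrier Y) \<and>
     (\<forall>w\<in>l1. \<forall>v\<in>l1. S (w + v) = S w \<oplus>\<^bsub>Y\<^esub> S v) \<and>
     (\<forall>c. \<forall>w\<in>l1. S (fscale c w) = c \<odot>\<^bsub>Y\<^esub> S w) \<and>
     (\<forall>w\<in>l1. vnorm Y (S w) \<le> \<nu> w) \<and>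
     x0 \<in> l1 \<and> \<nu> x0 = 1 \<and> vnorm Y (S x0) = 1 \<and> \<nu> (x - x0) < \<epsilon> \<and>
     (\<forall>w\<in>l1. vnorm Y (T w \<ominus>\<^bsub>Y\<^esub> S w) \<le> 2 * \<epsilon> * \<nu> w) \<and>
     (\<forall>w\<in>l1. \<forall>v\<in>l1. \<nu> w = 1 \<longrightarrow> \<nu> v = 1 \<longrightarrow> vnorm Y (S w) = 1 \<longrightarrow> vnorm Y (S v) = 1 \<longrightarrow>
        (\<exists>c. norm c = 1 \<and> S w = c \<odot>\<^bsub>Y\<^esub> S v))"

lemma exposing_approximation_exists:
  fixes Y :: "('k, 'a) normed_module"
  assumes Y: "banach_space Y" and univ: "universal_BPBp_RSE_range Y" and \<epsilon>: "\<epsilon> > 0"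
  shows "\<exists>\<eta>. 0 < \<eta> \<and> \<eta> < \<epsilon> \<and> (\<forall>F v x. finite F \<longrightarrow> (\<forall>k. v k \<in> carrier Y) \<longrightarrow>
     (\<forall>w\<in>l1. \<nu> w \<le> 1 \<longrightarrow> vnorm Y (banach_space.comb Y F v w) \<le> 1) \<longrightarrow>
     x \<in> l1 \<longrightarrow> \<nu> x = 1 \<longrightarrow> vnorm Y (banach_space.comb Y F v x) > 1 - \<eta> \<longrightarrow>
     (\<exists>S x0. exposing_approximation Y \<epsilon> (banach_space.comb Y F v) x S x0))"
proof -
  interpret Y: banach_space Y by fact
  obtain \<iota> :: "(nat \<Rightarrow> 'k) \<Rightarrow> 'a" where inj: "inj \<iota>" using inj_sequences_into_line[OF Y] by blast
  define Z :: "('k, 'a) normed_module" where "Z = copy \<iota>"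
  have Z: "banach_space Z" unfolding Z_def by (rule copy_banach_space[OF inj])
  interpret Z: banach_space Z by (rule Z)
  note Zs = copy_simps[OF inj, folded Z_def] copy_minus[OF inj, folded Z_def]
  have ball: "z \<in> unit_ball Z \<longleftrightarrow> (\<exists>w\<in>l1. z = \<iota> w \<and> \<nu> w \<le> 1)" for z
    by (auto simp: unit_ball_def Zs)
  obtain \<eta>0 where \<eta>0: "0 < \<eta>0" "\<eta>0 < \<epsilon>" and bpb: "\<forall>T\<in>bounded_op Z Y. \<forall>x\<in>unit_sphere Z.
      op_norm Z Y T = 1 \<and> vnorm Y (T x) > 1 - \<eta>0 \<longrightarrow>
      (\<exists>S\<in>RSE Z Y. \<exists>x0\<in>unit_sphere Z. op_norm Z Y S = 1 \<and> vnorm Y (S x0) = 1 \<and>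
         op_norm Z Y (\<lambda>z. S z \<ominus>\<^bsub>Y\<^esub> T z) < \<epsilon> \<and> vnorm Z (x \<ominus>\<^bsub>Z\<^esub> x0) < \<epsilon>)"
    using univ Z \<epsilon> unfolding universal_BPBp_RSE_range_def BPBp_RSE_def by blast
  define \<eta> where "\<eta> = min \<eta>0 (1 / 2)"
  have \<eta>: "0 < \<eta>" "\<eta> \<le> \<eta>0" "\<eta> \<le> 1 / 2" using \<eta>0 by (auto simp: \<eta>_def)
  \<comment> \<open>The property is applied to \<open>T / N\<close>, where \<open>1 - \<eta> < N \<le> 1\<close> is the norm of \<open>T\<close>.\<close>
  have "\<exists>S x0. exposing_approximation Y \<epsilon> (Y.comb F v) x S x0"
    if F: "finite F" and v: "\<And>k. v k \<in> carrier Y"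
      and le1: "\<And>w. w \<in> l1 \<Longrightarrow> \<nu> w \<le> 1 \<Longrightarrow> vnorm Y (Y.comb F v w) \<le> 1"
      and x: "x \<in> l1" "\<nu> x = 1" and big: "vnorm Y (Y.comb F v x) > 1 - \<eta>" for F v x
  proof -
    define T where "T z = Y.comb F v (inv_into UNIV \<iota> z)" for z
    have T\<iota>: "T (\<iota> w) = Y.comb F v w" for w by (simp add: T_def inj)
    have cl: "Y.comb F v w \<in> carrier Y" for w using v by (rule Y.comb_closed)
    have Tb: "T \<in> bounded_op Z Y"
    proof (rule bounded_opI[OF Z Y])
      fix z assume "z \<in> carrier Z"
      then obtain w where w: "z = \<iota> w" "w \<in> l1" by (auto simp: Zs)
      show "T z \<in> carrier Y" by (simp add: w T\<iota> cl)
      show "T (c \<odot>\<^bsub>Z\<^esub> z) = c \<odot>\<^bsub>Y\<^esub> T z" for c using F v by (simp add: w Zs T\<iota> Y.comb_fscale)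
      have "vnorm Y (Y.comb F v w) \<le> (\<Sum>k\<in>F. norm (w k) * vnorm Y (v k))" by (rule Y.vnorm_comb_le[OF F v])
      also have "\<dots> \<le> (\<Sum>k\<in>F. (C * \<nu> w) * vnorm Y (v k))"
        using norm_le_l1_norm[OF w(2)] l1_norm_le[OF w(2)] v Y.vnorm_nonneg
        by (intro sum_mono mult_right_mono) (auto intro: order_trans)
      also have "\<dots> = (C * (\<Sum>k\<in>F. vnorm Y (v k))) * \<nu> w" by (simp add: sum_distrib_left mult_ac)
      finally show "vnorm Y (T z) \<le> (C * (\<Sum>k\<in>F. vnorm Y (v k))) * vnorm Z z" by (simp add: w Zs T\<iota>)
      fix y assume "y \<in> carrier Z"
      then obtain u where u: "y = \<iota> u" "u \<in> l1" by (auto simp: Zs)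
      show "T (z \<oplus>\<^bsub>Z\<^esub> y) = T z \<oplus>\<^bsub>Y\<^esub> T y" using v by (simp add: w u Zs T\<iota> Y.comb_add)
    qed
    define N where "N = op_norm Z Y T"
    have T_le: "vnorm Y (Y.comb F v w) \<le> N * \<nu> w" if "w \<in> l1" for w
      using vnorm_le_op_norm[OF Z Y Tb, of "\<iota> w"] that by (simp add: Zs T\<iota> N_def)
    have N: "1 - \<eta> < N" using T_le[OF x(1)] x(2) big by simp
    have N0: "N > 0" using N \<eta> by simp
    have N1: "N \<le> 1" unfolding N_def by (rule op_norm_le[OF Z]) (auto simp: ball T\<iota> le1)
    define c :: 'k where "c = of_real (1 / N)"
    have c: "norm c = 1 / N" using N0 by (simp add: c_def norm_divide)
    define T1 where "T1 z = c \<odot>\<^bsub>Y\<^esub> T z" for z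
    have T1b: "T1 \<in> bounded_op Z Y" unfolding T1_def by (rule bounded_op_scalar[OF Z Y Tb])
    have T1\<iota>: "T1 (\<iota> w) = c \<odot>\<^bsub>Y\<^esub> Y.comb F v w" for w by (simp add: T1_def T\<iota>)
    have nT1: "vnorm Y (T1 (\<iota> w)) = vnorm Y (Y.comb F v w) / N" for w
      using cl by (simp add: T1\<iota> Y.vnorm_smult c)
    have "op_norm Z Y T1 \<le> 1"
    proof (rule op_norm_le[OF Z])
      fix z assume "z \<in> unit_ball Z"
      then obtain w where w: "w \<in> l1" "z = \<iota> w" "\<nu> w \<le> 1" by (auto simp: ball)
      have "vnorm Y (Y.comb F v w) \<le> N * 1" using T_le[OF w(1)] mult_left_mono[OF w(3), of N] N0 by linarith
      then show "vnorm Y (T1 z) \<le> 1" using N0 by (simp add: w nT1)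
    qed
    moreover have "op_norm Z Y T \<le> op_norm Z Y T1 * N"
    proof (rule op_norm_le[OF Z])
      fix z assume "z \<in> unit_ball Z"
      then obtain w where w: "w \<in> l1" "z = \<iota> w" "\<nu> w \<le> 1" by (auto simp: ball)
      have "vnorm Y (T1 z) \<le> op_norm Z Y T1 * \<nu> w"
        using vnorm_le_op_norm[OF Z Y T1b, of z] w by (simp add: Zs)
      also have "\<dots> \<le> op_norm Z Y T1 * 1"
      proof (rule mult_left_mono[OF w(3)])
        have "0 \<le> vnorm Y (T1 (\<iota> x))" using N0 Y.vnorm_nonneg[OF cl] by (simp add: nT1)
        also have "\<dots> \<le> op_norm Z Y T1 * vnorm Z (\<iota> x)"
          using x by (intro vnorm_le_op_norm[OF Z Y T1b]) (simp add: Zs)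
        finally show "0 \<le> op_norm Z Y T1" using x by (simp add: Zs)
      qed
      finally show "vnorm Y (T z) \<le> op_norm Z Y T1 * N"
        using N0 by (simp add: w nT1 T\<iota> field_simps)
    qed
    ultimately have T1n: "op_norm Z Y T1 = 1" using N0 by (simp add: N_def[symmetric])
    have xs: "\<iota> x \<in> unit_sphere Z" using x by (simp add: unit_sphere_def Zs)
    have "1 - \<eta>0 < vnorm Y (Y.comb F v x)" using big \<eta> by simp
    also have "\<dots> \<le> vnorm Y (T1 (\<iota> x))"
      using N0 mult_right_mono[OF N1 Y.vnorm_nonneg[OF cl]] by (simp add: nT1 field_simps)
    finally have gt: "1 - \<eta>0 < vnorm Y (T1 (\<iota> x))" .
    obtain S' z0 where S': "S' \<in> RSE Z Y" and z0: "z0 \<in> unit_sphere Z"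
      and S'1: "op_norm Z Y S' = 1" "vnorm Y (S' z0) = 1"
      and near: "op_norm Z Y (\<lambda>z. S' z \<ominus>\<^bsub>Y\<^esub> T1 z) < \<epsilon>" "vnorm Z (\<iota> x \<ominus>\<^bsub>Z\<^esub> z0) < \<epsilon>"
      using bpb[rule_format, OF T1b xs conjI[OF T1n gt]] by blast
    obtain x0 where x0: "z0 = \<iota> x0" "x0 \<in> l1" "\<nu> x0 = 1"
      using z0 by (auto simp: unit_sphere_def Zs)
    have S'b: "S' \<in> bounded_op Z Y" using S' by (simp add: RSE_def)
    note S'D = bounded_opD[OF S'b]
    define S where "S w = S' (\<iota> w)" for w
    have Scl: "S w \<in> carrier Y" if "w \<in> l1" for w using S'D(1) that by (simp add: S_def Zs)
    have "exposing_approximation Y \<epsilon> (Y.comb F v) x S x0"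
      unfolding exposing_approximation_def
    proof (intro conjI ballI allI impI)
      show "S w \<in> carrier Y" if "w \<in> l1" for w using Scl that .
      show "S (w + u) = S w \<oplus>\<^bsub>Y\<^esub> S u" if "w \<in> l1" "u \<in> l1" for w u
        using S'D(2)[of "\<iota> w" "\<iota> u"] that by (simp add: S_def Zs)
      show "S (fscale c w) = c \<odot>\<^bsub>Y\<^esub> S w" if "w \<in> l1" for c w
        using S'D(3)[of "\<iota> w" c] that by (simp add: S_def Zs)
      show "vnorm Y (S w) \<le> \<nu> w" if "w \<in> l1" for w
        using vnorm_le_op_norm[OF Z Y S'b, of "\<iota> w"] S'1 that by (simp add: S_def Zs)
      show "x0 \<in> l1" "\<nu> x0 = 1" "vnorm Y (S x0) = 1" using x0 S'1 by (auto simp: S_def)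
      show "\<nu> (x - x0) < \<epsilon>" using near(2) x x0 by (simp add: Zs)
      show "vnorm Y (Y.comb F v w \<ominus>\<^bsub>Y\<^esub> S w) \<le> 2 * \<epsilon> * \<nu> w" if w: "w \<in> l1" for w
      proof -
        have "Y.comb F v w \<ominus>\<^bsub>Y\<^esub> T1 (\<iota> w) = (1 - c) \<odot>\<^bsub>Y\<^esub> Y.comb F v w"
          using cl Y.scalar_add[of "Y.comb F v w" 1 "- c"]
          by (simp add: T1\<iota> Y.minus_eq_scalar Y.scalar_mult[symmetric])
        then have "vnorm Y (Y.comb F v w \<ominus>\<^bsub>Y\<^esub> T1 (\<iota> w)) = norm (1 - c) * vnorm Y (Y.comb F v w)"
          using cl by (simp add: Y.vnorm_smult)
        also have "norm (1 - c) = 1 / N - 1"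
        proof -
          have "1 - c = of_real (1 - 1 / N)" by (simp add: c_def)
          then have "norm (1 - c) = \<bar>1 - 1 / N\<bar>" by (metis norm_of_real)
          then show ?thesis using N0 N1 by simp
        qed
        also have "(1 / N - 1) * vnorm Y (Y.comb F v w) \<le> (1 / N - 1) * (N * \<nu> w)"
          using N0 N1 T_le[OF w] by (intro mult_left_mono) auto
        also have "\<dots> = (1 - N) * \<nu> w" using N0 by (simp add: field_simps)
        also have "\<dots> \<le> \<epsilon> * \<nu> w" using N \<eta> \<eta>0 \<nu>_nonneg[OF w] by (intro mult_right_mono) auto
        finally have first: "vnorm Y (Y.comb F v w \<ominus>\<^bsub>Y\<^esub> T1 (\<iota> w)) \<le> \<epsilon> * \<nu> w" .
        have T1cl: "T1 (\<iota> w) \<in> carrier Y" using cl by (simp add: T1\<iota>)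
        have "vnorm Y (S w \<ominus>\<^bsub>Y\<^esub> T1 (\<iota> w)) \<le> op_norm Z Y (\<lambda>z. S' z \<ominus>\<^bsub>Y\<^esub> T1 z) * \<nu> w"
          using vnorm_le_op_norm[OF Z Y bounded_op_diff[OF Z Y S'b T1b], of "\<iota> w"] w by (simp add: S_def Zs)
        also have "\<dots> \<le> \<epsilon> * \<nu> w" using near(1) \<nu>_nonneg[OF w] by (intro mult_right_mono) auto
        finally have "vnorm Y (T1 (\<iota> w) \<ominus>\<^bsub>Y\<^esub> S w) \<le> \<epsilon> * \<nu> w"
          using Y.vnorm_minus_commute[OF Scl[OF w] T1cl] by simp
        then show ?thesis
          using Y.vnorm_minus_triangle[OF cl T1cl Scl[OF w], of w] first by simp
      qed
      show "\<exists>c. norm c = 1 \<and> S w = c \<odot>\<^bsub>Y\<^esub> S u"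
        if "w \<in> l1" "u \<in> l1" "\<nu> w = 1" "\<nu> u = 1" "vnorm Y (S w) = 1" "vnorm Y (S u) = 1" for w u
        unfolding S_def using that S'1
        by (intro RSE_unique_direction[OF Z Y S']) (auto simp: ball S_def)
    qed
    then show ?thesis by blast
  qed
  then show ?thesis using \<eta> \<eta>0 by (intro exI[of _ \<eta>]) auto
qed

end

section \<open>Uniform convexity\<close>

text \<open>
  The approximating operator \<open>S\<close> attains its norm at a point with nonzero coordinates \<open>0\<close> and \<open>1\<close>, hence at
  \<open>e\<^sub>0\<close> and \<open>e\<^sub>1\<close>. Therefore \<open>S e\<^sub>1 = c S e\<^sub>0\<close> with \<open>|c| = 1\<close>, while \<open>|1 + c|\<close> is almost \<open>2\<close>; the parallelogram law
  in the scalar field then makes \<open>|1 - c|\<close> small.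
\<close>

lemma universal_range_imp_uniformly_convex:
  fixes Y :: "('k::{real_normed_field, euclidean_space}, 'a) normed_module"
  assumes Y: "banach_space Y" and univ: "universal_BPBp_RSE_range Y"
  shows "uniformly_convex_space Y"
  unfolding uniformly_convex_space_def
proof (intro allI impI)
  fix \<epsilon> :: real assume \<epsilon>: "\<epsilon> > 0"
  interpret Y: banach_space Y by fact
  interpret L: renormed_l1 "l1_norm :: (nat \<Rightarrow> 'k) \<Rightarrow> real" 1
    by unfold_locales (auto simp: l1_add l1_fscale)
  \<comment> \<open>With accuracy \<open>e\<close>, one gets \<open>|1 + c| \<ge> 2 - 6 e\<close>, so \<open>|1 - c|\<close> is at most the square root of \<open>24 e\<close>,
    which the last bound makes at most \<open>\<epsilon> / 4\<close>.\<close>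
  define e where "e = min (1 / 4) (min (\<epsilon> / 16) (\<epsilon>\<^sup>2 / 384))"
  have e: "0 < e" "e \<le> 1 / 4" "e \<le> \<epsilon> / 16" "e \<le> \<epsilon>\<^sup>2 / 384" using \<epsilon> by (auto simp: e_def)
  obtain \<eta> where \<eta>: "0 < \<eta>" "\<eta> < e" and
    approx: "\<forall>F v x. finite F \<longrightarrow> (\<forall>k. v k \<in> carrier Y) \<longrightarrow>
     (\<forall>w\<in>l1. l1_norm w \<le> 1 \<longrightarrow> vnorm Y (Y.comb F v w) \<le> 1) \<longrightarrow>
     x \<in> l1 \<longrightarrow> l1_norm x = 1 \<longrightarrow> vnorm Y (Y.comb F v x) > 1 - \<eta> \<longrightarrow>
     (\<exists>S x0. L.exposing_approximation Y e (Y.comb F v) x S x0)"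
    using L.exposing_approximation_exists[OF Y univ e(1)] by blast
  have "vnorm Y (y1 \<ominus>\<^bsub>Y\<^esub> y2) < \<epsilon>"
    if y: "y1 \<in> unit_sphere Y" "y2 \<in> unit_sphere Y" and mid: "vnorm Y (y1 \<oplus>\<^bsub>Y\<^esub> y2) / 2 > 1 - \<eta>" for y1 y2
  proof -
    have yc: "y1 \<in> carrier Y" "y2 \<in> carrier Y" "vnorm Y y1 = 1" "vnorm Y y2 = 1"
      using y by (auto simp: unit_sphere_def)
    define v where "v k = (if k = 0 then y1 else y2)" for k :: nat
    have v: "v k \<in> carrier Y" for k using yc by (simp add: v_def)
    have comb: "Y.comb {0, Suc 0} v w = w 0 \<odot>\<^bsub>Y\<^esub> y1 \<oplus>\<^bsub>Y\<^esub> w (Suc 0) \<odot>\<^bsub>Y\<^esub> y2" for w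
      using v yc by (simp add: Y.comb_insert) (simp add: v_def)
    define x :: "nat \<Rightarrow> 'k" where "x k = (if k = 0 \<or> k = Suc 0 then 1 / 2 else 0)" for k
    have x: "x \<in> l1" "l1_norm x = 1"
      using l1_finite_support[of "{0, Suc 0}" x] by (auto simp: x_def norm_divide)
    have bound: "vnorm Y (Y.comb {0, Suc 0} v w) \<le> 1" if "w \<in> l1" "l1_norm w \<le> 1" for w
    proof -
      have "vnorm Y (Y.comb {0, Suc 0} v w) \<le> (\<Sum>k\<in>{0, Suc 0}. norm (w k) * vnorm Y (v k))"
        using v by (intro Y.vnorm_comb_le) auto
      also have "\<dots> = (\<Sum>k\<in>{0, Suc 0}. norm (w k))" using yc by (intro sum.cong) (auto simp: v_def)
      also have "\<dots> \<le> l1_norm w" using that by (intro sum_norm_le_l1_norm) auto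
      finally show ?thesis using that by simp
    qed
    have "Y.comb {0, Suc 0} v x = (1 / 2) \<odot>\<^bsub>Y\<^esub> (y1 \<oplus>\<^bsub>Y\<^esub> y2)"
      using yc by (simp add: comb x_def Y.scalar_distrib)
    then have "vnorm Y (Y.comb {0, Suc 0} v x) > 1 - \<eta>"
      using mid yc by (simp add: Y.vnorm_smult norm_divide)
    then have "\<exists>S x0. L.exposing_approximation Y e (Y.comb {0, Suc 0} v) x S x0"
      by (intro approx[rule_format]) (use v bound x in auto)
    then obtain S x0 where app: "L.exposing_approximation Y e (Y.comb {0, Suc 0} v) x S x0" by blast
    note app = app[unfolded L.exposing_approximation_def]
    have Scl: "S w \<in> carrier Y" if "w \<in> l1" for w using app that by blast
    have Sadd: "S (w + u) = S w \<oplus>\<^bsub>Y\<^esub> S u" if "w \<in> l1" "u \<in> l1" for w u using app that by blast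
    have Sscale: "S (fscale c w) = c \<odot>\<^bsub>Y\<^esub> S w" if "w \<in> l1" for w c using app that by blast
    have Sle: "vnorm Y (S w) \<le> l1_norm w" if "w \<in> l1" for w using app that by blast
    have x0: "x0 \<in> l1" "l1_norm x0 = 1" "vnorm Y (S x0) = 1" "l1_norm (x - x0) < e" using app by blast+
    have close: "vnorm Y (Y.comb {0, Suc 0} v w \<ominus>\<^bsub>Y\<^esub> S w) \<le> 2 * e * l1_norm w" if "w \<in> l1" for w
      using app that by blast
    have dir: "\<exists>c. norm c = 1 \<and> S w = c \<odot>\<^bsub>Y\<^esub> S u"
      if "w \<in> l1" "u \<in> l1" "l1_norm w = 1" "l1_norm u = 1" "vnorm Y (S w) = 1" "vnorm Y (S u) = 1" for w u
      using app that by blast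
    have attain: "vnorm Y (S (unitv k)) = 1" if k: "k = 0 \<or> k = Suc 0" for k
    proof -
      have "norm (x k - x0 k) < e"
        using norm_le_l1_norm[of "x - x0" k] l1_diff[OF x(1) x0(1)] x0(4) by (simp add: pointwise)
      moreover have "norm (x k) = 1 / 2" using k by (auto simp: x_def norm_divide)
      ultimately have pos: "norm (x0 k) > 0" using e norm_triangle_ineq2[of "x k" "x0 k"] by linarith
      have rem: "x0(k := 0) \<in> l1" "l1_norm (x0(k := 0)) = 1 - norm (x0 k)"
        using l1_norm_remove[OF x0(1), of k] x0(2) by auto
      have fs: "fscale (x0 k) (unitv k) \<in> l1" using l1_fscale[OF l1_unitv(1)] by blast
      have "S x0 = S (fscale (x0 k) (unitv k) + x0(k := 0))" by (rule arg_cong[OF split_coordinate])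
      then have "S x0 = x0 k \<odot>\<^bsub>Y\<^esub> S (unitv k) \<oplus>\<^bsub>Y\<^esub> S (x0(k := 0))"
        by (simp only: Sadd[OF fs rem(1)] Sscale[OF l1_unitv(1)])
      then have "1 \<le> norm (x0 k) * vnorm Y (S (unitv k)) + (1 - norm (x0 k))"
        using Y.vnorm_triangle[of "x0 k \<odot>\<^bsub>Y\<^esub> S (unitv k)" "S (x0(k := 0))"] Scl[OF rem(1)] Scl[OF l1_unitv(1), of k]
          Sle[OF rem(1)] rem(2) x0(3) by (simp add: Y.vnorm_smult)
      then have "norm (x0 k) * 1 \<le> norm (x0 k) * vnorm Y (S (unitv k))" by simp
      then have "1 \<le> vnorm Y (S (unitv k))" using pos by (simp only: mult_le_cancel_left_pos)
      then show ?thesis using Sle[OF l1_unitv(1), of k] l1_unitv(2)[of k, where 'k = 'k] by simp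
    qed
    define s1 s2 where "s1 = S (unitv 0)" and "s2 = S (unitv (Suc 0))"
    have s: "s1 \<in> carrier Y" "s2 \<in> carrier Y" "vnorm Y s1 = 1" "vnorm Y s2 = 1"
      using Scl[OF l1_unitv(1)] attain by (auto simp: s1_def s2_def)
    obtain c where c: "norm c = 1" "s2 = c \<odot>\<^bsub>Y\<^esub> s1"
      using dir[OF l1_unitv(1) l1_unitv(1) l1_unitv(2) l1_unitv(2), of "Suc 0" 0] attain
      unfolding s1_def s2_def by auto
    have "Y.comb {0, Suc 0} v (unitv 0) = y1" "Y.comb {0, Suc 0} v (unitv (Suc 0)) = y2"
      using yc by (simp_all add: comb unitv_apply)
    then have near: "vnorm Y (y1 \<ominus>\<^bsub>Y\<^esub> s1) \<le> 2 * e" "vnorm Y (y2 \<ominus>\<^bsub>Y\<^esub> s2) \<le> 2 * e"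
      using close[OF l1_unitv(1), of 0] close[OF l1_unitv(1), of "Suc 0"] by (simp_all add: s1_def s2_def l1_unitv)
    have "vnorm Y (s1 \<oplus>\<^bsub>Y\<^esub> s2) = norm (1 + c)"
      using s c Y.scalar_add[of s1 1 c] Y.vnorm_smult[of s1 "1 + c"] by simp
    moreover have "vnorm Y (s1 \<ominus>\<^bsub>Y\<^esub> s2) = norm (1 - c)"
      using s c Y.scalar_add[of s1 1 "- c"] Y.vnorm_smult[of s1 "1 - c"] Y.minus_eq_scalar[of s1 s2]
      by (simp add: Y.scalar_mult[symmetric])
    moreover have "vnorm Y (y1 \<oplus>\<^bsub>Y\<^esub> y2) \<le> vnorm Y (s1 \<oplus>\<^bsub>Y\<^esub> s2) + (vnorm Y (y1 \<ominus>\<^bsub>Y\<^esub> s1) + vnorm Y (y2 \<ominus>\<^bsub>Y\<^esub> s2))"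
    proof -
      define d1 d2 where "d1 = y1 \<ominus>\<^bsub>Y\<^esub> s1" and "d2 = y2 \<ominus>\<^bsub>Y\<^esub> s2"
      have d: "d1 \<in> carrier Y" "d2 \<in> carrier Y" using s yc by (auto simp: d1_def d2_def)
      have "y1 = d1 \<oplus>\<^bsub>Y\<^esub> s1" "y2 = d2 \<oplus>\<^bsub>Y\<^esub> s2"
        using s yc by (simp_all add: d1_def d2_def a_minus_def Y.M.a_assoc Y.M.l_neg)
      then have "y1 \<oplus>\<^bsub>Y\<^esub> y2 = (s1 \<oplus>\<^bsub>Y\<^esub> s2) \<oplus>\<^bsub>Y\<^esub> (d1 \<oplus>\<^bsub>Y\<^esub> d2)"
        using s d by (simp only: Y.M.a_ac Y.M.add.m_closed)
      then show ?thesis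
        using Y.vnorm_triangle[of "s1 \<oplus>\<^bsub>Y\<^esub> s2" "d1 \<oplus>\<^bsub>Y\<^esub> d2"] Y.vnorm_triangle[OF d] s d
        by (simp add: d1_def[symmetric] d2_def[symmetric])
    qed
    ultimately have plus: "norm (1 + c) \<ge> 2 - 6 * e" and minus: "vnorm Y (s1 \<ominus>\<^bsub>Y\<^esub> s2) = norm (1 - c)"
      using mid near \<eta> by linarith+
    have par: "(norm (1 + c))\<^sup>2 + (norm (1 - c))\<^sup>2 = 4"
    proof -
      have "(norm (1 + c))\<^sup>2 + (norm (1 - c))\<^sup>2 = 2 * (norm (1 :: 'k))\<^sup>2 + 2 * (norm c)\<^sup>2"
        unfolding power2_norm_eq_inner by (simp add: inner_add inner_diff inner_commute)
      then show ?thesis using c by simp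
    qed
    have "(2 - 6 * e)\<^sup>2 \<le> (norm (1 + c))\<^sup>2" using plus e by (intro power_mono) auto
    moreover have "(2 - 6 * e)\<^sup>2 = 4 - 24 * e + 36 * (e * e)" by (simp add: power2_eq_square algebra_simps)
    moreover have "0 \<le> e * e" by simp
    ultimately have "(norm (1 - c))\<^sup>2 \<le> 24 * e" using par by linarith
    also have "\<dots> \<le> (\<epsilon> / 4)\<^sup>2" using e by (simp add: power_divide)
    finally have "norm (1 - c) \<le> \<epsilon> / 4" by (rule power2_le_imp_le) (use \<epsilon> in simp)
    moreover have "vnorm Y (y1 \<ominus>\<^bsub>Y\<^esub> y2) \<le> vnorm Y (y1 \<ominus>\<^bsub>Y\<^esub> s1) + (vnorm Y (s1 \<ominus>\<^bsub>Y\<^esub> s2) + vnorm Y (y2 \<ominus>\<^bsub>Y\<^esub> s2))"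
      using Y.vnorm_minus_triangle[OF yc(1) s(1) yc(2)] Y.vnorm_minus_triangle[OF s(1) s(2) yc(2)]
        Y.vnorm_minus_commute[OF yc(2) s(2)] by linarith
    ultimately show ?thesis using near minus e \<epsilon> by linarith
  qed
  then show "\<exists>\<delta>. 0 < \<delta> \<and> \<delta> < 1 \<and> (\<forall>y\<^sub>1\<in>unit_sphere Y. \<forall>y\<^sub>2\<in>unit_sphere Y.
      vnorm Y (y\<^sub>1 \<oplus>\<^bsub>Y\<^esub> y\<^sub>2) / 2 > 1 - \<delta> \<longrightarrow> vnorm Y (y\<^sub>1 \<ominus>\<^bsub>Y\<^esub> y\<^sub>2) < \<epsilon>)"
    using \<eta> e by (intro exI[of _ \<eta>]) auto
qed

section \<open>A norm that is flat in some coordinate at every point\<close>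

text \<open>
  The inequality \<open>flat_quot A w \<le> 1\<close> means \<open>|w\<^sub>0| + (\<Sum>k\<in>A. |w\<^sub>k| - 1/k)/4 \<le> 1\<close>, which is most restrictive
  for the set \<open>A\<close> of those \<open>k\<close> with \<open>|w\<^sub>k| > 1/k\<close>.
\<close>

definition flat_quot :: "nat set \<Rightarrow> (nat \<Rightarrow> 'k::real_normed_field) \<Rightarrow> real" where
  "flat_quot A w = (norm (w 0) + (\<Sum>k\<in>A. norm (w k)) / 4) / (1 + (\<Sum>k\<in>A. 1 / real k) / 4)"

text \<open>
  The unit ball consists of the \<open>w\<close> whose tail \<open>(w\<^sub>1, w\<^sub>2, \<dots>)\<close> lies in the unit ball of \<open>\<ell>\<^sub>1\<close> and which satisfy
  \<open>|w\<^sub>0| + (\<Sum>k. max 0 (|w\<^sub>k| - 1/k))/4 \<le> 1\<close>. Coordinates with \<open>|w\<^sub>k| < 1/k\<close> do not enter the second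
  condition.
\<close>

definition flat_norm :: "(nat \<Rightarrow> 'k::real_normed_field) \<Rightarrow> real" where
  "flat_norm w = max (l1_norm (w(0 := 0))) (SUP A\<in>{A. finite A \<and> 0 \<notin> A}. flat_quot A w)"

lemma flat_denominator_ge_1: "1 \<le> 1 + (\<Sum>k\<in>A. 1 / real k) / 4"
  by (simp add: sum_nonneg)

lemma flat_quot_le_iff:
  "flat_quot A w \<le> r \<longleftrightarrow> norm (w 0) + (\<Sum>k\<in>A. norm (w k)) / 4 \<le> r * (1 + (\<Sum>k\<in>A. 1 / real k) / 4)"
proof -
  have "0 < 1 + (\<Sum>k\<in>A. 1 / real k) / 4" using flat_denominator_ge_1[of A] by linarith
  then show ?thesis unfolding flat_quot_def by (rule pos_divide_le_eq)
qed

lemma flat_quot_le_l1_norm: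
  assumes "w \<in> l1" "finite A" "0 \<notin> A"
  shows "flat_quot A w \<le> l1_norm w"
proof -
  have "norm (w 0) + (\<Sum>k\<in>A. norm (w k)) / 4 \<le> (\<Sum>k\<in>insert 0 A. norm (w k))"
    using assms sum_nonneg[of A "\<lambda>k. norm (w k)"] by simp
  also have "\<dots> \<le> l1_norm w" using assms by (intro sum_norm_le_l1_norm) auto
  also have "\<dots> \<le> l1_norm w * (1 + (\<Sum>k\<in>A. 1 / real k) / 4)"
    using mult_left_mono[OF flat_denominator_ge_1 l1_norm_nonneg[OF assms(1)]] by simp
  finally show ?thesis by (simp add: flat_quot_le_iff)
qed

lemma flat_norm_le_iff:
  assumes "w \<in> l1"
  shows "flat_norm w \<le> r \<longleftrightarrow>
    l1_norm (w(0 := 0)) \<le> r \<and> (\<forall>A. finite A \<longrightarrow> 0 \<notin> A \<longrightarrow> flat_quot A w \<le> r)"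
proof -
  have "bdd_above ((\<lambda>A. flat_quot A w) ` {A. finite A \<and> 0 \<notin> A})"
    using flat_quot_le_l1_norm[OF assms] by (intro bdd_aboveI2[of _ _ "l1_norm w"]) auto
  moreover have "{A :: nat set. finite A \<and> 0 \<notin> A} \<noteq> {}" by (auto intro!: exI[of _ "{}"])
  ultimately show ?thesis
    unfolding flat_norm_def by (simp add: cSUP_le_iff) blast
qed

lemma flat_norm_bounds:
  assumes "w \<in> l1"
  shows "l1_norm (w(0 := 0)) \<le> flat_norm w" "norm (w 0) \<le> flat_norm w"
    "finite A \<Longrightarrow> 0 \<notin> A \<Longrightarrow> flat_quot A w \<le> flat_norm w" "flat_norm w \<le> l1_norm w"
proof -
  show "l1_norm (w(0 := 0)) \<le> flat_norm w"
    and quot: "\<And>A. finite A \<Longrightarrow> 0 \<notin> A \<Longrightarrow> flat_quot A w \<le> flat_norm w"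
    using flat_norm_le_iff[OF assms, of "flat_norm w"] by auto
  show "norm (w 0) \<le> flat_norm w" using quot[of "{}"] by (simp add: flat_quot_def)
  show "flat_norm w \<le> l1_norm w"
    using l1_norm_remove(2)[OF assms, of 0] flat_quot_le_l1_norm[OF assms]
    by (simp add: flat_norm_le_iff[OF assms])
qed

lemma flat_norm_add:
  assumes "w \<in> l1" "v \<in> l1"
  shows "flat_norm (w + v) \<le> flat_norm w + flat_norm v"
proof -
  have "(w + v)(0 := 0) = w(0 := 0) + v(0 := 0)" by (simp add: fun_eq_iff pointwise)
  then have "l1_norm ((w + v)(0 := 0)) \<le> l1_norm (w(0 := 0)) + l1_norm (v(0 := 0))"
    using l1_add[OF l1_norm_remove(1)[OF assms(1)] l1_norm_remove(1)[OF assms(2)], of 0 0] by simp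
  moreover have "flat_quot A (w + v) \<le> flat_quot A w + flat_quot A v" for A
  proof -
    have "norm ((w + v) 0) + (\<Sum>k\<in>A. norm ((w + v) k)) / 4 \<le>
        (norm (w 0) + norm (v 0)) + (\<Sum>k\<in>A. norm (w k) + norm (v k)) / 4"
      by (intro add_mono divide_right_mono sum_mono) (auto simp: pointwise norm_triangle_ineq)
    then have "norm ((w + v) 0) + (\<Sum>k\<in>A. norm ((w + v) k)) / 4 \<le>
        (norm (w 0) + (\<Sum>k\<in>A. norm (w k)) / 4) + (norm (v 0) + (\<Sum>k\<in>A. norm (v k)) / 4)"
      by (simp add: sum.distrib add_divide_distrib)
    then show ?thesis
      unfolding flat_quot_def add_divide_distrib[symmetric, of "norm (w 0) + (\<Sum>k\<in>A. norm (w k)) / 4"]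
      using flat_denominator_ge_1[of A] by (intro divide_right_mono) auto
  qed
  ultimately show ?thesis
    using flat_norm_bounds(1,3)[OF assms(1)] flat_norm_bounds(1,3)[OF assms(2)] l1_add[OF assms]
    by (subst flat_norm_le_iff) (fastforce intro: order_trans add_mono)+
qed

lemma flat_norm_fscale_le:
  assumes "w \<in> l1"
  shows "flat_norm (fscale c w) \<le> norm c * flat_norm w"
proof -
  have "(fscale c w)(0 := 0) = fscale c (w(0 := 0))" by (simp add: fun_eq_iff pointwise)
  then have "l1_norm ((fscale c w)(0 := 0)) = norm c * l1_norm (w(0 := 0))"
    using l1_fscale[OF l1_norm_remove(1)[OF assms], of c 0] by simp
  moreover have "flat_quot A (fscale c w) = norm c * flat_quot A w" for A
    by (simp add: flat_quot_def pointwise norm_mult sum_distrib_left[symmetric] distrib_left)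
  ultimately show ?thesis
    using flat_norm_bounds(1,3)[OF assms] l1_fscale[OF assms, of c]
    by (subst flat_norm_le_iff) (auto intro: mult_left_mono)
qed

lemma flat_norm_fscale:
  assumes w: "w \<in> l1"
  shows "flat_norm (fscale c w) = norm c * flat_norm w"
proof (cases "c = 0")
  case True
  have "0 \<le> flat_norm (fscale c w)"
    using flat_norm_bounds(2)[of "fscale c w"] l1_fscale[OF w, of c] norm_ge_zero[of "fscale c w 0"] by linarith
  then show ?thesis using flat_norm_fscale_le[OF w, of c] True by simp
next
  case False
  have "w = fscale (1 / c) (fscale c w)" using False by (simp add: fun_eq_iff pointwise)
  then have "flat_norm w \<le> norm (1 / c) * flat_norm (fscale c w)"
    using flat_norm_fscale_le[of "fscale c w" "1 / c"] l1_fscale[OF w, of c] by simp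
  then have "norm c * flat_norm w \<le> flat_norm (fscale c w)"
    using False by (simp add: norm_divide field_simps)
  then show ?thesis using flat_norm_fscale_le[OF w, of c] by simp
qed

lemma renormed_l1_flat_norm:
  "renormed_l1 (flat_norm :: (nat \<Rightarrow> 'k::{real_normed_field, euclidean_space}) \<Rightarrow> real) 2"
proof
  fix w :: "nat \<Rightarrow> 'k" assume w: "w \<in> l1"
  show "l1_norm w \<le> 2 * flat_norm w"
    using flat_norm_bounds(1,2)[OF w] l1_norm_remove(2)[OF w, of 0] by simp
  show "flat_norm w \<le> 2 * l1_norm w"
    using flat_norm_bounds(4)[OF w] l1_norm_nonneg[OF w] by simp
qed (auto simp: flat_norm_add flat_norm_fscale)

text \<open>
  As long as \<open>|w\<^sub>k|\<close> stays below \<open>1/k\<close>, a set \<open>A\<close> containing \<open>k\<close> imposes no more than \<open>A - {k}\<close> does.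
\<close>

lemma flat_norm_perturb:
  assumes w: "w \<in> l1" "flat_norm w \<le> 1" and tail: "l1_norm (w(0 := 0)) \<le> 1 / 2"
    and k: "k \<noteq> 0" and t: "norm t \<le> 1 / 2" "norm (w k) + norm t \<le> 1 / real k"
  shows "flat_norm (w + fscale t (unitv k)) \<le> 1"
proof -
  define u where "u = w + fscale t (unitv k)"
  have u: "u \<in> l1" using l1_add[OF w(1)] l1_fscale[OF l1_unitv(1)] by (auto simp: u_def)
  have u_eq: "u j = (if j = k then w k + t else w j)" for j by (simp add: u_def pointwise unitv_apply)
  have "u(0 := 0) = w(0 := 0) + fscale t (unitv k)"
    using k by (auto simp: u_def fun_eq_iff pointwise unitv_apply)
  then have "l1_norm (u(0 := 0)) \<le> 1"
    using l1_add[OF l1_norm_remove(1)[OF w(1)], of "fscale t (unitv k)" 0] tail t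
      l1_fscale[OF l1_unitv(1), of t k] l1_unitv(2)[of k, where 'k = 'a] by simp
  moreover have "flat_quot A u \<le> 1" if A: "finite A" "0 \<notin> A" for A
  proof (cases "k \<in> A")
    case False
    then have "flat_quot A u = flat_quot A w"
      using k unfolding flat_quot_def by (intro arg_cong2[where f = "(/)"] arg_cong2[where f = "(+)"]
        arg_cong2[where f = "(/)" and d = 4] sum.cong refl) (auto simp: u_eq)
    then show ?thesis using flat_norm_bounds(3)[OF w(1) A] w(2) by simp
  next
    case True
    define B where "B = A - {k}"
    have B: "finite B" "0 \<notin> B" "k \<notin> B" "A = insert k B" using A True by (auto simp: B_def)
    have "flat_quot B w \<le> 1" using flat_norm_bounds(3)[OF w(1) B(1,2)] w(2) by simp
    then have "norm (w 0) + (\<Sum>j\<in>B. norm (w j)) / 4 \<le> 1 + (\<Sum>j\<in>B. 1 / real j) / 4"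
      by (simp add: flat_quot_le_iff)
    moreover have "norm (w k + t) \<le> 1 / real k" using norm_triangle_ineq[of "w k" t] t(2) by linarith
    moreover have "(\<Sum>j\<in>B. norm (u j)) = (\<Sum>j\<in>B. norm (w j))"
      using B by (intro sum.cong) (auto simp: u_eq)
    ultimately show ?thesis
      using B k by (simp add: flat_quot_le_iff u_eq add_divide_distrib)
  qed
  ultimately show ?thesis using u by (simp add: flat_norm_le_iff u_def)
qed

lemma harmonic_block_ge: "1 / 2 \<le> (\<Sum>k::nat=2 ^ m..<2 * 2 ^ m. 1 / real k)"
proof -
  have "(\<Sum>k::nat=2 ^ m..<2 * 2 ^ m. 1 / (2 * 2 ^ m)) \<le> (\<Sum>k::nat=2 ^ m..<2 * 2 ^ m. 1 / real k)"
  proof (intro sum_mono)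
    fix k :: nat assume "k \<in> {2 ^ m..<2 * 2 ^ m}"
    then have "0 < k" "real k \<le> real (2 * 2 ^ m)" 
      using zero_less_power[of "2::nat" m] by (auto simp del: of_nat_mult of_nat_power)
    then show "1 / (2 * 2 ^ m) \<le> 1 / real k" by (simp add: frac_le)
  qed
  then show ?thesis by simp
qed

section \<open>Finite dimension\<close>

text \<open>
  The plan of the proof is that of the introduction. In \<open>\<parallel>T\<parallel> \<le> 1\<close> the case \<open>|w\<^sub>0| \<le> 1/2\<close> is crude. In the
  other case each \<open>w\<^sub>k\<close> is split into a part \<open>q\<^sub>k\<close> of modulus at most \<open>1/k\<close> and an excess: the first parts
  contribute at most \<open>\<eta>/4\<close>, the excesses at most \<open>1 - |w\<^sub>0|\<close> by the definition of the norm, and the factor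
  \<open>1 - \<eta>/2\<close> at the coordinate \<open>0\<close> makes up for the \<open>\<eta>/4\<close>.
\<close>

lemma universal_range_imp_finite_dimensional:
  fixes Y :: "('k::{real_normed_field, euclidean_space}, 'a) normed_module"
  assumes Y: "banach_space Y" and univ: "universal_BPBp_RSE_range Y"
    and uc: "uniformly_convex_space Y"
  shows "vectorspace.fin_dim class_ring Y"
proof (rule ccontr)
  assume inf: "\<not> vectorspace.fin_dim class_ring Y"
  interpret Y: banach_space Y by fact
  interpret L: renormed_l1 "flat_norm :: (nat \<Rightarrow> 'k) \<Rightarrow> real" 2 by (rule renormed_l1_flat_norm)
  obtain \<eta> where \<eta>: "0 < \<eta>" "\<eta> < 1 / 16" and
    approx: "\<forall>F v x. finite F \<longrightarrow> (\<forall>k. v k \<in> carrier Y) \<longrightarrow>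
     (\<forall>w\<in>l1. flat_norm w \<le> 1 \<longrightarrow> vnorm Y (Y.comb F v w) \<le> 1) \<longrightarrow>
     x \<in> l1 \<longrightarrow> flat_norm x = 1 \<longrightarrow> vnorm Y (Y.comb F v x) > 1 - \<eta> \<longrightarrow>
     (\<exists>S x0. L.exposing_approximation Y (1 / 16) (Y.comb F v) x S x0)"
    using L.exposing_approximation_exists[OF Y univ, of "1 / 16"] by auto
  obtain m y where y: "\<And>l. y l \<in> carrier Y" "\<And>l. vnorm Y (y l) = 1"
    and small: "\<And>q. (\<And>l. norm (q l) \<le> 1 / 2 ^ m) \<Longrightarrow> vnorm Y (Y.comb {..<2 ^ m} y q) \<le> \<eta>"
    using small_unconditional_sums[OF Y inf uc \<eta>(1)] by blast
  define B :: "nat set" where "B = {2 ^ m..<2 * 2 ^ m}"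
  have B: "finite B" "0 \<notin> B" "B = (\<lambda>l. 2 ^ m + l) ` {..<2 ^ m}"
    unfolding B_def using image_add_atLeastLessThan[of "2 ^ m" 0 "2 ^ m"] by (auto simp: lessThan_atLeast0 mult_2)
  have inj: "inj_on (\<lambda>l :: nat. 2 ^ m + l) {..<2 ^ m}" by (auto simp: inj_on_def)
  define v where "v k = (if k = 0 then (of_real (1 - \<eta> / 2) :: 'k) \<odot>\<^bsub>Y\<^esub> y 0
      else (1 / 4 :: 'k) \<odot>\<^bsub>Y\<^esub> y (k - 2 ^ m))" for k
  have v: "v k \<in> carrier Y" for k using y by (simp add: v_def)
  have v0: "vnorm Y (v 0) = 1 - \<eta> / 2"
  proof -
    have "norm (of_real (1 - \<eta> / 2) :: 'k) = 1 - \<eta> / 2" using \<eta> by (simp only: norm_of_real)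
    then show ?thesis using y by (simp add: v_def Y.vnorm_smult del: of_real_diff)
  qed
  have vk: "vnorm Y (v k) = 1 / 4" if "k \<noteq> 0" for k
    using y that by (simp add: v_def Y.vnorm_smult norm_divide)
  define T where "T = Y.comb (insert 0 B) v"
  have T_eq: "T w = w 0 \<odot>\<^bsub>Y\<^esub> v 0 \<oplus>\<^bsub>Y\<^esub> Y.comb B v w" for w
    unfolding T_def using B v by (intro Y.comb_insert) auto
  have comb_cl: "Y.comb B v w \<in> carrier Y" for w using v by (rule Y.comb_closed)
  have T_split: "vnorm Y (T w) \<le> norm (w 0) * (1 - \<eta> / 2) + vnorm Y (Y.comb B v w)" for w
    using Y.vnorm_triangle[of "w 0 \<odot>\<^bsub>Y\<^esub> v 0" "Y.comb B v w"] v comb_cl by (simp add: T_eq Y.vnorm_smult v0)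
  have block_le: "vnorm Y (Y.comb B v w) \<le> (\<Sum>k\<in>B. norm (w k)) / 4" for w
  proof -
    have "vnorm Y (Y.comb B v w) \<le> (\<Sum>k\<in>B. norm (w k) * vnorm Y (v k))"
      by (rule Y.vnorm_comb_le[OF B(1) v])
    also have "\<dots> = (\<Sum>k\<in>B. norm (w k) / 4)"
    proof (intro sum.cong refl)
      fix k assume "k \<in> B"
      then have "k \<noteq> 0" using B(2) by metis
      then show "norm (w k) * vnorm Y (v k) = norm (w k) / 4" by (simp add: vk)
    qed
    finally show ?thesis by (simp add: sum_divide_distrib)
  qed
  have block_small: "vnorm Y (Y.comb B v q) \<le> \<eta> / 4" if q: "\<And>k. k \<in> B \<Longrightarrow> norm (q k) \<le> 1 / real k" for q
  proof -
    define q' where "q' l = (if l < 2 ^ m then q (2 ^ m + l) else 0)" for l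
    have "norm (q' l) \<le> 1 / 2 ^ m" for l
    proof (cases "l < 2 ^ m")
      case True
      then have "norm (q' l) \<le> 1 / real (2 ^ m + l)" using q[of "2 ^ m + l"] by (simp add: q'_def B_def)
      also have "\<dots> \<le> 1 / 2 ^ m" by (intro frac_le) auto
      finally show ?thesis .
    qed (simp add: q'_def)
    then have le: "vnorm Y (Y.comb {..<2 ^ m} y q') \<le> \<eta>" by (rule small)
    have "Y.comb B v q = (\<Oplus>\<^bsub>Y\<^esub>l\<in>{..<2 ^ m}. q (2 ^ m + l) \<odot>\<^bsub>Y\<^esub> v (2 ^ m + l))"
      unfolding Y.comb_def B(3) using v inj by (intro Y.M.finsum_reindex) auto
    also have "\<dots> = Y.comb {..<2 ^ m} y (fscale (1 / 4) q')"
      unfolding Y.comb_def using y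
      by (intro Y.M.finsum_cong') (auto simp: q'_def v_def pointwise Y.scalar_mult[symmetric])
    also have "\<dots> = (1 / 4) \<odot>\<^bsub>Y\<^esub> Y.comb {..<2 ^ m} y q'" using y by (simp add: Y.comb_fscale)
    finally have "vnorm Y (Y.comb B v q) = vnorm Y (Y.comb {..<2 ^ m} y q') / 4"
      using y by (simp add: Y.vnorm_smult Y.comb_closed norm_divide)
    then show ?thesis using le by simp
  qed
  have T_le: "vnorm Y (T w) \<le> 1" if w: "w \<in> l1" "flat_norm w \<le> 1" for w
  proof (cases "norm (w 0) \<le> 1 / 2")
    case True
    have "(\<Sum>k\<in>B. norm (w k)) = (\<Sum>k\<in>B. norm ((w(0 := 0)) k))"
      using B(2) by (intro sum.cong) auto
    also have "\<dots> \<le> l1_norm (w(0 := 0))" by (rule sum_norm_le_l1_norm[OF l1_norm_remove(1)[OF w(1)] B(1)])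
    also have "\<dots> \<le> 1" using flat_norm_bounds(1)[OF w(1)] w(2) by simp
    finally have "vnorm Y (Y.comb B v w) \<le> 1 / 4" using block_le[of w] by simp
    moreover have "norm (w 0) * (1 - \<eta> / 2) \<le> 1 / 2 * 1" using True \<eta> by (intro mult_mono) auto
    ultimately show ?thesis using T_split[of w] by simp
  next
    case False
    \<comment> \<open>Outside \<open>A\<close> there is no excess, that is, \<open>q k = w k\<close>.\<close>
    define A where "A = {k \<in> B. 1 / real k < norm (w k)}"
    have A: "finite A" "0 \<notin> A" "A \<subseteq> B" using B(1,2) by (auto simp: A_def)
    define q where "q k = (if k \<in> A then of_real (1 / (real k * norm (w k))) * w k else w k)" for k
    have pos: "norm (w k) > 0" "real k > 0" if "k \<in> A" for k
    proof -
      have "k \<noteq> 0" using that A(2) by metis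
      then show k: "real k > 0" by simp
      have "1 / real k < norm (w k)" using that by (simp add: A_def)
      moreover have "0 < 1 / real k" using k by simp
      ultimately show "norm (w k) > 0" by linarith
    qed
    have q_le: "norm (q k) \<le> 1 / real k" if "k \<in> B" for k
      using that pos[of k] by (auto simp: q_def norm_mult norm_divide A_def)
    have rest: "norm ((w - q) k) = norm (w k) - 1 / real k" if k: "k \<in> A" for k
    proof -
      have "(w - q) k = of_real (1 - 1 / (real k * norm (w k))) * w k"
        using k by (simp add: q_def pointwise left_diff_distrib)
      then have "norm ((w - q) k) = \<bar>1 - 1 / (real k * norm (w k))\<bar> * norm (w k)"
        by (simp only: norm_mult norm_of_real)
      also have "\<bar>1 - 1 / (real k * norm (w k))\<bar> = 1 - 1 / (real k * norm (w k))"
        using k pos[OF k] by (intro abs_of_nonneg) (simp add: A_def field_simps)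
      also have "(1 - 1 / (real k * norm (w k))) * norm (w k) = norm (w k) - 1 / real k"
        using pos[OF k] by (simp add: left_diff_distrib)
      finally show ?thesis .
    qed
    have "Y.comb B v w = Y.comb B v (q + (w - q))" by simp
    also have "\<dots> = Y.comb B v q \<oplus>\<^bsub>Y\<^esub> Y.comb B v (w - q)" using v by (rule Y.comb_add)
    finally have "vnorm Y (Y.comb B v w) \<le> vnorm Y (Y.comb B v q) + vnorm Y (Y.comb B v (w - q))"
      using Y.vnorm_triangle[OF comb_cl comb_cl] by simp
    also have "vnorm Y (Y.comb B v q) \<le> \<eta> / 4" by (rule block_small[OF q_le])
    also have "vnorm Y (Y.comb B v (w - q)) \<le> (\<Sum>k\<in>B. norm ((w - q) k)) / 4" by (rule block_le)
    also have "(\<Sum>k\<in>B. norm ((w - q) k)) = (\<Sum>k\<in>A. norm ((w - q) k))"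
      using B(1) A(3) by (intro sum.mono_neutral_right) (auto simp: q_def pointwise)
    also have "\<dots> = (\<Sum>k\<in>A. norm (w k)) - (\<Sum>k\<in>A. 1 / real k)"
      using rest by (simp add: sum_subtractf)
    finally have block: "vnorm Y (Y.comb B v w) \<le> \<eta> / 4 + ((\<Sum>k\<in>A. norm (w k)) - (\<Sum>k\<in>A. 1 / real k)) / 4"
      by simp
    have "flat_quot A w \<le> 1" using flat_norm_bounds(3)[OF w(1) A(1,2)] w(2) by simp
    then have "norm (w 0) + (\<Sum>k\<in>A. norm (w k)) / 4 \<le> 1 + (\<Sum>k\<in>A. 1 / real k) / 4"
      by (simp add: flat_quot_le_iff)
    then have "vnorm Y (T w) \<le> norm (w 0) * (1 - \<eta> / 2) + (\<eta> / 4 + (1 - norm (w 0)))"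
      using T_split[of w] block by (simp add: diff_divide_distrib)
    also have "\<dots> = 1 - (norm (w 0) - 1 / 2) * (\<eta> / 2)" by (simp add: algebra_simps)
    also have "\<dots> \<le> 1" using False \<eta> by simp
    finally show ?thesis .
  qed
  have e0: "(unitv 0 :: nat \<Rightarrow> 'k) \<in> l1" "flat_norm (unitv 0 :: nat \<Rightarrow> 'k) = 1"
    using flat_norm_bounds(2,4)[OF l1_unitv(1), of 0, where 'a = 'k] l1_unitv(2)[of 0, where 'k = 'k]
    by (auto simp: l1_unitv unitv_apply)
  have "T (unitv 0) = v 0" unfolding T_def using B v by (intro Y.comb_unitv) auto
  then have "vnorm Y (T (unitv 0)) > 1 - \<eta>" using v0 \<eta> by simp
  then have "\<exists>S x0. L.exposing_approximation Y (1 / 16) T (unitv 0) S x0"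
    unfolding T_def by (intro approx[rule_format]) (use v T_le[unfolded T_def] e0 B in auto)
  then obtain S x0 where app: "L.exposing_approximation Y (1 / 16) T (unitv 0) S x0" by blast
  note app = app[unfolded L.exposing_approximation_def]
  have Scl: "S w \<in> carrier Y" if "w \<in> l1" for w using app that by blast
  have Sadd: "S (w + u) = S w \<oplus>\<^bsub>Y\<^esub> S u" if "w \<in> l1" "u \<in> l1" for w u using app that by blast
  have Sscale: "S (fscale c w) = c \<odot>\<^bsub>Y\<^esub> S w" if "w \<in> l1" for w c using app that by blast
  have Sle: "vnorm Y (S w) \<le> flat_norm w" if "w \<in> l1" for w using app that by blast
  have x0: "x0 \<in> l1" "flat_norm x0 = 1" "vnorm Y (S x0) = 1" "flat_norm (unitv 0 - x0) < 1 / 16" using app by blast+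
  have close: "vnorm Y (T w \<ominus>\<^bsub>Y\<^esub> S w) \<le> 2 * (1 / 16) * flat_norm w" if "w \<in> l1" for w
    using app that by blast
  have diff: "unitv 0 - x0 \<in> l1" using l1_diff[OF e0(1) x0(1)] by blast
  have "(unitv 0 - x0)(0 := 0) = fscale (-1) (x0(0 := 0))"
    by (simp add: fun_eq_iff pointwise unitv_apply)
  then have "l1_norm ((unitv 0 - x0)(0 := 0)) = l1_norm (x0(0 := 0))"
    using l1_fscale[OF l1_norm_remove(1)[OF x0(1)], of "-1" 0] by simp
  then have tail: "l1_norm (x0(0 := 0)) < 1 / 16"
    using flat_norm_bounds(1)[OF diff] x0(4) by simp
  obtain k where k: "k \<in> B" "norm (x0 k) < 1 / real k"
  proof (rule ccontr)
    assume "\<not> thesis"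
    then have "\<And>k. k \<in> B \<Longrightarrow> 1 / real k \<le> norm (x0 k)" using that by force
    then have "(\<Sum>k\<in>B. 1 / real k) \<le> (\<Sum>k\<in>B. norm (x0 k))" by (rule sum_mono)
    also have "\<dots> = (\<Sum>k\<in>B. norm ((x0(0 := 0)) k))" using B(2) by (intro sum.cong) auto
    also have "\<dots> \<le> l1_norm (x0(0 := 0))" by (rule sum_norm_le_l1_norm[OF l1_norm_remove(1)[OF x0(1)] B(1)])
    finally show False using tail harmonic_block_ge[of m] by (simp add: B_def)
  qed
  have k0: "k \<noteq> 0" using k B by auto
  \<comment> \<open>Moving \<open>x0\<close> by at most \<open>s\<close> in the direction \<open>e\<^sub>k\<close> does not leave the unit ball.\<close>
  define s where "s = min (1 / 2) (1 / real k - norm (x0 k))"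
  have s: "0 < s" "s \<le> 1 / 2" "norm (x0 k) + s \<le> 1 / real k" using k unfolding s_def by linarith+
  define e :: "nat \<Rightarrow> 'k" where "e = unitv k"
  have e: "e \<in> l1" by (simp add: e_def l1_unitv)
  have pert: "x0 + fscale (of_real t) e \<in> l1" "vnorm Y (S (x0 + fscale (of_real t) e)) \<le> 1" if "\<bar>t\<bar> = s" for t
  proof -
    show l: "x0 + fscale (of_real t) e \<in> l1" using l1_add[OF x0(1)] l1_fscale[OF e] by blast
    have "flat_norm (x0 + fscale (of_real t) e) \<le> 1"
      unfolding e_def using x0 tail k0 s that by (intro flat_norm_perturb) auto
    then show "vnorm Y (S (x0 + fscale (of_real t) e)) \<le> 1" using Sle[OF l] by simp
  qed
  define u1 u2 where "u1 = S (x0 + fscale (of_real s) e)" and "u2 = S (x0 + fscale (of_real (- s)) e)"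
  have u: "u1 \<in> carrier Y" "u2 \<in> carrier Y" "vnorm Y u1 \<le> 1" "vnorm Y u2 \<le> 1"
    using pert[of s] pert[of "- s"] s Scl unfolding u1_def u2_def by simp_all
  have "(x0 + fscale (of_real s) e) + (x0 + fscale (of_real (- s)) e) = fscale 2 x0"
    by (simp add: fun_eq_iff pointwise)
  then have "u1 \<oplus>\<^bsub>Y\<^esub> u2 = 2 \<odot>\<^bsub>Y\<^esub> S x0"
    unfolding u1_def u2_def using Sadd[OF pert(1) pert(1), of s "- s"] Sscale[OF x0(1), of 2] s by simp
  then have "vnorm Y (u1 \<oplus>\<^bsub>Y\<^esub> u2) = 2" using Scl[OF x0(1)] x0(3) by (simp add: Y.vnorm_smult)
  then have eq: "u1 = u2" by (intro Y.uniformly_convex_imp_strictly_convex[OF uc] u)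
  have "x0 + fscale (of_real s) e = (x0 + fscale (of_real (- s)) e) + fscale (of_real (2 * s)) e"
    by (simp add: fun_eq_iff pointwise algebra_simps)
  then have "u1 = S ((x0 + fscale (of_real (- s)) e) + fscale (of_real (2 * s)) e)"
    unfolding u1_def by (rule arg_cong)
  also have "\<dots> = u2 \<oplus>\<^bsub>Y\<^esub> S (fscale (of_real (2 * s)) e)"
    unfolding u2_def using pert(1)[of "- s"] l1_fscale[OF e] s by (intro Sadd) auto
  finally have "u1 = u2 \<oplus>\<^bsub>Y\<^esub> of_real (2 * s) \<odot>\<^bsub>Y\<^esub> S e" by (simp only: Sscale[OF e])
  then have "(of_real (2 * s) :: 'k) \<odot>\<^bsub>Y\<^esub> S e = \<zero>\<^bsub>Y\<^esub>"
    using eq u Scl[OF e] by (simp add: Y.M.add.r_cancel_one')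
  then have "norm (of_real (2 * s) :: 'k) * vnorm Y (S e) = 0"
    using Y.vnorm_smult[OF Scl[OF e], of "of_real (2 * s)"] Y.vnorm_zero by metis
  then have Se: "vnorm Y (S e) = 0" using s by simp
  have "T e = v k" unfolding T_def e_def using B k v by (intro Y.comb_unitv) auto
  then have "vnorm Y (T e) = 1 / 4" using vk[OF k0] by simp
  moreover have "vnorm Y (T e) \<le> vnorm Y (T e \<ominus>\<^bsub>Y\<^esub> S e) + vnorm Y (S e)"
    unfolding T_def using v Scl[OF e] by (intro Y.vnorm_add_le_minus) (auto intro: Y.comb_closed)
  moreover have "flat_norm e \<le> 1" using flat_norm_bounds(4)[OF e] by (simp add: e_def l1_unitv)
  ultimately show False using close[OF e] Se by simp
qed

theorem corollary5p6:
  fixes Y_real :: "(real, 'a) normed_module"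
    and Y_complex :: "(complex, 'b) normed_module"
  shows "(banach_space Y_real \<and> universal_BPBp_RSE_range Y_real \<longrightarrow>
            uniformly_convex_space Y_real \<and> vectorspace.fin_dim class_ring Y_real) \<and>
         (banach_space Y_complex \<and> universal_BPBp_RSE_range Y_complex \<longrightarrow>
            uniformly_convex_space Y_complex \<and> vectorspace.fin_dim class_ring Y_complex)"
  by (intro conjI impI; elim conjE;
      intro universal_range_imp_uniformly_convex universal_range_imp_finite_dimensional; assumption)

end
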